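(* Let $Q$ be a quiver of Dynkin type $A_n$, let $T$ be a maximal rigid object of $\mathcal{C}(Q)$, and let $T'$ be the object obtained from $T$ by removing all direct summands of the form $[i,i]$ (loops). Then $T'$ is a loop-free maximal rigid object of $\mathcal{C}(Q)$.
   Context: Category. Let $K$ be an algebraically closed field, $D^b(KQ)$ the bounded derived category of finite-dimensional left modules over the path algebra $KQ$, $\Sigma$ its shift functor and $\tau$ its Auslander-Reiten translate. $\mathcal{C}(Q)$ is the orbit category $D^b(KQ)/\tau\Sigma^2$ (same objects as $D^b(KQ)$, and $\mathrm{Hom}_{\mathcal{C}(Q)}(X,Y)=\bigoplus_{k\in\mathbb{Z}}\mathrm{Hom}_{D^b(KQ)}(X,(\tau\Sigma^2)^kY)$); it is a triangulated Krull-Schmidt category, and $\mathrm{Ext}_{\mathcal{C}(Q)}(X,Y)=\mathrm{Hom}_{\mathcal{C}(Q)}(X,\Sigma Y)$. Geometric model. $P_n$ is a regular $n$-gon (a disk with $n$ marked boundary points) with vertices $1,\dots,n$ numbered clockwise; vertices are taken modulo $n$. $[i,j]$ denotes the oriented edge from $i$ to $j$ (sides of the polygon and loops $[i,i]$ are allowed). Let $\Gamma(n)$ be the translation quiver with vertices all $[i,j]$, $1\le i,j\le n$, arrows $[i,j]\to[i+1,j]$ for $j\ne i+1$ and $[i,j]\to[i,j+1]$ for $i\neq j$, and translation $\tau[i,j]=[i-1,j-1]$. The Auslander-Reiten quiver of $\mathcal{C}(Q)$ is isomorphic to $\Gamma(n)$ as a translation quiver, and $\mathcal{C}(Q)$ is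 equivalent to the additive hull of the mesh category of $\Gamma(n)$; fix such an identification. Thus isomorphism classes of indecomposable objects are identified with the oriented edges $[i,j]$ of $P_n$, and a basic object is identified with the directed graph on the vertices of $P_n$ whose arrows are its indecomposable summands. Rigidity. A basic object $X$ is rigid if $\mathrm{Ext}_{\mathcal{C}(Q)}(X,X)=0$. A maximal rigid object is a basic rigid object $T$ such that every indecomposable $X$ with $\mathrm{Ext}_{\mathcal{C}(Q)}(T\oplus X,T\oplus X)=0$ is a direct summand of $T$. A vertex $i$ of $P_n$ is isolated for an object if no summand of the object (loops included) is an edge incident with $i$. A rigid basic object $T'$ is loop-free maximal rigid if none of its indecomposable direct summands is a loop, and there is no $[i,j]$, with $i,j$ distinct vertices that are non-isolated for $T'$ and $[i,j]$ not a summand of $T'$, such that $T'\oplus[i,j]$ is rigid. *)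

theory Defs
  imports "HOL-Computational_Algebra.Polynomial" "HOL-Library.Function_Algebras"
begin

section \<open>Linear categories and functors\<close>

text \<open>
  The morphism sets of a linear category are subspaces of one ambient vector space (any small
  linear category can be put in this form, by taking the direct sum of all its morphism spaces).
  The same element of the ambient space may belong to several morphism sets, so composition and
  functors carry the objects as arguments: \<open>Comp C X Y Z g f\<close> stands for \<open>g \<circ> f\<close> with
  \<open>f : X \<rightarrow> Y\<close> and \<open>g : Y \<rightarrow> Z\<close>.
\<close>

record ('o, 'm, 'k) lincat =
  Obj :: "'o set"
  Hom :: "'o \<Rightarrow> 'o \<Rightarrow> 'm set"
  Comp :: "'o \<Rightarrow> 'o \<Rightarrow> 'o \<Rightarrow> 'm \<Rightarrow> 'm \<Rightarrow> 'm"
  Idt :: "'o \<Rightarrow> 'm"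
  scl :: "'k \<Rightarrow> 'm \<Rightarrow> 'm"

definition linear_category :: "('o, 'm::ab_group_add, 'k::field) lincat \<Rightarrow> bool" where
  "linear_category C \<longleftrightarrow>
     vector_space (scl C) \<and>
     (\<forall>X\<in>Obj C. \<forall>Y\<in>Obj C. module.subspace (scl C) (Hom C X Y)) \<and>
     (\<forall>X\<in>Obj C. Idt C X \<in> Hom C X X) \<and>
     (\<forall>X\<in>Obj C. \<forall>Y\<in>Obj C. \<forall>f\<in>Hom C X Y.
        Comp C X X Y f (Idt C X) = f \<and> Comp C X Y Y (Idt C Y) f = f) \<and>
     (\<forall>X\<in>Obj C. \<forall>Y\<in>Obj C. \<forall>Z\<in>Obj C. \<forall>f\<in>Hom C X Y. \<forall>g\<in>Hom C Y Z.
        Comp C X Y Z g f \<in> Hom C X Z \<and>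
        (\<forall>f'\<in>Hom C X Y. Comp C X Y Z g (f + f') = Comp C X Y Z g f + Comp C X Y Z g f') \<and>
        (\<forall>g'\<in>Hom C Y Z. Comp C X Y Z (g + g') f = Comp C X Y Z g f + Comp C X Y Z g' f) \<and>
        (\<forall>c. Comp C X Y Z g (scl C c f) = scl C c (Comp C X Y Z g f)) \<and>
        (\<forall>c. Comp C X Y Z (scl C c g) f = scl C c (Comp C X Y Z g f))) \<and>
     (\<forall>W\<in>Obj C. \<forall>X\<in>Obj C. \<forall>Y\<in>Obj C. \<forall>Z\<in>Obj C.
        \<forall>f\<in>Hom C W X. \<forall>g\<in>Hom C X Y. \<forall>h\<in>Hom C Y Z.
        Comp C W X Z (Comp C X Y Z h g) f = Comp C W Y Z h (Comp C W X Y g f))"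

record ('o, 'p, 'm, 'q) lfunctor =
  fobj :: "'o \<Rightarrow> 'p"
  fmor :: "'o \<Rightarrow> 'o \<Rightarrow> 'm \<Rightarrow> 'q"

definition linear_functor ::
  "('o, 'm::ab_group_add, 'k) lincat \<Rightarrow> ('p, 'q::ab_group_add, 'k) lincat
     \<Rightarrow> ('o, 'p, 'm, 'q) lfunctor \<Rightarrow> bool" where
  "linear_functor C D F \<longleftrightarrow>
     (\<forall>X\<in>Obj C. fobj F X \<in> Obj D \<and> fmor F X X (Idt C X) = Idt D (fobj F X)) \<and>
     (\<forall>X\<in>Obj C. \<forall>Y\<in>Obj C. \<forall>f\<in>Hom C X Y.
        fmor F X Y f \<in> Hom D (fobj F X) (fobj F Y) \<and>
        (\<forall>g\<in>Hom C X Y. fmor F X Y (f + g) = fmor F X Y f + fmor F X Y g) \<and>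
        (\<forall>c. fmor F X Y (scl C c f) = scl D c (fmor F X Y f))) \<and>
     (\<forall>X\<in>Obj C. \<forall>Y\<in>Obj C. \<forall>Z\<in>Obj C. \<forall>f\<in>Hom C X Y. \<forall>g\<in>Hom C Y Z.
        fmor F X Z (Comp C X Y Z g f) =
        Comp D (fobj F X) (fobj F Y) (fobj F Z) (fmor F Y Z g) (fmor F X Y f))"

definition automorphism ::
  "('o, 'm::ab_group_add, 'k) lincat \<Rightarrow> ('o, 'o, 'm, 'm) lfunctor \<Rightarrow> bool" where
  "automorphism C F \<longleftrightarrow> linear_functor C C F \<and> bij_betw (fobj F) (Obj C) (Obj C) \<and>
     (\<forall>X\<in>Obj C. \<forall>Y\<in>Obj C.
        bij_betw (fmor F X Y) (Hom C X Y) (Hom C (fobj F X) (fobj F Y)))"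

definition fid :: "('o, 'o, 'm, 'm) lfunctor" where
  "fid = \<lparr>fobj = (\<lambda>X. X), fmor = (\<lambda>X Y f. f)\<rparr>"

definition fcomp ::
  "('p, 'r, 'q, 's) lfunctor \<Rightarrow> ('o, 'p, 'm, 'q) lfunctor \<Rightarrow> ('o, 'r, 'm, 's) lfunctor" where
  "fcomp G F = \<lparr>fobj = (\<lambda>X. fobj G (fobj F X)),
     fmor = (\<lambda>X Y f. fmor G (fobj F X) (fobj F Y) (fmor F X Y f))\<rparr>"

definition finv ::
  "('o, 'm, 'k) lincat \<Rightarrow> ('o, 'o, 'm, 'm) lfunctor \<Rightarrow> ('o, 'o, 'm, 'm) lfunctor" where
  "finv C F = (let G = inv_into (Obj C) (fobj F) in
     \<lparr>fobj = G, fmor = (\<lambda>X Y. inv_into (Hom C (G X) (G Y)) (fmor F (G X) (G Y)))\<rparr>)"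

primrec fiter :: "('o, 'o, 'm, 'm) lfunctor \<Rightarrow> nat \<Rightarrow> ('o, 'o, 'm, 'm) lfunctor" where
  "fiter F 0 = fid"
| "fiter F (Suc k) = fcomp F (fiter F k)"

definition fpow ::
  "('o, 'm, 'k) lincat \<Rightarrow> ('o, 'o, 'm, 'm) lfunctor \<Rightarrow> int \<Rightarrow> ('o, 'o, 'm, 'm) lfunctor" where
  "fpow C F k = (if 0 \<le> k then fiter F (nat k) else fiter (finv C F) (nat (- k)))"

definition is_iso :: "('o, 'm, 'k) lincat \<Rightarrow> 'o \<Rightarrow> 'o \<Rightarrow> 'm \<Rightarrow> bool" where
  "is_iso C X Y f \<longleftrightarrow> f \<in> Hom C X Y \<and>
     (\<exists>g\<in>Hom C Y X. Comp C X Y X g f = Idt C X \<and> Comp C Y X Y f g = Idt C Y)"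

definition isomorphic :: "('o, 'm, 'k) lincat \<Rightarrow> 'o \<Rightarrow> 'o \<Rightarrow> bool" where
  "isomorphic C X Y \<longleftrightarrow> (\<exists>f. is_iso C X Y f)"

definition direct_sum ::
  "('o, 'm::ab_group_add, 'k) lincat \<Rightarrow> 'i set \<Rightarrow> ('i \<Rightarrow> 'o) \<Rightarrow> 'o \<Rightarrow> bool" where
  "direct_sum C I A X \<longleftrightarrow> finite I \<and> A ` I \<subseteq> Obj C \<and> X \<in> Obj C \<and>
     (\<exists>\<iota> \<pi>. (\<forall>i\<in>I. \<iota> i \<in> Hom C (A i) X \<and> \<pi> i \<in> Hom C X (A i)) \<and>
        (\<forall>i\<in>I. \<forall>j\<in>I. Comp C (A i) X (A j) (\<pi> j) (\<iota> i) = (if i = j then Idt C (A i) else 0)) \<and>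
        (\<Sum>i\<in>I. Comp C X (A i) X (\<iota> i) (\<pi> i)) = Idt C X)"

definition direct_sum2 :: "('o, 'm::ab_group_add, 'k) lincat \<Rightarrow> 'o \<Rightarrow> 'o \<Rightarrow> 'o \<Rightarrow> bool" where
  "direct_sum2 C A B X \<longleftrightarrow> direct_sum C UNIV (\<lambda>b. if b then A else B) X"

definition summand :: "('o, 'm::ab_group_add, 'k) lincat \<Rightarrow> 'o \<Rightarrow> 'o \<Rightarrow> bool" where
  "summand C A X \<longleftrightarrow> (\<exists>B. direct_sum2 C A B X)"

definition zero_object :: "('o, 'm::ab_group_add, 'k) lincat \<Rightarrow> 'o \<Rightarrow> bool" where
  "zero_object C X \<longleftrightarrow> X \<in> Obj C \<and> Idt C X = 0"

definition indecomposable :: "('o, 'm::ab_group_add, 'k) lincat \<Rightarrow> 'o \<Rightarrow> bool" where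
  "indecomposable C X \<longleftrightarrow> X \<in> Obj C \<and> \<not> zero_object C X \<and>
     (\<forall>A B. direct_sum2 C A B X \<longrightarrow> zero_object C A \<or> zero_object C B)"

definition basic :: "('o, 'm::ab_group_add, 'k) lincat \<Rightarrow> 'o \<Rightarrow> bool" where
  "basic C X \<longleftrightarrow> X \<in> Obj C \<and>
     \<not> (\<exists>A B. indecomposable C A \<and> direct_sum2 C A A B \<and> summand C B X)"

section \<open>Quivers and complexes of representations\<close>

record ('v, 'a) quiver =
  verts :: "'v set"
  arrs :: "'a set"
  src :: "'a \<Rightarrow> 'v"
  tgt :: "'a \<Rightarrow> 'v"

definition dynkin_A :: "nat \<Rightarrow> ('v, 'a) quiver \<Rightarrow> bool" where
  "dynkin_A n Q \<longleftrightarrow> n \<ge> 1 \<and>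
     (\<exists>v a. bij_betw v {1..n} (verts Q) \<and> bij_betw a {1..<n} (arrs Q) \<and>
        (\<forall>i\<in>{1..<n}. {src Q (a i), tgt Q (a i)} = {v i, v (Suc i)}))"

text \<open>
  Matrices and vectors are functions vanishing outside their index range. The first argument of
  \<open>mmul\<close> and of \<open>mvec\<close> is the number of columns of the left factor.
\<close>

type_synonym 'k mtx = "nat \<Rightarrow> nat \<Rightarrow> 'k"

definition is_mat :: "nat \<Rightarrow> nat \<Rightarrow> 'k::zero mtx \<Rightarrow> bool" where
  "is_mat r c A \<longleftrightarrow> (\<forall>i j. A i j \<noteq> 0 \<longrightarrow> i < r \<and> j < c)"

definition is_vec :: "nat \<Rightarrow> (nat \<Rightarrow> 'k::zero) \<Rightarrow> bool" where
  "is_vec r x \<longleftrightarrow> (\<forall>i. x i \<noteq> 0 \<longrightarrow> i < r)"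

definition mmul :: "nat \<Rightarrow> 'k::comm_ring_1 mtx \<Rightarrow> 'k mtx \<Rightarrow> 'k mtx" where
  "mmul d A B = (\<lambda>i j. \<Sum>l<d. A i l * B l j)"

definition mvec :: "nat \<Rightarrow> 'k::comm_ring_1 mtx \<Rightarrow> (nat \<Rightarrow> 'k) \<Rightarrow> nat \<Rightarrow> 'k" where
  "mvec d A x = (\<lambda>i. \<Sum>l<d. A i l * x l)"

text \<open>
  Finite-dimensional left modules over the path algebra \<open>KQ\<close> are the finite-dimensional
  representations of \<open>Q\<close>; such a module is given, up to isomorphism, by the dimensions at the
  vertices and one matrix for each arrow. In a cochain complex \<open>X\<close> of representations,
  \<open>cdim X p v\<close> is the dimension of \<open>X\<^sup>p\<close> at the vertex \<open>v\<close>, \<open>cact X p a\<close> the matrix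
  of the arrow \<open>a\<close> in \<open>X\<^sup>p\<close>, and \<open>cdiff X p v\<close> the component at \<open>v\<close> of the differential
  from degree \<open>p\<close> to degree \<open>p + 1\<close>.
\<close>

record ('v, 'a, 'k) rcomplex =
  cdim :: "int \<Rightarrow> 'v \<Rightarrow> nat"
  cact :: "int \<Rightarrow> 'a \<Rightarrow> 'k mtx"
  cdiff :: "int \<Rightarrow> 'v \<Rightarrow> 'k mtx"

type_synonym ('v, 'k) cmap = "int \<Rightarrow> 'v \<Rightarrow> 'k mtx"

definition bounded_complex ::
  "('v, 'a) quiver \<Rightarrow> ('v, 'a, 'k::field) rcomplex \<Rightarrow> bool" where
  "bounded_complex Q X \<longleftrightarrow>
     (\<forall>p. \<forall>a\<in>arrs Q. is_mat (cdim X p (tgt Q a)) (cdim X p (src Q a)) (cact X p a)) \<and>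
     (\<forall>p. \<forall>v\<in>verts Q. is_mat (cdim X (p + 1) v) (cdim X p v) (cdiff X p v)) \<and>
     (\<forall>p. \<forall>a\<in>arrs Q.
        mmul (cdim X p (tgt Q a)) (cdiff X p (tgt Q a)) (cact X p a) =
        mmul (cdim X (p + 1) (src Q a)) (cact X (p + 1) a) (cdiff X p (src Q a))) \<and>
     (\<forall>p. \<forall>v\<in>verts Q. mmul (cdim X (p + 1) v) (cdiff X (p + 1) v) (cdiff X p v) = 0) \<and>
     (\<exists>N. \<forall>p. \<forall>v\<in>verts Q. \<bar>p\<bar> > N \<longrightarrow> cdim X p v = 0)"

definition graded_maps ::
  "('v, 'a) quiver \<Rightarrow> int \<Rightarrow> ('v, 'a, 'k::field) rcomplex \<Rightarrow> ('v, 'a, 'k) rcomplex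
     \<Rightarrow> ('v, 'k) cmap set" where
  "graded_maps Q r X Y = {f.
     (\<forall>p v. v \<notin> verts Q \<longrightarrow> f p v = 0) \<and>
     (\<forall>p. \<forall>v\<in>verts Q. is_mat (cdim Y (p + r) v) (cdim X p v) (f p v)) \<and>
     (\<forall>p. \<forall>a\<in>arrs Q.
        mmul (cdim X p (tgt Q a)) (f p (tgt Q a)) (cact X p a) =
        mmul (cdim Y (p + r) (src Q a)) (cact Y (p + r) a) (f p (src Q a)))}"

definition chain_maps ::
  "('v, 'a) quiver \<Rightarrow> ('v, 'a, 'k::field) rcomplex \<Rightarrow> ('v, 'a, 'k) rcomplex
     \<Rightarrow> ('v, 'k) cmap set" where
  "chain_maps Q X Y = {f \<in> graded_maps Q 0 X Y. \<forall>p. \<forall>v\<in>verts Q.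
     mmul (cdim X (p + 1) v) (f (p + 1) v) (cdiff X p v) =
     mmul (cdim Y p v) (cdiff Y p v) (f p v)}"

definition complexes ::
  "('v, 'a) quiver \<Rightarrow> (('v, 'a, 'k::field) rcomplex, ('v, 'k) cmap, 'k) lincat" where
  "complexes Q = \<lparr>
     Obj = {X. bounded_complex Q X},
     Hom = chain_maps Q,
     Comp = (\<lambda>X Y Z g f p v. mmul (cdim Y p v) (g p v) (f p v)),
     Idt = (\<lambda>X p v i j. if v \<in> verts Q \<and> i = j \<and> i < cdim X p v then 1 else 0),
     scl = (\<lambda>c f p v i j. c * f p v i j)\<rparr>"

definition homotopic ::
  "('v, 'a) quiver \<Rightarrow> ('v, 'a, 'k::field) rcomplex \<Rightarrow> ('v, 'a, 'k) rcomplex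
     \<Rightarrow> ('v, 'k) cmap \<Rightarrow> ('v, 'k) cmap \<Rightarrow> bool" where
  "homotopic Q X Y f g \<longleftrightarrow> (\<exists>h\<in>graded_maps Q (- 1) X Y. \<forall>p. \<forall>v\<in>verts Q.
     f p v - g p v = mmul (cdim Y (p - 1) v) (cdiff Y (p - 1) v) (h p v)
                   + mmul (cdim X (p + 1) v) (h (p + 1) v) (cdiff X p v))"

definition cocycles :: "('v, 'a, 'k::field) rcomplex \<Rightarrow> int \<Rightarrow> 'v \<Rightarrow> (nat \<Rightarrow> 'k) set" where
  "cocycles X p v = {x. is_vec (cdim X p v) x \<and> mvec (cdim X p v) (cdiff X p v) x = 0}"

definition coboundaries :: "('v, 'a, 'k::field) rcomplex \<Rightarrow> int \<Rightarrow> 'v \<Rightarrow> (nat \<Rightarrow> 'k) set" where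
  "coboundaries X p v =
     mvec (cdim X (p - 1) v) (cdiff X (p - 1) v) ` {x. is_vec (cdim X (p - 1) v) x}"

definition quasi_iso ::
  "('v, 'a) quiver \<Rightarrow> ('v, 'a, 'k::field) rcomplex \<Rightarrow> ('v, 'a, 'k) rcomplex
     \<Rightarrow> ('v, 'k) cmap \<Rightarrow> bool" where
  "quasi_iso Q X Y s \<longleftrightarrow> s \<in> chain_maps Q X Y \<and> (\<forall>p. \<forall>v\<in>verts Q.
     (\<forall>y\<in>cocycles Y p v. \<exists>x\<in>cocycles X p v.
        y - mvec (cdim X p v) (s p v) x \<in> coboundaries Y p v) \<and>
     (\<forall>x\<in>cocycles X p v. mvec (cdim X p v) (s p v) x \<in> coboundaries Y p v
        \<longrightarrow> x \<in> coboundaries X p v))"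

definition shift_functor ::
  "(('v, 'a, 'k::field) rcomplex, ('v, 'a, 'k) rcomplex, ('v, 'k) cmap, ('v, 'k) cmap) lfunctor"
  where
  "shift_functor = \<lparr>
     fobj = (\<lambda>X. \<lparr>cdim = (\<lambda>p. cdim X (p + 1)), cact = (\<lambda>p. cact X (p + 1)),
                  cdiff = (\<lambda>p v i j. - cdiff X (p + 1) v i j)\<rparr>),
     fmor = (\<lambda>X Y f p. f (p + 1))\<rparr>"

section \<open>The bounded derived category, its shift and its Auslander-Reiten translate\<close>

text \<open>
  The derived category is determined up to equivalence as the localisation \<open>L\<close> of the category
  of bounded complexes at the quasi-isomorphisms. Being a localisation is expressed by the
  calculus of right fractions: every morphism is a fraction \<open>L f \<circ> (L s)\<inverse>\<close>, and \<open>L f = L g\<close>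
  exactly when \<open>f s\<close> and \<open>g s\<close> are homotopic for some quasi-isomorphism \<open>s\<close>. The category is
  described only up to equivalence because forming the orbit category needs the shift and the
  translate to be automorphisms rather than autoequivalences; they are in a skeletal version.
\<close>

definition bounded_derived_category ::
  "('v, 'a) quiver \<Rightarrow> ('o, 'm::ab_group_add, 'k::field) lincat
     \<Rightarrow> (('v, 'a, 'k) rcomplex, 'o, ('v, 'k) cmap, 'm) lfunctor \<Rightarrow> bool" where
  "bounded_derived_category Q D L \<longleftrightarrow>
     linear_category D \<and> linear_functor (complexes Q) D L \<and>
     (\<forall>X Y s. bounded_complex Q X \<and> bounded_complex Q Y \<and> quasi_iso Q X Y s
        \<longrightarrow> is_iso D (fobj L X) (fobj L Y) (fmor L X Y s)) \<and>
     (\<forall>X Y. bounded_complex Q X \<and> bounded_complex Q Y \<longrightarrow>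
        (\<forall>\<phi>\<in>Hom D (fobj L X) (fobj L Y). \<exists>Z s. \<exists>f\<in>chain_maps Q Z Y.
           bounded_complex Q Z \<and> quasi_iso Q Z X s \<and>
           Comp D (fobj L Z) (fobj L X) (fobj L Y) \<phi> (fmor L Z X s) = fmor L Z Y f) \<and>
        (\<forall>f\<in>chain_maps Q X Y. \<forall>g\<in>chain_maps Q X Y.
           fmor L X Y f = fmor L X Y g \<longleftrightarrow>
           (\<exists>Z s. bounded_complex Q Z \<and> quasi_iso Q Z X s \<and>
              homotopic Q Z Y (Comp (complexes Q) Z X Y f s) (Comp (complexes Q) Z X Y g s)))) \<and>
     (\<forall>A\<in>Obj D. \<exists>X. bounded_complex Q X \<and> isomorphic D A (fobj L X))"

definition is_shift ::
  "('v, 'a) quiver \<Rightarrow> ('o, 'm::ab_group_add, 'k::field) lincat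
     \<Rightarrow> (('v, 'a, 'k) rcomplex, 'o, ('v, 'k) cmap, 'm) lfunctor
     \<Rightarrow> ('o, 'o, 'm, 'm) lfunctor \<Rightarrow> bool" where
  "is_shift Q D L \<Sigma> \<longleftrightarrow> automorphism D \<Sigma> \<and>
     (\<exists>\<eta>. let A = fcomp L shift_functor; B = fcomp \<Sigma> L in
        (\<forall>X. bounded_complex Q X \<longrightarrow> is_iso D (fobj A X) (fobj B X) (\<eta> X)) \<and>
        (\<forall>X Y. bounded_complex Q X \<and> bounded_complex Q Y \<longrightarrow> (\<forall>f\<in>chain_maps Q X Y.
           Comp D (fobj A X) (fobj A Y) (fobj B Y) (\<eta> Y) (fmor A X Y f) =
           Comp D (fobj A X) (fobj B X) (fobj B Y) (fmor B X Y f) (\<eta> X))))"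

definition linear_form_on ::
  "('o, 'm::ab_group_add, 'k::field) lincat \<Rightarrow> 'm set \<Rightarrow> ('m \<Rightarrow> 'k) \<Rightarrow> bool" where
  "linear_form_on C V l \<longleftrightarrow> (\<forall>f\<in>V. (\<forall>g\<in>V. l (f + g) = l f + l g) \<and> (\<forall>c. l (scl C c f) = c * l f))"

text \<open>
  A Serre functor \<open>S\<close>: isomorphisms \<open>B X Y\<close> from \<open>Hom(X, Y)\<close> to the dual of \<open>Hom(Y, S X)\<close>,
  natural in \<open>X\<close> and \<open>Y\<close>.
\<close>

definition serre_functor ::
  "('o, 'm::ab_group_add, 'k::field) lincat \<Rightarrow> ('o, 'o, 'm, 'm) lfunctor \<Rightarrow> bool" where
  "serre_functor D S \<longleftrightarrow> automorphism D S \<and> (\<exists>B.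
     (\<forall>X\<in>Obj D. \<forall>Y\<in>Obj D.
        (\<forall>f\<in>Hom D X Y. linear_form_on D (Hom D Y (fobj S X)) (B X Y f)) \<and>
        (\<forall>g\<in>Hom D Y (fobj S X). linear_form_on D (Hom D X Y) (\<lambda>f. B X Y f g)) \<and>
        (\<forall>l. linear_form_on D (Hom D Y (fobj S X)) l \<longrightarrow>
           (\<exists>!f. f \<in> Hom D X Y \<and> (\<forall>g\<in>Hom D Y (fobj S X). B X Y f g = l g)))) \<and>
     (\<forall>X\<in>Obj D. \<forall>Y\<in>Obj D. \<forall>Y'\<in>Obj D.
        \<forall>f\<in>Hom D X Y. \<forall>u\<in>Hom D Y Y'. \<forall>g\<in>Hom D Y' (fobj S X).
        B X Y' (Comp D X Y Y' u f) g = B X Y f (Comp D Y Y' (fobj S X) g u)) \<and>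
     (\<forall>X'\<in>Obj D. \<forall>X\<in>Obj D. \<forall>Y\<in>Obj D.
        \<forall>w\<in>Hom D X' X. \<forall>f\<in>Hom D X Y. \<forall>g\<in>Hom D Y (fobj S X').
        B X' Y (Comp D X' X Y f w) g =
        B X Y f (Comp D Y (fobj S X') (fobj S X) (fmor S X' X w) g)))"

text \<open>The Auslander-Reiten translate is \<open>\<tau> = \<Sigma>\<inverse> S\<close>, where \<open>S\<close> is the Serre functor.\<close>

definition is_ar_translate ::
  "('o, 'm::ab_group_add, 'k::field) lincat \<Rightarrow> ('o, 'o, 'm, 'm) lfunctor
     \<Rightarrow> ('o, 'o, 'm, 'm) lfunctor \<Rightarrow> bool" where
  "is_ar_translate D \<Sigma> \<tau> \<longleftrightarrow> automorphism D \<tau> \<and> serre_functor D (fcomp \<Sigma> \<tau>)"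

section \<open>The orbit category\<close>

text \<open>
  A morphism from \<open>X\<close> to \<open>Y\<close> is a finitely supported family \<open>f\<close> with \<open>f k : X \<rightarrow> F\<^sup>k Y\<close>. The
  composite of \<open>f p : X \<rightarrow> F\<^sup>p Y\<close> and \<open>g q : Y \<rightarrow> F\<^sup>q Z\<close> is \<open>F\<^sup>p (g q) \<circ> f p\<close>, in degree \<open>p + q\<close>.
\<close>

definition orbit_category ::
  "('o, 'm::ab_group_add, 'k) lincat \<Rightarrow> ('o, 'o, 'm, 'm) lfunctor
     \<Rightarrow> ('o, int \<Rightarrow> 'm, 'k) lincat" where
  "orbit_category D F = \<lparr>
     Obj = Obj D,
     Hom = (\<lambda>X Y. {f. finite {k. f k \<noteq> 0} \<and> (\<forall>k. f k \<in> Hom D X (fobj (fpow D F k) Y))}),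
     Comp = (\<lambda>X Y Z g f k. \<Sum>p\<in>{p. f p \<noteq> 0}.
        Comp D X (fobj (fpow D F p) Y) (fobj (fpow D F k) Z)
          (fmor (fpow D F p) Y (fobj (fpow D F (k - p)) Z) (g (k - p))) (f p)),
     Idt = (\<lambda>X k. if k = 0 then Idt D X else 0),
     scl = (\<lambda>c f k. scl D c (f k))\<rparr>"

definition CQ ::
  "('o, 'm::ab_group_add, 'k) lincat \<Rightarrow> ('o, 'o, 'm, 'm) lfunctor \<Rightarrow> ('o, 'o, 'm, 'm) lfunctor
     \<Rightarrow> ('o, int \<Rightarrow> 'm, 'k) lincat" where
  "CQ D \<Sigma> \<tau> = orbit_category D (fcomp \<tau> (fcomp \<Sigma> \<Sigma>))"

section \<open>The translation quiver of oriented edges of the polygon and its mesh category\<close>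

type_synonym edge = "nat \<times> nat"

definition edges :: "nat \<Rightarrow> edge set" where
  "edges n = {1..n} \<times> {1..n}"

definition nxt :: "nat \<Rightarrow> nat \<Rightarrow> nat" where
  "nxt n i = (if i = n then 1 else i + 1)"

definition prv :: "nat \<Rightarrow> nat \<Rightarrow> nat" where
  "prv n i = (if i = 1 then n else i - 1)"

definition gamma_arrow :: "nat \<Rightarrow> edge \<Rightarrow> edge \<Rightarrow> bool" where
  "gamma_arrow n x y \<longleftrightarrow> x \<in> edges n \<and>
     (case x of (i, j) \<Rightarrow> (y = (nxt n i, j) \<and> j \<noteq> nxt n i) \<or> (y = (i, nxt n j) \<and> i \<noteq> j))"

definition gamma_tau :: "nat \<Rightarrow> edge \<Rightarrow> edge" where
  "gamma_tau n x = (prv n (fst x), prv n (snd x))"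

text \<open>\<open>\<Gamma>(n)\<close> has no multiple arrows, so a path is given by the list of vertices it visits.\<close>

definition gamma_path :: "nat \<Rightarrow> edge \<Rightarrow> edge \<Rightarrow> edge list \<Rightarrow> bool" where
  "gamma_path n x y p \<longleftrightarrow> p \<noteq> [] \<and> hd p = x \<and> last p = y \<and> set p \<subseteq> edges n \<and>
     successively (gamma_arrow n) p"

definition path_category :: "nat \<Rightarrow> (edge, edge list \<Rightarrow> 'k::field, 'k) lincat" where
  "path_category n = \<lparr>
     Obj = edges n,
     Hom = (\<lambda>x y. {f. finite {p. f p \<noteq> 0} \<and> (\<forall>p. f p \<noteq> 0 \<longrightarrow> gamma_path n x y p)}),
     Comp = (\<lambda>x y z g f r. \<Sum>p\<in>{p. f p \<noteq> 0}. \<Sum>q\<in>{q. g q \<noteq> 0}.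
        if r = p @ tl q then g q * f p else 0),
     Idt = (\<lambda>x p. if p = [x] then 1 else 0),
     scl = (\<lambda>c f p. c * f p)\<rparr>"

definition mesh_relation :: "nat \<Rightarrow> edge \<Rightarrow> edge list \<Rightarrow> 'k::field" where
  "mesh_relation n z p = (if \<exists>y. gamma_arrow n y z \<and> p = [gamma_tau n z, y, z] then 1 else 0)"

inductive mesh_ideal :: "nat \<Rightarrow> edge \<Rightarrow> edge \<Rightarrow> (edge list \<Rightarrow> 'k::field) \<Rightarrow> bool" for n where
  relation: "z \<in> edges n \<Longrightarrow> mesh_ideal n (gamma_tau n z) z (mesh_relation n z)"
| zero: "x \<in> edges n \<Longrightarrow> y \<in> edges n \<Longrightarrow> mesh_ideal n x y 0"
| add: "mesh_ideal n x y f \<Longrightarrow> mesh_ideal n x y g \<Longrightarrow> mesh_ideal n x y (f + g)"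
| scale: "mesh_ideal n x y f \<Longrightarrow> mesh_ideal n x y (scl (path_category n) c f)"
| left: "mesh_ideal n x y f \<Longrightarrow> z \<in> edges n \<Longrightarrow> g \<in> Hom (path_category n) y z \<Longrightarrow>
    mesh_ideal n x z (Comp (path_category n) x y z g f)"
| right: "mesh_ideal n y z g \<Longrightarrow> x \<in> edges n \<Longrightarrow> f \<in> Hom (path_category n) x y \<Longrightarrow>
    mesh_ideal n x z (Comp (path_category n) x y z g f)"

text \<open>
  An equivalence between \<open>C\<close> and the additive hull of the mesh category of \<open>\<Gamma>(n)\<close>, compatible
  with the translations. The mesh category is the quotient of the path category by the mesh
  ideal, so a fully faithful functor on it is a full functor on the path category whose kernel is
  the mesh ideal. It extends to an equivalence from the additive hull exactly when all finite
  direct sums of its values exist in \<open>C\<close> and exhaust the objects of \<open>C\<close>.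
\<close>

definition identification ::
  "nat \<Rightarrow> ('o, 'm::ab_group_add, 'k::field) lincat \<Rightarrow> ('o \<Rightarrow> 'o)
     \<Rightarrow> (edge, 'o, edge list \<Rightarrow> 'k, 'm) lfunctor \<Rightarrow> bool" where
  "identification n C t \<Psi> \<longleftrightarrow>
     linear_functor (path_category n) C \<Psi> \<and>
     (\<forall>x\<in>edges n. \<forall>y\<in>edges n.
        fmor \<Psi> x y ` Hom (path_category n) x y = Hom C (fobj \<Psi> x) (fobj \<Psi> y) \<and>
        (\<forall>f\<in>Hom (path_category n) x y. fmor \<Psi> x y f = 0 \<longleftrightarrow> mesh_ideal n x y f)) \<and>
     (\<forall>xs. set xs \<subseteq> edges n \<longrightarrow>
        (\<exists>X. direct_sum C {..<length xs} (\<lambda>k. fobj \<Psi> (xs ! k)) X)) \<and>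
     (\<forall>X\<in>Obj C. \<exists>xs. set xs \<subseteq> edges n \<and>
        direct_sum C {..<length xs} (\<lambda>k. fobj \<Psi> (xs ! k)) X) \<and>
     (\<forall>x\<in>edges n. isomorphic C (t (fobj \<Psi> x)) (fobj \<Psi> (gamma_tau n x)))"

section \<open>Rigidity\<close>

text \<open>
  Below, \<open>s\<close> is the action of the shift of \<open>C\<close> on objects, and
  \<open>E [i, j]\<close> is the indecomposable object identified with the oriented edge \<open>[i, j]\<close>.
\<close>

definition Ext :: "('o, 'm, 'k) lincat \<Rightarrow> ('o \<Rightarrow> 'o) \<Rightarrow> 'o \<Rightarrow> 'o \<Rightarrow> 'm set" where
  "Ext C s X Y = Hom C X (s Y)"

definition ext_free :: "('o, 'm::ab_group_add, 'k) lincat \<Rightarrow> ('o \<Rightarrow> 'o) \<Rightarrow> 'o \<Rightarrow> bool" where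
  "ext_free C s X \<longleftrightarrow> Ext C s X X = {0}"

definition rigid :: "('o, 'm::ab_group_add, 'k) lincat \<Rightarrow> ('o \<Rightarrow> 'o) \<Rightarrow> 'o \<Rightarrow> bool" where
  "rigid C s X \<longleftrightarrow> basic C X \<and> ext_free C s X"

definition maximal_rigid :: "('o, 'm::ab_group_add, 'k) lincat \<Rightarrow> ('o \<Rightarrow> 'o) \<Rightarrow> 'o \<Rightarrow> bool" where
  "maximal_rigid C s T \<longleftrightarrow> rigid C s T \<and>
     (\<forall>X Y. indecomposable C X \<and> direct_sum2 C T X Y \<and> ext_free C s Y \<longrightarrow> summand C X T)"

definition isolated ::
  "nat \<Rightarrow> ('o, 'm::ab_group_add, 'k) lincat \<Rightarrow> (edge \<Rightarrow> 'o) \<Rightarrow> 'o \<Rightarrow> nat \<Rightarrow> bool" where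
  "isolated n C E T i \<longleftrightarrow> \<not> (\<exists>x\<in>edges n. summand C (E x) T \<and> (fst x = i \<or> snd x = i))"

definition loop_free_maximal_rigid ::
  "nat \<Rightarrow> ('o, 'm::ab_group_add, 'k) lincat \<Rightarrow> ('o \<Rightarrow> 'o) \<Rightarrow> (edge \<Rightarrow> 'o) \<Rightarrow> 'o \<Rightarrow> bool" where
  "loop_free_maximal_rigid n C s E T \<longleftrightarrow> rigid C s T \<and>
     (\<forall>i\<in>{1..n}. \<not> summand C (E (i, i)) T) \<and>
     \<not> (\<exists>i\<in>{1..n}. \<exists>j\<in>{1..n}. i \<noteq> j \<and> \<not> isolated n C E T i \<and> \<not> isolated n C E T j \<and>
          \<not> summand C (E (i, j)) T \<and> (\<exists>Y. direct_sum2 C T (E (i, j)) Y \<and> rigid C s Y))"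

definition remove_loops ::
  "nat \<Rightarrow> ('o, 'm::ab_group_add, 'k) lincat \<Rightarrow> (edge \<Rightarrow> 'o) \<Rightarrow> 'o \<Rightarrow> 'o \<Rightarrow> bool" where
  "remove_loops n C E T T' \<longleftrightarrow> (\<exists>G\<subseteq>edges n. direct_sum C G E T \<and>
     direct_sum C {x\<in>G. fst x \<noteq> snd x} E T')"

end

theory Submission
  imports Defs
begin

text \<open>
  In the orbit category \<open>\<tau>\<Sigma>\<^sup>2\<close> is the identity, so Serre duality turns \<open>Ext(X, Y) = 0\<close> into
  \<open>Hom(Y, \<tau>X) = 0\<close>, and for edges this is read off the mesh category of \<open>\<Gamma>(n)\<close>: a loop \<open>[k, k]\<close>
  conflicts exactly with the edges that start at \<open>k - 1\<close> or end at \<open>k + 1\<close>, and two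
  consecutive edges \<open>[i, j]\<close>, \<open>[j, m]\<close> with \<open>i \<noteq> j \<noteq> m\<close> always conflict. Suppose \<open>[i, j]\<close> is
  compatible with \<open>T'\<close> and conflicts with a loop of \<open>T\<close>, say with \<open>i = k - 1\<close>. No edge of \<open>T'\<close>
  starts at \<open>i\<close>, because it would conflict with the loop, and none ends at \<open>i\<close>, because it would
  conflict with \<open>[i, j]\<close>; so \<open>i\<close> is isolated for \<open>T'\<close>. The case \<open>j = k + 1\<close> is symmetric. Hence
  an edge between non-isolated vertices that is compatible with \<open>T'\<close> is compatible with \<open>T\<close>.
\<close>

section \<open>Direct sums in linear categories\<close>

text \<open>Two obstacles shape the proof. First, \<Sigma> and F = \<tau>\<Sigma>\<Sigma> are not
  known to commute, and neither \<Sigma> nor \<tau> is turned into a functor on the orbit category.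
  Rigidity only asks whether Hom spaces vanish, so natural isomorphisms are replaced throughout by
  equivalences of vanishing statements; Serre duality alone yields such an equivalence between
  \<Sigma> F^k and F^k \<Sigma>. Second, the mesh ideal is generated inductively, and membership in
  it is decided from two sides. Outside it, a path is certified by a linear form that kills the
  ideal, read off a signed one-dimensional representation on a rectangle of \<Gamma>(n). Inside it,
  a path is rewritten by mesh relations until it runs off \<Gamma>(n). The rewriting also kills all
  nontrivial cycles, so edges have endomorphism ring k. The part of Krull-Schmidt theory that
  relates summands to edges then becomes a rank argument over k instead of one about local
  rings.\<close>

locale lin_category =
  fixes C :: "('o, 'm::ab_group_add, 'k::field) lincat"
  assumes linear: "linear_category C"
begin

lemma scl_vector_space: "vector_space (scl C)"
  using linear unfolding linear_category_def by blast

lemma hom_subspace: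
  "X \<in> Obj C \<Longrightarrow> Y \<in> Obj C \<Longrightarrow> module.subspace (scl C) (Hom C X Y)"
  using linear unfolding linear_category_def by (elim conjE) simp

interpretation vs: vector_space "scl C"
  by (rule scl_vector_space)

lemma hom_zero: "X \<in> Obj C \<Longrightarrow> Y \<in> Obj C \<Longrightarrow> 0 \<in> Hom C X Y"
  using hom_subspace vs.subspace_0 by blast

lemma hom_add:
  "X \<in> Obj C \<Longrightarrow> Y \<in> Obj C \<Longrightarrow> f \<in> Hom C X Y \<Longrightarrow> g \<in> Hom C X Y \<Longrightarrow> f + g \<in> Hom C X Y"
  using hom_subspace vs.subspace_add by blast

lemma hom_scl:
  "X \<in> Obj C \<Longrightarrow> Y \<in> Obj C \<Longrightarrow> f \<in> Hom C X Y \<Longrightarrow> scl C c f \<in> Hom C X Y"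
  using hom_subspace vs.subspace_scale by blast

lemma hom_sum:
  assumes "X \<in> Obj C" "Y \<in> Obj C" "\<And>i. i \<in> I \<Longrightarrow> f i \<in> Hom C X Y"
  shows "sum f I \<in> Hom C X Y"
  using assms by (intro vs.subspace_sum hom_subspace) auto

lemma id_hom: "X \<in> Obj C \<Longrightarrow> Idt C X \<in> Hom C X X"
  using linear unfolding linear_category_def by blast

lemma comp_id_right:
  "X \<in> Obj C \<Longrightarrow> Y \<in> Obj C \<Longrightarrow> f \<in> Hom C X Y \<Longrightarrow> Comp C X X Y f (Idt C X) = f"
  using linear unfolding linear_category_def by blast

lemma comp_id_left:
  "X \<in> Obj C \<Longrightarrow> Y \<in> Obj C \<Longrightarrow> f \<in> Hom C X Y \<Longrightarrow> Comp C X Y Y (Idt C Y) f = f"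
  using linear unfolding linear_category_def by blast

context
  fixes X Y Z
  assumes obj: "X \<in> Obj C" "Y \<in> Obj C" "Z \<in> Obj C"
begin

lemma comp_hom: "f \<in> Hom C X Y \<Longrightarrow> g \<in> Hom C Y Z \<Longrightarrow> Comp C X Y Z g f \<in> Hom C X Z"
  using linear obj unfolding linear_category_def by blast

lemma comp_add_right:
  "f \<in> Hom C X Y \<Longrightarrow> f' \<in> Hom C X Y \<Longrightarrow> g \<in> Hom C Y Z \<Longrightarrow>
   Comp C X Y Z g (f + f') = Comp C X Y Z g f + Comp C X Y Z g f'"
  using linear obj unfolding linear_category_def by blast

lemma comp_add_left:
  "f \<in> Hom C X Y \<Longrightarrow> g \<in> Hom C Y Z \<Longrightarrow> g' \<in> Hom C Y Z \<Longrightarrow>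
   Comp C X Y Z (g + g') f = Comp C X Y Z g f + Comp C X Y Z g' f"
  using linear obj unfolding linear_category_def by blast

lemma comp_scl_right:
  "f \<in> Hom C X Y \<Longrightarrow> g \<in> Hom C Y Z \<Longrightarrow>
   Comp C X Y Z g (scl C c f) = scl C c (Comp C X Y Z g f)"
  using linear obj unfolding linear_category_def by blast

lemma comp_scl_left:
  "f \<in> Hom C X Y \<Longrightarrow> g \<in> Hom C Y Z \<Longrightarrow>
   Comp C X Y Z (scl C c g) f = scl C c (Comp C X Y Z g f)"
  using linear obj unfolding linear_category_def by blast

lemma comp_zero_right: "g \<in> Hom C Y Z \<Longrightarrow> Comp C X Y Z g 0 = 0"
  using comp_add_right[of 0 0 g] obj by (simp add: hom_zero)

lemma comp_zero_left: "f \<in> Hom C X Y \<Longrightarrow> Comp C X Y Z 0 f = 0"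
  using comp_add_left[of f 0 0] obj by (simp add: hom_zero)

lemma comp_sum_right:
  assumes "\<And>i. i \<in> I \<Longrightarrow> f i \<in> Hom C X Y" "g \<in> Hom C Y Z"
  shows "Comp C X Y Z g (sum f I) = (\<Sum>i\<in>I. Comp C X Y Z g (f i))"
  using assms
proof (induction I rule: infinite_finite_induct)
  case (insert i I)
  then show ?case
    using obj by (simp add: comp_add_right hom_sum)
qed (simp_all add: comp_zero_right)

lemma comp_sum_left:
  assumes "\<And>i. i \<in> I \<Longrightarrow> g i \<in> Hom C Y Z" "f \<in> Hom C X Y"
  shows "Comp C X Y Z (sum g I) f = (\<Sum>i\<in>I. Comp C X Y Z (g i) f)"
  using assms
proof (induction I rule: infinite_finite_induct)
  case (insert i I)
  then show ?case
    using obj by (simp add: comp_add_left hom_sum)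
qed (simp_all add: comp_zero_left)

end

lemma comp_assoc:
  "W \<in> Obj C \<Longrightarrow> X \<in> Obj C \<Longrightarrow> Y \<in> Obj C \<Longrightarrow> Z \<in> Obj C \<Longrightarrow>
   f \<in> Hom C W X \<Longrightarrow> g \<in> Hom C X Y \<Longrightarrow> h \<in> Hom C Y Z \<Longrightarrow>
   Comp C W X Z (Comp C X Y Z h g) f = Comp C W Y Z h (Comp C W X Y g f)"
  using linear unfolding linear_category_def by blast

lemma comp_four:
  assumes "U \<in> Obj C" "V \<in> Obj C" "W \<in> Obj C" "X \<in> Obj C" "Y \<in> Obj C"
    and "f \<in> Hom C U V" "g \<in> Hom C V W" "h \<in> Hom C W X" "k \<in> Hom C X Y"
  shows "Comp C U W Y (Comp C W X Y k h) (Comp C U V W g f) =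
         Comp C U X Y k (Comp C U V X (Comp C V W X h g) f)"
  using assms by (simp add: comp_assoc comp_hom)

text \<open>Block matrix multiplication through X: orthogonality of \<open>p\<close> and
  \<open>b\<close> leaves only the diagonal blocks. The index sets may differ, so equal and disjoint
  ones, the two cases met in \<open>direct_sum_Un\<close>, are both instances.\<close>

lemma comp_sums_orthogonal:
  assumes "finite I" "finite J" "A ` (I \<union> J) \<subseteq> Obj C" "W \<in> Obj C" "X \<in> Obj C" "Z \<in> Obj C"
    and "\<And>i. i \<in> I \<Longrightarrow> a i \<in> Hom C (A i) Z" "\<And>i. i \<in> I \<Longrightarrow> p i \<in> Hom C X (A i)"
    and "\<And>j. j \<in> J \<Longrightarrow> b j \<in> Hom C (A j) X" "\<And>j. j \<in> J \<Longrightarrow> q j \<in> Hom C W (A j)"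
    and orth: "\<And>i j. i \<in> I \<Longrightarrow> j \<in> J \<Longrightarrow>
      Comp C (A j) X (A i) (p i) (b j) = (if j = i then Idt C (A j) else 0)"
  shows "Comp C W X Z (\<Sum>i\<in>I. Comp C X (A i) Z (a i) (p i)) (\<Sum>j\<in>J. Comp C W (A j) X (b j) (q j))
       = (\<Sum>i\<in>I \<inter> J. Comp C W (A i) Z (a i) (q i))"
proof -
  have A: "A i \<in> Obj C" if "i \<in> I \<union> J" for i
    using assms(3) that by blast
  have "Comp C W X Z (\<Sum>i\<in>I. Comp C X (A i) Z (a i) (p i)) (\<Sum>j\<in>J. Comp C W (A j) X (b j) (q j))
      = (\<Sum>i\<in>I. \<Sum>j\<in>J. Comp C W X Z (Comp C X (A i) Z (a i) (p i)) (Comp C W (A j) X (b j) (q j)))"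
    using assms A
    by (subst sum.swap) (simp add: comp_sum_left comp_sum_right comp_hom hom_sum)
  also have "\<dots> = (\<Sum>i\<in>I. \<Sum>j\<in>J. if j = i then Comp C W (A i) Z (a i) (q i) else 0)"
  proof (intro sum.cong refl)
    fix i j assume ij: "i \<in> I" "j \<in> J"
    have "Comp C W X Z (Comp C X (A i) Z (a i) (p i)) (Comp C W (A j) X (b j) (q j)) =
       Comp C W (A i) Z (a i) (Comp C W (A j) (A i) (Comp C (A j) X (A i) (p i) (b j)) (q j))"
      using ij assms A by (intro comp_four) auto
    then show "Comp C W X Z (Comp C X (A i) Z (a i) (p i)) (Comp C W (A j) X (b j) (q j)) =
       (if j = i then Comp C W (A i) Z (a i) (q i) else 0)"
      using ij assms A by (auto simp: orth comp_id_left comp_zero_left comp_zero_right)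
  qed
  also have "\<dots> = (\<Sum>i\<in>I. if i \<in> J then Comp C W (A i) Z (a i) (q i) else 0)"
    using assms(2) by simp
  also have "\<dots> = (\<Sum>i\<in>I \<inter> J. Comp C W (A i) Z (a i) (q i))"
    using assms(1) by (simp add: sum.inter_restrict)
  finally show ?thesis .
qed

lemma direct_sumE:
  assumes "direct_sum C I A X"
  obtains \<iota> \<pi> where "finite I" "X \<in> Obj C" "\<And>i. i \<in> I \<Longrightarrow> A i \<in> Obj C"
    "\<And>i. i \<in> I \<Longrightarrow> \<iota> i \<in> Hom C (A i) X" "\<And>i. i \<in> I \<Longrightarrow> \<pi> i \<in> Hom C X (A i)"
    "\<And>i j. i \<in> I \<Longrightarrow> j \<in> I \<Longrightarrow>
       Comp C (A i) X (A j) (\<pi> j) (\<iota> i) = (if i = j then Idt C (A i) else 0)"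
    "(\<Sum>i\<in>I. Comp C X (A i) X (\<iota> i) (\<pi> i)) = Idt C X"
proof -
  obtain \<iota> \<pi> where "\<forall>i\<in>I. \<iota> i \<in> Hom C (A i) X \<and> \<pi> i \<in> Hom C X (A i)"
    "\<forall>i\<in>I. \<forall>j\<in>I. Comp C (A i) X (A j) (\<pi> j) (\<iota> i) = (if i = j then Idt C (A i) else 0)"
    "(\<Sum>i\<in>I. Comp C X (A i) X (\<iota> i) (\<pi> i)) = Idt C X"
    using assms unfolding direct_sum_def by (elim conjE exE)
  then show ?thesis
    using assms unfolding direct_sum_def by (intro that[of \<iota> \<pi>]) auto
qed

lemma direct_sum_retract:
  assumes "direct_sum C I A X" "i \<in> I"
  obtains u v where "u \<in> Hom C (A i) X" "v \<in> Hom C X (A i)"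
    "Comp C (A i) X (A i) v u = Idt C (A i)"
proof -
  obtain \<iota> \<pi> where "finite I" "X \<in> Obj C" "\<And>i. i \<in> I \<Longrightarrow> A i \<in> Obj C"
    "\<And>i. i \<in> I \<Longrightarrow> \<iota> i \<in> Hom C (A i) X" "\<And>i. i \<in> I \<Longrightarrow> \<pi> i \<in> Hom C X (A i)"
    "\<And>i j. i \<in> I \<Longrightarrow> j \<in> I \<Longrightarrow>
       Comp C (A i) X (A j) (\<pi> j) (\<iota> i) = (if i = j then Idt C (A i) else 0)"
    "(\<Sum>i\<in>I. Comp C X (A i) X (\<iota> i) (\<pi> i)) = Idt C X"
    by (rule direct_sumE[OF assms(1)]) (rule that)
  note ds = this
  show ?thesis
    using that[OF ds(4)[OF assms(2)] ds(5)[OF assms(2)]] ds(6)[OF assms(2) assms(2)] by simp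
qed

text \<open>A map out of X is determined by its restrictions to the summands, and each summand is a
  retract. Only the first argument is treated; the second is reached later by duality, in
  \<open>Ext_direct_sum_right\<close>.\<close>

lemma direct_sum_hom_zero_iff:
  assumes "direct_sum C I A X" "W \<in> Obj C"
  shows "Hom C X W = {0} \<longleftrightarrow> (\<forall>i\<in>I. Hom C (A i) W = {0})"
proof -
  obtain \<iota> \<pi> where ds: "finite I" "X \<in> Obj C" "\<And>i. i \<in> I \<Longrightarrow> A i \<in> Obj C"
    "\<And>i. i \<in> I \<Longrightarrow> \<iota> i \<in> Hom C (A i) X" "\<And>i. i \<in> I \<Longrightarrow> \<pi> i \<in> Hom C X (A i)"
    "\<And>i j. i \<in> I \<Longrightarrow> j \<in> I \<Longrightarrow>
       Comp C (A i) X (A j) (\<pi> j) (\<iota> i) = (if i = j then Idt C (A i) else 0)"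
    "(\<Sum>i\<in>I. Comp C X (A i) X (\<iota> i) (\<pi> i)) = Idt C X"
    by (rule direct_sumE[OF assms(1)]) (rule that)
  show ?thesis
  proof (intro iffI ballI)
    fix i assume i: "i \<in> I" and X: "Hom C X W = {0}"
    have "f = 0" if f: "f \<in> Hom C (A i) W" for f
    proof -
      have "Comp C X (A i) W f (\<pi> i) = 0"
        using comp_hom[of X "A i" W "\<pi> i" f] X f i ds assms(2) by auto
      then have "Comp C (A i) X W 0 (\<iota> i) = Comp C (A i) (A i) W f (Comp C (A i) X (A i) (\<pi> i) (\<iota> i))"
        using comp_assoc[of "A i" X "A i" W "\<iota> i" "\<pi> i" f] f i ds assms(2) by simp
      then show ?thesis
        using f i ds assms(2) by (simp add: comp_id_right comp_zero_left)
    qed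
    then show "Hom C (A i) W = {0}"
      using hom_zero ds i assms(2) by blast
  next
    assume A: "\<forall>i\<in>I. Hom C (A i) W = {0}"
    have "f = 0" if f: "f \<in> Hom C X W" for f
    proof -
      have "f = Comp C X X W f (\<Sum>i\<in>I. Comp C X (A i) X (\<iota> i) (\<pi> i))"
        using f ds assms(2) by (simp add: comp_id_right)
      also have "\<dots> = (\<Sum>i\<in>I. Comp C X (A i) W (Comp C (A i) X W f (\<iota> i)) (\<pi> i))"
        using f ds(1-5) assms(2) by (simp add: comp_sum_right comp_hom comp_assoc)
      also have "\<dots> = (\<Sum>i\<in>I. 0)"
      proof (intro sum.cong refl)
        fix i assume i: "i \<in> I"
        have "Comp C (A i) X W f (\<iota> i) \<in> Hom C (A i) W"
          using f i ds assms(2) by (intro comp_hom) auto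
        then show "Comp C X (A i) W (Comp C (A i) X W f (\<iota> i)) (\<pi> i) = 0"
          using A i ds assms(2) by (auto simp: comp_zero_left)
      qed
      finally show ?thesis by simp
    qed
    then show "Hom C X W = {0}"
      using hom_zero ds assms(2) by blast
  qed
qed

lemma direct_sum_reindex:
  assumes "direct_sum C I A X" "bij_betw h J I"
  shows "direct_sum C J (\<lambda>j. A (h j)) X"
proof -
  obtain \<iota> \<pi> where ds: "finite I" "X \<in> Obj C" "\<And>i. i \<in> I \<Longrightarrow> A i \<in> Obj C"
    "\<And>i. i \<in> I \<Longrightarrow> \<iota> i \<in> Hom C (A i) X" "\<And>i. i \<in> I \<Longrightarrow> \<pi> i \<in> Hom C X (A i)"
    "\<And>i j. i \<in> I \<Longrightarrow> j \<in> I \<Longrightarrow>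
       Comp C (A i) X (A j) (\<pi> j) (\<iota> i) = (if i = j then Idt C (A i) else 0)"
    "(\<Sum>i\<in>I. Comp C X (A i) X (\<iota> i) (\<pi> i)) = Idt C X"
    by (rule direct_sumE[OF assms(1)]) (rule that)
  have h: "h j \<in> I" if "j \<in> J" for j
    using assms(2) that bij_betwE by blast
  have inj: "h i = h j \<longleftrightarrow> i = j" if "i \<in> J" "j \<in> J" for i j
    using assms(2) that by (auto simp: bij_betw_def inj_on_def)
  have "(\<Sum>j\<in>J. Comp C X (A (h j)) X (\<iota> (h j)) (\<pi> (h j))) = Idt C X"
    using sum.reindex_bij_betw[OF assms(2), of "\<lambda>i. Comp C X (A i) X (\<iota> i) (\<pi> i)"] ds by simp
  then show ?thesis
    unfolding direct_sum_def
    using ds h inj bij_betw_finite[OF assms(2)]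
    by (intro conjI exI[of _ "\<lambda>j. \<iota> (h j)"] exI[of _ "\<lambda>j. \<pi> (h j)"]) auto
qed

lemma direct_sum_cong:
  assumes "direct_sum C I A X" "\<And>i. i \<in> I \<Longrightarrow> A i = B i"
  shows "direct_sum C I B X"
proof -
  obtain \<iota> \<pi> where ds: "finite I" "X \<in> Obj C" "\<And>i. i \<in> I \<Longrightarrow> A i \<in> Obj C"
    "\<And>i. i \<in> I \<Longrightarrow> \<iota> i \<in> Hom C (A i) X" "\<And>i. i \<in> I \<Longrightarrow> \<pi> i \<in> Hom C X (A i)"
    "\<And>i j. i \<in> I \<Longrightarrow> j \<in> I \<Longrightarrow>
       Comp C (A i) X (A j) (\<pi> j) (\<iota> i) = (if i = j then Idt C (A i) else 0)"
    "(\<Sum>i\<in>I. Comp C X (A i) X (\<iota> i) (\<pi> i)) = Idt C X"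
    by (rule direct_sumE[OF assms(1)]) (rule that)
  have "(\<Sum>i\<in>I. Comp C X (B i) X (\<iota> i) (\<pi> i)) = Idt C X"
    using ds(7) assms(2) by simp
  then show ?thesis
    unfolding direct_sum_def using ds(1-6) assms(2)
    by (intro conjI exI[of _ \<iota>] exI[of _ \<pi>]) auto
qed

lemma direct_sum_singleton:
  assumes "A i \<in> Obj C"
  shows "direct_sum C {i} A (A i)"
  unfolding direct_sum_def using assms
  by (auto intro!: exI[of _ "\<lambda>i. Idt C (A i)"] simp: id_hom comp_id_left)

text \<open>The maps between X and the partial sums pass through the common summands
  \<open>A i\<close>. The six composites that the biproduct identities involve are then all cases of
  \<open>comp_sums_orthogonal\<close>.\<close>

lemma direct_sum_Un:
  assumes X: "direct_sum C (I \<union> J) A X" and "direct_sum C I A X1" "direct_sum C J A X2"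
    and "I \<inter> J = {}"
  shows "direct_sum2 C X1 X2 X"
proof -
  obtain \<iota> \<pi> where ds: "finite (I \<union> J)" "X \<in> Obj C" "\<And>i. i \<in> I \<union> J \<Longrightarrow> A i \<in> Obj C"
    "\<And>i. i \<in> I \<union> J \<Longrightarrow> \<iota> i \<in> Hom C (A i) X" "\<And>i. i \<in> I \<union> J \<Longrightarrow> \<pi> i \<in> Hom C X (A i)"
    "\<And>i j. i \<in> I \<union> J \<Longrightarrow> j \<in> I \<union> J \<Longrightarrow>
       Comp C (A i) X (A j) (\<pi> j) (\<iota> i) = (if i = j then Idt C (A i) else 0)"
    "(\<Sum>i\<in>I \<union> J. Comp C X (A i) X (\<iota> i) (\<pi> i)) = Idt C X"
    by (rule direct_sumE[OF assms(1)]) (rule that)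
  obtain \<iota>1 \<pi>1 where ds1: "finite I" "X1 \<in> Obj C" "\<And>i. i \<in> I \<Longrightarrow> A i \<in> Obj C"
    "\<And>i. i \<in> I \<Longrightarrow> \<iota>1 i \<in> Hom C (A i) X1" "\<And>i. i \<in> I \<Longrightarrow> \<pi>1 i \<in> Hom C X1 (A i)"
    "\<And>i j. i \<in> I \<Longrightarrow> j \<in> I \<Longrightarrow>
       Comp C (A i) X1 (A j) (\<pi>1 j) (\<iota>1 i) = (if i = j then Idt C (A i) else 0)"
    "(\<Sum>i\<in>I. Comp C X1 (A i) X1 (\<iota>1 i) (\<pi>1 i)) = Idt C X1"
    by (rule direct_sumE[OF assms(2)]) (rule that)
  obtain \<iota>2 \<pi>2 where ds2: "finite J" "X2 \<in> Obj C" "\<And>i. i \<in> J \<Longrightarrow> A i \<in> Obj C"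
    "\<And>i. i \<in> J \<Longrightarrow> \<iota>2 i \<in> Hom C (A i) X2" "\<And>i. i \<in> J \<Longrightarrow> \<pi>2 i \<in> Hom C X2 (A i)"
    "\<And>i j. i \<in> J \<Longrightarrow> j \<in> J \<Longrightarrow>
       Comp C (A i) X2 (A j) (\<pi>2 j) (\<iota>2 i) = (if i = j then Idt C (A i) else 0)"
    "(\<Sum>i\<in>J. Comp C X2 (A i) X2 (\<iota>2 i) (\<pi>2 i)) = Idt C X2"
    by (rule direct_sumE[OF assms(3)]) (rule that)
  have fin: "finite I" "finite J" using ds(1) by auto
  have A: "A ` (I \<union> J) \<subseteq> Obj C" "A ` I \<subseteq> Obj C" "A ` J \<subseteq> Obj C" using ds by auto
  define u1 where "u1 = (\<Sum>i\<in>I. Comp C X1 (A i) X (\<iota> i) (\<pi>1 i))"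
  define v1 where "v1 = (\<Sum>i\<in>I. Comp C X (A i) X1 (\<iota>1 i) (\<pi> i))"
  define u2 where "u2 = (\<Sum>i\<in>J. Comp C X2 (A i) X (\<iota> i) (\<pi>2 i))"
  define v2 where "v2 = (\<Sum>i\<in>J. Comp C X (A i) X2 (\<iota>2 i) (\<pi> i))"
  have hom: "u1 \<in> Hom C X1 X" "v1 \<in> Hom C X X1" "u2 \<in> Hom C X2 X" "v2 \<in> Hom C X X2"
    unfolding u1_def u2_def v1_def v2_def using ds ds1 ds2 by (auto intro!: hom_sum comp_hom)
  have "Comp C X1 X X1 v1 u1 = (\<Sum>i\<in>I \<inter> I. Comp C X1 (A i) X1 (\<iota>1 i) (\<pi>1 i))"
    unfolding u1_def v1_def using ds ds1 fin A by (intro comp_sums_orthogonal) auto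
  moreover have "Comp C X2 X X2 v2 u2 = (\<Sum>i\<in>J \<inter> J. Comp C X2 (A i) X2 (\<iota>2 i) (\<pi>2 i))"
    unfolding u2_def v2_def using ds ds2 fin A by (intro comp_sums_orthogonal) auto
  moreover have "Comp C X1 X X2 v2 u1 = (\<Sum>i\<in>J \<inter> I. Comp C X1 (A i) X2 (\<iota>2 i) (\<pi>1 i))"
    unfolding u1_def v2_def using ds ds1 ds2 fin A by (intro comp_sums_orthogonal) auto
  moreover have "Comp C X2 X X1 v1 u2 = (\<Sum>i\<in>I \<inter> J. Comp C X2 (A i) X1 (\<iota>1 i) (\<pi>2 i))"
    unfolding u2_def v1_def using ds ds1 ds2 fin A by (intro comp_sums_orthogonal) auto
  moreover have "Comp C X X1 X u1 v1 = (\<Sum>i\<in>I \<inter> I. Comp C X (A i) X (\<iota> i) (\<pi> i))"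
    unfolding u1_def v1_def using ds ds1 fin A by (intro comp_sums_orthogonal) auto
  moreover have "Comp C X X2 X u2 v2 = (\<Sum>i\<in>J \<inter> J. Comp C X (A i) X (\<iota> i) (\<pi> i))"
    unfolding u2_def v2_def using ds ds2 fin A by (intro comp_sums_orthogonal) auto
  moreover have "(\<Sum>i\<in>I. Comp C X (A i) X (\<iota> i) (\<pi> i)) + (\<Sum>i\<in>J. Comp C X (A i) X (\<iota> i) (\<pi> i))
      = Idt C X"
    using sum.union_disjoint[OF fin \<open>I \<inter> J = {}\<close>] ds(7) by metis
  moreover have "J \<inter> I = {}" using \<open>I \<inter> J = {}\<close> by blast
  ultimately have eqs: "Comp C X1 X X1 v1 u1 = Idt C X1" "Comp C X2 X X2 v2 u2 = Idt C X2"
    "Comp C X1 X X2 v2 u1 = 0" "Comp C X2 X X1 v1 u2 = 0"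
    "Comp C X X1 X u1 v1 + Comp C X X2 X u2 v2 = Idt C X"
    using ds1(7) ds2(7) \<open>I \<inter> J = {}\<close> by simp_all
  show ?thesis
    unfolding direct_sum2_def direct_sum_def UNIV_bool
    apply (intro conjI)
    subgoal by simp
    subgoal using ds1(2) ds2(2) by simp
    subgoal by (fact ds(2))
    apply (rule exI[of _ "\<lambda>b. if b then u1 else u2"])
    apply (rule exI[of _ "\<lambda>b. if b then v1 else v2"])
    using hom eqs by (simp add: add.commute)
qed

lemma direct_sum2E:
  assumes "direct_sum2 C A B X"
  obtains \<iota> \<pi> \<iota>' \<pi>' where "X \<in> Obj C" "A \<in> Obj C" "B \<in> Obj C"
    "\<iota> \<in> Hom C A X" "\<pi> \<in> Hom C X A" "\<iota>' \<in> Hom C B X" "\<pi>' \<in> Hom C X B"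
    "Comp C A X A \<pi> \<iota> = Idt C A" "Comp C B X B \<pi>' \<iota>' = Idt C B"
    "Comp C A X B \<pi>' \<iota> = 0" "Comp C B X A \<pi> \<iota>' = 0"
    "Comp C X A X \<iota> \<pi> + Comp C X B X \<iota>' \<pi>' = Idt C X"
proof -
  obtain \<iota> \<pi> where "finite (UNIV :: bool set)" "X \<in> Obj C" "\<And>i. i \<in> (UNIV :: bool set) \<Longrightarrow> (if i then A else B) \<in> Obj C"
    "\<And>i. i \<in> UNIV \<Longrightarrow> \<iota> i \<in> Hom C (if i then A else B) X"
    "\<And>i. i \<in> UNIV \<Longrightarrow> \<pi> i \<in> Hom C X (if i then A else B)"
    "\<And>i j. i \<in> UNIV \<Longrightarrow> j \<in> UNIV \<Longrightarrow>
       Comp C (if i then A else B) X (if j then A else B) (\<pi> j) (\<iota> i) =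
         (if i = j then Idt C (if i then A else B) else 0)"
    "(\<Sum>i\<in>UNIV. Comp C X (if i then A else B) X (\<iota> i) (\<pi> i)) = Idt C X"
    by (rule direct_sumE[OF assms[unfolded direct_sum2_def]]) (rule that)
  note ds = this
  show ?thesis
    using ds(2) ds(3)[of True] ds(3)[of False] ds(4)[of True] ds(4)[of False] ds(5)[of True]
      ds(5)[of False] ds(6)[of True True] ds(6)[of True False] ds(6)[of False True]
      ds(6)[of False False] ds(7)
    by (intro that[of "\<iota> True" "\<pi> True" "\<iota> False" "\<pi> False"]) (auto simp: UNIV_bool add.commute)
qed

text \<open>The identity of A equals its own square, and regrouping the four factors puts the zero
  map \<iota> \<pi> in the middle.\<close>

lemma zero_object_if_comp_zero:
  assumes "A \<in> Obj C" "X \<in> Obj C" "\<iota> \<in> Hom C A X" "\<pi> \<in> Hom C X A"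
    and "Comp C A X A \<pi> \<iota> = Idt C A" "Comp C X A X \<iota> \<pi> = 0"
  shows "zero_object C A"
proof -
  have "Idt C A = Comp C A X A (Comp C X A A (Idt C A) \<pi>) \<iota>"
    using assms by (simp add: comp_id_left)
  also have "\<dots> = Comp C A X A (Comp C X A A (Comp C A X A \<pi> \<iota>) \<pi>) \<iota>"
    using assms by simp
  also have "\<dots> = Comp C A X A (Comp C X X A \<pi> (Comp C X A X \<iota> \<pi>)) \<iota>"
    using assms by (subst comp_assoc[of X A X A \<pi> \<iota> \<pi>]) auto
  also have "\<dots> = 0"
    using assms by (simp add: comp_zero_left comp_zero_right)
  finally show ?thesis
    using assms unfolding zero_object_def by blast
qed

end

text \<open>
  Pairwise non-isomorphic objects with endomorphism ring \<open>k\<close>, no two of which compose to a nonzero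
  cycle: under these hypotheses the Krull-Schmidt property is linear algebra over \<open>k\<close>.
\<close>

locale schur_family = lin_category C
  for C :: "('o, 'm::ab_group_add, 'k::field) lincat" +
  fixes S :: "'e set" and E :: "'e \<Rightarrow> 'o"
  assumes E_obj: "x \<in> S \<Longrightarrow> E x \<in> Obj C"
    and E_nonzero: "x \<in> S \<Longrightarrow> Idt C (E x) \<noteq> 0"
    and E_end: "x \<in> S \<Longrightarrow> f \<in> Hom C (E x) (E x) \<Longrightarrow> \<exists>c. f = scl C c (Idt C (E x))"
    and E_cycle: "x \<in> S \<Longrightarrow> y \<in> S \<Longrightarrow> x \<noteq> y \<Longrightarrow> f \<in> Hom C (E x) (E y) \<Longrightarrow>
      g \<in> Hom C (E y) (E x) \<Longrightarrow> Comp C (E x) (E y) (E x) g f = 0"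
    and sums_exist: "set xs \<subseteq> S \<Longrightarrow> \<exists>X. direct_sum C {..<length xs} (\<lambda>k. E (xs ! k)) X"
    and decomposition: "X \<in> Obj C \<Longrightarrow>
      \<exists>xs. set xs \<subseteq> S \<and> direct_sum C {..<length xs} (\<lambda>k. E (xs ! k)) X"
begin

interpretation vs: vector_space "scl C"
  by (rule scl_vector_space)

text \<open>Expand the identity of X over G. By \<open>E_cycle\<close> only the summand z
  contributes to an endomorphism of \<open>E z\<close> through X, and its endomorphisms are scalars.
  As G is a set, z occurs at most once, so the pairing of Hom(E z, X) with Hom(X, E z) is a product
  of two functions: a matrix of rank at most one.\<close>

lemma comp_through_sum:
  assumes "direct_sum C G E X" "G \<subseteq> S" "z \<in> S"
  obtains p i where "\<And>a b. a \<in> Hom C (E z) X \<Longrightarrow> b \<in> Hom C X (E z) \<Longrightarrow>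
    Comp C (E z) X (E z) b a \<noteq> 0 \<Longrightarrow> z \<in> G"
    and "\<And>a b. a \<in> Hom C (E z) X \<Longrightarrow> b \<in> Hom C X (E z) \<Longrightarrow>
      Comp C (E z) X (E z) b a = scl C (i b * p a) (Idt C (E z))"
proof -
  obtain \<iota> \<pi> where ds0: "finite G" "X \<in> Obj C" "\<And>x. x \<in> G \<Longrightarrow> E x \<in> Obj C"
    "\<And>x. x \<in> G \<Longrightarrow> \<iota> x \<in> Hom C (E x) X" "\<And>x. x \<in> G \<Longrightarrow> \<pi> x \<in> Hom C X (E x)"
    "\<And>x y. x \<in> G \<Longrightarrow> y \<in> G \<Longrightarrow>
       Comp C (E x) X (E y) (\<pi> y) (\<iota> x) = (if x = y then Idt C (E x) else 0)"
    "(\<Sum>x\<in>G. Comp C X (E x) X (\<iota> x) (\<pi> x)) = Idt C X"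
    by (rule direct_sumE[OF assms(1)]) (rule that)
  note obj = ds0(3)
  note ds = ds0(1,2,4,5,7)
  note z = E_obj[OF assms(3)]
  have expand: "Comp C (E z) X (E z) b a =
     (if z \<in> G then Comp C (E z) (E z) (E z) (Comp C (E z) X (E z) b (\<iota> z))
        (Comp C (E z) X (E z) (\<pi> z) a) else 0)"
    if a: "a \<in> Hom C (E z) X" and b: "b \<in> Hom C X (E z)" for a b
  proof -
    have "Comp C (E z) X (E z) b a = Comp C (E z) X (E z) b (Comp C (E z) X X (Idt C X) a)"
      using a ds(2) z by (simp add: comp_id_left)
    also have "\<dots> = (\<Sum>x\<in>G. Comp C (E z) X (E z) b (Comp C (E z) X X (Comp C X (E x) X (\<iota> x) (\<pi> x)) a))"
      using a b ds z obj by (simp flip: ds(5) add: comp_sum_left comp_sum_right comp_hom)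
    also have "\<dots> = (\<Sum>x\<in>G. Comp C (E z) (E x) (E z) (Comp C (E x) X (E z) b (\<iota> x))
        (Comp C (E z) X (E x) (\<pi> x) a))"
      using a b ds z obj by (intro sum.cong refl) (simp add: comp_four comp_hom)
    also have "\<dots> = (\<Sum>x\<in>G. if x = z then Comp C (E z) (E z) (E z) (Comp C (E z) X (E z) b (\<iota> z))
        (Comp C (E z) X (E z) (\<pi> z) a) else 0)"
    proof (intro sum.cong refl)
      fix x assume x: "x \<in> G"
      have "Comp C (E z) X (E x) (\<pi> x) a \<in> Hom C (E z) (E x)"
        "Comp C (E x) X (E z) b (\<iota> x) \<in> Hom C (E x) (E z)"
        using a b x ds z obj by (auto intro!: comp_hom)
      then show "Comp C (E z) (E x) (E z) (Comp C (E x) X (E z) b (\<iota> x))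
          (Comp C (E z) X (E x) (\<pi> x) a) = (if x = z then Comp C (E z) (E z) (E z)
          (Comp C (E z) X (E z) b (\<iota> z)) (Comp C (E z) X (E z) (\<pi> z) a) else 0)"
        using E_cycle[of z x] x assms by auto
    qed
    finally show ?thesis
      using ds(1) by simp
  qed
  \<comment> \<open>Coordinates of a and b at the summand z, taken by choice because
    \<open>E_end\<close> only asserts that a scalar exists.\<close>
  define p where "p a = (SOME c. Comp C (E z) X (E z) (\<pi> z) a = scl C c (Idt C (E z)))" for a
  define i where "i b = (SOME c. Comp C (E z) X (E z) b (\<iota> z) = scl C c (Idt C (E z)))" for b
  have p: "Comp C (E z) X (E z) (\<pi> z) a = scl C (p a) (Idt C (E z))"
    if "a \<in> Hom C (E z) X" "z \<in> G" for a
    unfolding p_def using E_end[OF assms(3)] that ds z by (metis (mono_tags, lifting) comp_hom someI_ex)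
  have i: "Comp C (E z) X (E z) b (\<iota> z) = scl C (i b) (Idt C (E z))"
    if "b \<in> Hom C X (E z)" "z \<in> G" for b
    unfolding i_def using E_end[OF assms(3)] that ds z by (metis (mono_tags, lifting) comp_hom someI_ex)
  \<comment> \<open>For z outside G the whole pairing is zero, which the factor 0 encodes.\<close>
  have "Comp C (E z) X (E z) b a = scl C ((if z \<in> G then i b else 0) * p a) (Idt C (E z))"
    if "a \<in> Hom C (E z) X" "b \<in> Hom C X (E z)" for a b
    using expand[OF that] p[OF that(1)] i[OF that(2)] z
    by (auto simp: comp_scl_left comp_scl_right comp_id_left id_hom hom_scl)
  then show ?thesis
    using expand that[of "\<lambda>b. if z \<in> G then i b else 0" p] by presburger
qed

lemma scl_id_eq_iff: "x \<in> S \<Longrightarrow> scl C a (Idt C (E x)) = scl C b (Idt C (E x)) \<longleftrightarrow> a = b"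
  using E_nonzero by simp

text \<open>The uniqueness half of Krull-Schmidt for sums of distinct members: the identity of
  \<open>E z\<close> factors through X and is not zero.\<close>

lemma summand_imp_mem:
  assumes "direct_sum C G E X" "G \<subseteq> S" "z \<in> S" "summand C (E z) X"
  shows "z \<in> G"
proof -
  obtain B where "direct_sum2 C (E z) B X"
    using assms(4) unfolding summand_def by blast
  then obtain a b where "a \<in> Hom C (E z) X" "b \<in> Hom C X (E z)"
    "Comp C (E z) X (E z) b a = Idt C (E z)"
    by (elim direct_sum2E) blast
  then show ?thesis
    using comp_through_sum[OF assms(1-3)] E_nonzero[OF assms(3)] by metis
qed

text \<open>Basicness quantifies over all indecomposables A, while only the members
  \<open>E z\<close> are understood. So some \<open>E z\<close> is chosen inside A, and its two
  copies in X are tested against the pairing of \<open>comp_through_sum\<close>.\<close>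

lemma direct_sum_basic:
  assumes "direct_sum C G E X" "G \<subseteq> S"
  shows "basic C X"
proof -
  have False if A: "indecomposable C A" and B: "direct_sum2 C A A B" "summand C B X" for A B
  proof -
    have AO: "A \<in> Obj C" "Idt C A \<noteq> 0"
      using A unfolding indecomposable_def zero_object_def by auto
    then obtain xs where xs: "set xs \<subseteq> S" "direct_sum C {..<length xs} (\<lambda>k. E (xs ! k)) A"
      using decomposition by blast
    \<comment> \<open>The empty sum would make the identity of A zero.\<close>
    have "xs \<noteq> []"
      using xs(2) AO(2) unfolding direct_sum_def by auto
    then have 0: "0 \<in> {..<length xs}" by simp
    define z where "z = xs ! 0"
    have z: "z \<in> S"
      using xs(1) \<open>xs \<noteq> []\<close> by (auto simp: z_def)
    obtain u v where uv: "u \<in> Hom C (E z) A" "v \<in> Hom C A (E z)" "Comp C (E z) A (E z) v u = Idt C (E z)"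
      using direct_sum_retract[OF xs(2) 0] unfolding z_def by metis
    obtain \<iota> \<pi> \<iota>' \<pi>' where B0: "B \<in> Obj C" "A \<in> Obj C" "A \<in> Obj C"
      "\<iota> \<in> Hom C A B" "\<pi> \<in> Hom C B A" "\<iota>' \<in> Hom C A B" "\<pi>' \<in> Hom C B A"
      "Comp C A B A \<pi> \<iota> = Idt C A" "Comp C A B A \<pi>' \<iota>' = Idt C A"
      "Comp C A B A \<pi>' \<iota> = 0" "Comp C A B A \<pi> \<iota>' = 0"
      "Comp C B A B \<iota> \<pi> + Comp C B A B \<iota>' \<pi>' = Idt C B"
      by (rule direct_sum2E[OF B(1)]) (rule that)
    note B1 = B0(1,4-11)
    obtain K where "direct_sum2 C B K X"
      using B(2) unfolding summand_def by blast
    then obtain j q where B2: "X \<in> Obj C" "j \<in> Hom C B X" "q \<in> Hom C X B" "Comp C B X B q j = Idt C B"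
      by (elim direct_sum2E) blast
    define a where "a i = Comp C (E z) B X j (Comp C (E z) A B i u)" for i
    define b where "b p = Comp C X B (E z) (Comp C B A (E z) v p) q" for p
    note z' = E_obj[OF z]
    have hom: "a i \<in> Hom C (E z) X" if "i \<in> Hom C A B" for i
      unfolding a_def using that uv B1(1) B2 AO z' by (intro comp_hom) auto
    have hom': "b p \<in> Hom C X (E z)" if "p \<in> Hom C B A" for p
      unfolding b_def using that uv B1(1) B2 AO z' by (intro comp_hom) auto
    have ab: "Comp C (E z) X (E z) (b p) (a i) =
        Comp C (E z) A (E z) v (Comp C (E z) A A (Comp C A B A p i) u)"
      if "p \<in> Hom C B A" "i \<in> Hom C A B" for p i
    proof -
      have "Comp C (E z) X (E z) (b p) (a i) = Comp C (E z) B (E z) (Comp C B A (E z) v p)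
         (Comp C (E z) B B (Comp C B X B q j) (Comp C (E z) A B i u))"
        unfolding a_def b_def using that uv B1(1) B2 AO z' by (intro comp_four comp_hom) auto
      also have "\<dots> = Comp C (E z) B (E z) (Comp C B A (E z) v p) (Comp C (E z) A B i u)"
        using that uv B1(1) B2 AO z' by (simp add: comp_id_left comp_hom)
      also have "\<dots> = Comp C (E z) A (E z) v (Comp C (E z) A A (Comp C A B A p i) u)"
        using that uv B1(1) B2 AO z' by (intro comp_four) auto
      finally show ?thesis .
    qed
    have id: "Comp C (E z) X (E z) (b p) (a i) = scl C 1 (Idt C (E z))"
      if "p \<in> Hom C B A" "i \<in> Hom C A B" "Comp C A B A p i = Idt C A" for p i
      using ab[OF that(1,2)] that(3) uv AO z' by (simp add: comp_id_left)
    have zr: "Comp C (E z) X (E z) (b p) (a i) = scl C 0 (Idt C (E z))"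
      if "p \<in> Hom C B A" "i \<in> Hom C A B" "Comp C A B A p i = 0" for p i
      using ab[OF that(1,2)] that(3) uv AO z' by (simp add: comp_zero_left comp_zero_right)
    obtain r t where rt: "\<And>a b. a \<in> Hom C (E z) X \<Longrightarrow> b \<in> Hom C X (E z) \<Longrightarrow>
      Comp C (E z) X (E z) b a = scl C (t b * r a) (Idt C (E z))"
      using comp_through_sum[OF assms z] by metis
    \<comment> \<open>the identity matrix of size two would have rank one\<close>
    have "t (b \<pi>) * r (a \<iota>) = 1" "t (b \<pi>') * r (a \<iota>') = 1" "t (b \<pi>') * r (a \<iota>) = 0"
      using rt[OF hom hom'] id zr B1 scl_id_eq_iff[OF z] by metis+
    then show False by auto
  qed
  then show ?thesis
    using assms(1) unfolding basic_def direct_sum_def by blast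
qed

text \<open>The idempotent \<iota> \<pi> belonging to A is a scalar c, and c \<iota> = \<iota>. If c
  = 0 or \<iota> = 0 then A is zero; if c = 1 nothing is left for B.\<close>

lemma E_indecomposable:
  assumes "z \<in> S"
  shows "indecomposable C (E z)"
proof -
  have "zero_object C A \<or> zero_object C B" if "direct_sum2 C A B (E z)" for A B
  proof -
    obtain \<iota> \<pi> \<iota>' \<pi>' where ds: "E z \<in> Obj C" "A \<in> Obj C" "B \<in> Obj C"
      "\<iota> \<in> Hom C A (E z)" "\<pi> \<in> Hom C (E z) A" "\<iota>' \<in> Hom C B (E z)" "\<pi>' \<in> Hom C (E z) B"
      "Comp C A (E z) A \<pi> \<iota> = Idt C A" "Comp C B (E z) B \<pi>' \<iota>' = Idt C B"
      "Comp C A (E z) B \<pi>' \<iota> = 0" "Comp C B (E z) A \<pi> \<iota>' = 0"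
      "Comp C (E z) A (E z) \<iota> \<pi> + Comp C (E z) B (E z) \<iota>' \<pi>' = Idt C (E z)"
      by (rule direct_sum2E[OF \<open>direct_sum2 C A B (E z)\<close>]) (rule that)
    obtain c where c: "Comp C (E z) A (E z) \<iota> \<pi> = scl C c (Idt C (E z))"
      using E_end[OF assms] ds by (metis comp_hom)
    show ?thesis
    proof (cases "c = 0")
      case True
      then show ?thesis
        using zero_object_if_comp_zero[of A "E z" \<iota> \<pi>] ds c by simp
    next
      case False
      have "Comp C A (E z) (E z) (Comp C (E z) A (E z) \<iota> \<pi>) \<iota>
          = Comp C A A (E z) \<iota> (Comp C A (E z) A \<pi> \<iota>)"
        using ds by (intro comp_assoc) auto
      then have "scl C c \<iota> = \<iota>"
        using ds c by (simp add: comp_scl_left id_hom comp_id_left comp_id_right)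
      then have 1: "c = 1 \<or> \<iota> = 0"
        by (metis vs.scale_cancel_right vs.scale_one)
      show ?thesis
      proof (cases "\<iota> = 0")
        case True
        then show ?thesis
          using ds by (auto simp: zero_object_def comp_zero_right)
      next
        case False
        then have "Comp C (E z) B (E z) \<iota>' \<pi>' = 0"
          using 1 c ds(12) by simp
        then show ?thesis
          using zero_object_if_comp_zero[of B "E z" \<iota>' \<pi>'] ds by simp
      qed
    qed
  qed
  then show ?thesis
    using assms E_nonzero E_obj unfolding indecomposable_def zero_object_def by blast
qed

lemma finite_sums_exist:
  assumes "finite G" "G \<subseteq> S"
  obtains X where "direct_sum C G E X"
proof -
  obtain xs where xs: "set xs = G" "distinct xs"
    using finite_distinct_list[OF assms(1)] by blast
  then obtain X where X: "direct_sum C {..<length xs} (\<lambda>k. E (xs ! k)) X"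
    using sums_exist assms(2) by blast
  have b: "bij_betw ((!) xs) {..<length xs} G"
    using bij_betw_nth[OF xs(2) refl] xs(1) by blast
  have X': "direct_sum C G (\<lambda>x. E (xs ! inv_into {..<length xs} ((!) xs) x)) X"
    using direct_sum_reindex[OF X bij_betw_inv_into[OF b]] .
  have "xs ! inv_into {..<length xs} ((!) xs) x = x" if "x \<in> G" for x
    using b that by (metis bij_betw_imp_surj_on f_inv_into_f)
  then have "direct_sum C G E X"
    by (intro direct_sum_cong[OF X']) auto
  then show ?thesis using that by blast
qed

text \<open>\<open>summand\<close> demands an actual complement; it is the sum over the other
  members, provided by \<open>finite_sums_exist\<close>.\<close>

lemma mem_imp_summand:
  assumes "direct_sum C G E X" "G \<subseteq> S" "z \<in> G"
  shows "summand C (E z) X"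
proof -
  have "finite (G - {z})"
    using assms(1) unfolding direct_sum_def by simp
  then obtain K where "direct_sum C (G - {z}) E K"
    using finite_sums_exist assms(2) by (metis Diff_subset subset_trans)
  moreover have "direct_sum C {z} E (E z)"
    using assms E_obj by (intro direct_sum_singleton) blast
  ultimately have "direct_sum2 C (E z) K X"
    using direct_sum_Un[of "{z}" "G - {z}" E X] assms by (simp add: insert_absorb)
  then show ?thesis
    unfolding summand_def by blast
qed

text \<open>The locale provides sums of family members, not of arbitrary objects; so both objects
  are decomposed and the two lists concatenated.\<close>

lemma direct_sum2_exists:
  assumes "A \<in> Obj C" "B \<in> Obj C"
  obtains X where "direct_sum2 C A B X"
proof -
  obtain xs where xs: "set xs \<subseteq> S" "direct_sum C {..<length xs} (\<lambda>k. E (xs ! k)) A"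
    using decomposition assms(1) by blast
  obtain ys where ys: "set ys \<subseteq> S" "direct_sum C {..<length ys} (\<lambda>k. E (ys ! k)) B"
    using decomposition assms(2) by blast
  let ?f = "\<lambda>k. E ((xs @ ys) ! k)"
  obtain X where "direct_sum C {..<length (xs @ ys)} ?f X"
    using sums_exist[of "xs @ ys"] xs ys by auto
  moreover have "{..<length (xs @ ys)} = {..<length xs} \<union> {length xs..<length (xs @ ys)}"
    by auto
  ultimately have "direct_sum C ({..<length xs} \<union> {length xs..<length (xs @ ys)}) ?f X"
    by simp
  moreover have "direct_sum C {..<length xs} ?f A"
    using xs(2) by (rule direct_sum_cong) (simp add: nth_append)
  moreover have "direct_sum C {length xs..<length (xs @ ys)} ?f B"
  proof -
    have b: "bij_betw (\<lambda>k. k - length xs) {length xs..<length (xs @ ys)} {..<length ys}"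
      by (rule bij_betw_byWitness[where f' = "\<lambda>k. k + length xs"]) auto
    have "direct_sum C {length xs..<length (xs @ ys)} (\<lambda>k. E (ys ! (k - length xs))) B"
      using direct_sum_reindex[OF ys(2) b] .
    then show ?thesis
      by (rule direct_sum_cong) (simp add: nth_append)
  qed
  ultimately have "direct_sum2 C A B X"
    by (rule direct_sum_Un) auto
  then show ?thesis using that by blast
qed

end

section \<open>The orbit category is a linear category\<close>

text \<open>Object and morphism maps are total functions with arbitrary values off
  \<open>Obj\<close> and \<open>Hom\<close>, so the laws for inverses and powers of an automorphism
  hold only on actual objects and morphisms.\<close>

definition functor_eq ::
  "('o, 'm::ab_group_add, 'k) lincat \<Rightarrow> ('o, 'o, 'm, 'm) lfunctor \<Rightarrow> ('o, 'o, 'm, 'm) lfunctor \<Rightarrow> bool"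
  where "functor_eq D F G \<longleftrightarrow> (\<forall>X\<in>Obj D. fobj F X = fobj G X) \<and>
    (\<forall>X\<in>Obj D. \<forall>Y\<in>Obj D. \<forall>f\<in>Hom D X Y. fmor F X Y f = fmor G X Y f)"

lemma functor_eq_refl: "functor_eq D F F"
  by (simp add: functor_eq_def)

lemma functor_eq_sym: "functor_eq D F G \<Longrightarrow> functor_eq D G F"
  by (simp add: functor_eq_def)

lemma functor_eq_trans [trans]: "functor_eq D F G \<Longrightarrow> functor_eq D G H \<Longrightarrow> functor_eq D F H"
  by (simp add: functor_eq_def)

lemma functor_eq_fcomp:
  assumes "functor_eq D F F'" "functor_eq D G G'" "linear_functor D D G"
  shows "functor_eq D (fcomp F G) (fcomp F' G')"
  using assms unfolding functor_eq_def fcomp_def linear_functor_def by auto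

lemma fcomp_assoc: "fcomp (fcomp F G) H = fcomp F (fcomp G H)"
  by (simp add: fcomp_def)

lemma fcomp_fid: "fcomp fid F = F" "fcomp F fid = F"
  by (simp_all add: fcomp_def fid_def)

lemma automorphism_linear: "automorphism D F \<Longrightarrow> linear_functor D D F"
  by (simp add: automorphism_def)

context
  fixes D :: "('o, 'm::ab_group_add, 'k::field) lincat" and F :: "('o, 'o, 'm, 'm) lfunctor"
  assumes aut: "automorphism D F"
begin

lemma aut_obj: "X \<in> Obj D \<Longrightarrow> fobj F X \<in> Obj D"
  using aut unfolding automorphism_def linear_functor_def by blast

lemma aut_id: "X \<in> Obj D \<Longrightarrow> fmor F X X (Idt D X) = Idt D (fobj F X)"
  using aut unfolding automorphism_def linear_functor_def by blast

lemma aut_hom: "X \<in> Obj D \<Longrightarrow> Y \<in> Obj D \<Longrightarrow> f \<in> Hom D X Y \<Longrightarrow>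
    fmor F X Y f \<in> Hom D (fobj F X) (fobj F Y)"
  using aut unfolding automorphism_def linear_functor_def by blast

lemma aut_add: "X \<in> Obj D \<Longrightarrow> Y \<in> Obj D \<Longrightarrow> f \<in> Hom D X Y \<Longrightarrow> g \<in> Hom D X Y \<Longrightarrow>
    fmor F X Y (f + g) = fmor F X Y f + fmor F X Y g"
  using aut unfolding automorphism_def linear_functor_def by blast

lemma aut_scl: "X \<in> Obj D \<Longrightarrow> Y \<in> Obj D \<Longrightarrow> f \<in> Hom D X Y \<Longrightarrow>
    fmor F X Y (scl D c f) = scl D c (fmor F X Y f)"
  using aut unfolding automorphism_def linear_functor_def by blast

lemma aut_comp: "X \<in> Obj D \<Longrightarrow> Y \<in> Obj D \<Longrightarrow> Z \<in> Obj D \<Longrightarrow> f \<in> Hom D X Y \<Longrightarrow> g \<in> Hom D Y Z \<Longrightarrow>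
    fmor F X Z (Comp D X Y Z g f) =
    Comp D (fobj F X) (fobj F Y) (fobj F Z) (fmor F Y Z g) (fmor F X Y f)"
  using aut unfolding automorphism_def linear_functor_def by blast

lemma aut_bij_obj: "bij_betw (fobj F) (Obj D) (Obj D)"
  using aut unfolding automorphism_def by blast

lemma aut_obj_surj: "Y \<in> Obj D \<Longrightarrow> \<exists>X\<in>Obj D. fobj F X = Y"
  using bij_betw_imp_surj_on[OF aut_bij_obj] by (metis imageE)

lemma aut_bij: "X \<in> Obj D \<Longrightarrow> Y \<in> Obj D \<Longrightarrow>
    bij_betw (fmor F X Y) (Hom D X Y) (Hom D (fobj F X) (fobj F Y))"
  using aut unfolding automorphism_def by blast

lemma aut_inj: "X \<in> Obj D \<Longrightarrow> Y \<in> Obj D \<Longrightarrow> f \<in> Hom D X Y \<Longrightarrow> g \<in> Hom D X Y \<Longrightarrow>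
    fmor F X Y f = fmor F X Y g \<Longrightarrow> f = g"
  using aut_bij unfolding bij_betw_def inj_on_def by blast

lemma finv_obj:
  assumes "X \<in> Obj D"
  shows "fobj (finv D F) X \<in> Obj D" "fobj F (fobj (finv D F) X) = X"
    "fobj (finv D F) (fobj F X) = X"
  using aut_bij_obj assms
  by (auto simp: finv_def Let_def bij_betw_def inv_into_into f_inv_into_f)

lemma finv_bij_obj: "bij_betw (fobj (finv D F)) (Obj D) (Obj D)"
  using bij_betw_inv_into[OF aut_bij_obj] by (simp add: finv_def Let_def)

lemma finv_bij:
  assumes "X \<in> Obj D" "Y \<in> Obj D"
  shows "bij_betw (fmor (finv D F) X Y) (Hom D X Y)
    (Hom D (fobj (finv D F) X) (fobj (finv D F) Y))"
  using bij_betw_inv_into[OF aut_bij[OF finv_obj(1)[OF assms(1)] finv_obj(1)[OF assms(2)]]]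
    finv_obj(2)[OF assms(1)] finv_obj(2)[OF assms(2)]
  by (simp add: finv_def Let_def)

lemma finv_hom:
  assumes "X \<in> Obj D" "Y \<in> Obj D" "f \<in> Hom D X Y"
  shows "fmor (finv D F) X Y f \<in> Hom D (fobj (finv D F) X) (fobj (finv D F) Y)"
  using finv_bij assms bij_betwE by blast

lemma fmor_finv:
  assumes "X \<in> Obj D" "Y \<in> Obj D" "f \<in> Hom D X Y"
  shows "fmor F (fobj (finv D F) X) (fobj (finv D F) Y) (fmor (finv D F) X Y f) = f"
  using bij_betw_inv_into_right[OF aut_bij[OF finv_obj(1)[OF assms(1)] finv_obj(1)[OF assms(2)]], of f]
    assms finv_obj(2)[OF assms(1)] finv_obj(2)[OF assms(2)]
  by (simp add: finv_def Let_def)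

end

section \<open>Inverses and integer powers of an automorphism\<close>

context lin_category
begin

lemma automorphism_fid: "automorphism C fid"
  unfolding automorphism_def linear_functor_def fid_def by (simp flip: id_def)

lemma automorphism_fcomp:
  assumes F: "automorphism C F" and G: "automorphism C G"
  shows "automorphism C (fcomp F G)"
  unfolding automorphism_def linear_functor_def
proof (intro conjI ballI allI)
  show "bij_betw (fobj (fcomp F G)) (Obj C) (Obj C)"
    using bij_betw_trans[OF aut_bij_obj[OF G] aut_bij_obj[OF F]] by (simp add: fcomp_def comp_def)
  fix X Y assume XY: "X \<in> Obj C" "Y \<in> Obj C"
  show "bij_betw (fmor (fcomp F G) X Y) (Hom C X Y) (Hom C (fobj (fcomp F G) X) (fobj (fcomp F G) Y))"
    using bij_betw_trans[OF aut_bij[OF G XY] aut_bij[OF F aut_obj[OF G XY(1)] aut_obj[OF G XY(2)]]]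
    by (simp add: fcomp_def comp_def)
qed (simp_all add: fcomp_def aut_obj[OF F] aut_obj[OF G] aut_id[OF F] aut_id[OF G] aut_hom[OF F]
    aut_hom[OF G] aut_add[OF F] aut_add[OF G] aut_scl[OF F] aut_scl[OF G] aut_comp[OF F] aut_comp[OF G])

text \<open>Each functor law for the inverse is checked after applying F, which is injective on
  morphism sets.\<close>

lemma automorphism_finv:
  assumes F: "automorphism C F"
  shows "automorphism C (finv C F)"
proof -
  note simps = finv_obj[OF F] finv_hom[OF F] fmor_finv[OF F] aut_add[OF F] aut_scl[OF F]
    aut_id[OF F] aut_comp[OF F] hom_add hom_scl id_hom comp_hom
  show ?thesis
    unfolding automorphism_def linear_functor_def
  proof (intro conjI ballI allI)
    fix X assume X: "X \<in> Obj C"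
    show "fmor (finv C F) X X (Idt C X) = Idt C (fobj (finv C F) X)"
      by (rule aut_inj[OF F, of "fobj (finv C F) X" "fobj (finv C F) X"]) (use X in \<open>simp_all add: simps\<close>)
    fix Y assume Y: "Y \<in> Obj C"
    fix f assume f: "f \<in> Hom C X Y"
    show "fmor (finv C F) X Y (scl C c f) = scl C c (fmor (finv C F) X Y f)" for c
      by (rule aut_inj[OF F, of "fobj (finv C F) X" "fobj (finv C F) Y"]) (use X Y f in \<open>simp_all add: simps\<close>)
    show "fmor (finv C F) X Y (f + g) = fmor (finv C F) X Y f + fmor (finv C F) X Y g"
      if "g \<in> Hom C X Y" for g
      by (rule aut_inj[OF F, of "fobj (finv C F) X" "fobj (finv C F) Y"]) (use X Y f that in \<open>simp_all add: simps\<close>)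
    fix Z g assume Z: "Z \<in> Obj C" "g \<in> Hom C Y Z"
    show "fmor (finv C F) X Z (Comp C X Y Z g f) =
       Comp C (fobj (finv C F) X) (fobj (finv C F) Y) (fobj (finv C F) Z)
         (fmor (finv C F) Y Z g) (fmor (finv C F) X Y f)"
      by (rule aut_inj[OF F, of "fobj (finv C F) X" "fobj (finv C F) Z"])
        (use X Y Z f in \<open>simp_all add: simps\<close>)
  qed (auto intro: finv_bij_obj[OF F] finv_bij[OF F] finv_obj[OF F] finv_hom[OF F])
qed

lemma fcomp_finv: "automorphism C F \<Longrightarrow> functor_eq C (fcomp F (finv C F)) fid"
  unfolding functor_eq_def fcomp_def fid_def by (simp add: finv_obj fmor_finv)

lemma finv_fcomp:
  assumes F: "automorphism C F"
  shows "functor_eq C (fcomp (finv C F) F) fid"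
proof -
  have "fmor (finv C F) (fobj F X) (fobj F Y) (fmor F X Y f) = f"
    if "X \<in> Obj C" "Y \<in> Obj C" "f \<in> Hom C X Y" for X Y f
    by (rule aut_inj[OF F, of X Y])
      (use that fmor_finv[OF F, of "fobj F X" "fobj F Y" "fmor F X Y f"]
        finv_hom[OF F, of "fobj F X" "fobj F Y" "fmor F X Y f"]
       in \<open>simp_all add: finv_obj[OF F] aut_obj[OF F] aut_hom[OF F]\<close>)
  then show ?thesis
    unfolding functor_eq_def fcomp_def fid_def using finv_obj[OF F] by simp
qed

lemma automorphism_fiter: "automorphism C F \<Longrightarrow> automorphism C (fiter F k)"
  by (induction k) (simp_all add: automorphism_fid automorphism_fcomp)

lemma automorphism_fpow: "automorphism C F \<Longrightarrow> automorphism C (fpow C F k)"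
  by (simp add: fpow_def automorphism_fiter automorphism_finv)

lemma fpow_succ:
  assumes F: "automorphism C F"
  shows "functor_eq C (fpow C F (k + 1)) (fcomp F (fpow C F k))"
proof (cases "0 \<le> k")
  case True
  then have "nat (k + 1) = Suc (nat k)" by simp
  then show ?thesis
    using True by (simp add: fpow_def functor_eq_refl)
next
  case False
  define m where "m = nat (- (k + 1))"
  have "nat (- k) = Suc m" using False by (simp add: m_def)
  then have k: "fpow C F k = fcomp (finv C F) (fiter (finv C F) m)"
    using False by (simp add: fpow_def)
  have k1: "fpow C F (k + 1) = fiter (finv C F) m"
    using False by (auto simp: fpow_def m_def)
  have "functor_eq C (fcomp (fcomp F (finv C F)) (fiter (finv C F) m)) (fcomp fid (fiter (finv C F) m))"
    using F by (intro functor_eq_fcomp fcomp_finv functor_eq_refl automorphism_linear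
        automorphism_fiter automorphism_finv)
  then show ?thesis
    unfolding k k1 by (simp add: fcomp_assoc fcomp_fid functor_eq_sym)
qed

lemma fpow_pred:
  assumes F: "automorphism C F"
  shows "functor_eq C (fpow C F (k - 1)) (fcomp (finv C F) (fpow C F k))"
proof -
  have "functor_eq C (fcomp (finv C F) (fpow C F k)) (fcomp (finv C F) (fcomp F (fpow C F (k - 1))))"
    using fpow_succ[OF F, of "k - 1"] F
    by (intro functor_eq_fcomp functor_eq_refl) (auto intro: automorphism_linear automorphism_fpow)
  also have "functor_eq C \<dots> (fcomp fid (fpow C F (k - 1)))"
    unfolding fcomp_assoc[symmetric] using F
    by (intro functor_eq_fcomp finv_fcomp functor_eq_refl automorphism_linear automorphism_fpow)
  finally show ?thesis
    by (simp add: fcomp_fid functor_eq_sym)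
qed

text \<open>Composition in the orbit category adds degrees: F^p applied to a morphism into F^q Z
  must have the target F^(p+q) Z itself, not merely an isomorphic object.\<close>

lemma fpow_add:
  assumes F: "automorphism C F"
  shows "functor_eq C (fpow C F (p + q)) (fcomp (fpow C F p) (fpow C F q))"
proof (induction p rule: int_induct[where k = 0])
  case base
  then show ?case
    by (simp add: fpow_def[of _ _ 0] fcomp_fid functor_eq_refl)
next
  case (step1 p)
  have "functor_eq C (fpow C F (p + 1 + q)) (fcomp F (fpow C F (p + q)))"
    using fpow_succ[OF F, of "p + q"] by (simp add: algebra_simps)
  also have "functor_eq C \<dots> (fcomp F (fcomp (fpow C F p) (fpow C F q)))"
    using step1 F by (intro functor_eq_fcomp functor_eq_refl automorphism_linear automorphism_fpow)
  also have "functor_eq C \<dots> (fcomp (fpow C F (p + 1)) (fpow C F q))"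
    unfolding fcomp_assoc[symmetric]
    by (rule functor_eq_fcomp[OF functor_eq_sym[OF fpow_succ[OF F]] functor_eq_refl
          automorphism_linear[OF automorphism_fpow[OF F]]])
  finally show ?case .
next
  case (step2 p)
  have "functor_eq C (fpow C F (p - 1 + q)) (fcomp (finv C F) (fpow C F (p + q)))"
    using fpow_pred[OF F, of "p + q"] by (simp add: algebra_simps)
  also have "functor_eq C \<dots> (fcomp (finv C F) (fcomp (fpow C F p) (fpow C F q)))"
    using step2 F by (intro functor_eq_fcomp functor_eq_refl automorphism_linear automorphism_fpow)
  also have "functor_eq C \<dots> (fcomp (fpow C F (p - 1)) (fpow C F q))"
    unfolding fcomp_assoc[symmetric]
    by (rule functor_eq_fcomp[OF functor_eq_sym[OF fpow_pred[OF F]] functor_eq_refl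
          automorphism_linear[OF automorphism_fpow[OF F]]])
  finally show ?case .
qed

end

section \<open>Composition of finitely supported families\<close>

locale orbit = lin_category D
  for D :: "('o, 'm::ab_group_add, 'k::field) lincat" +
  fixes F :: "('o, 'o, 'm, 'm) lfunctor"
  assumes automorphism_F: "automorphism D F"
begin

abbreviation Fo where "Fo k \<equiv> fobj (fpow D F k)"
abbreviation Fm where "Fm k \<equiv> fmor (fpow D F k)"

lemmas aut_fpow = automorphism_fpow[OF automorphism_F]

lemma Fo_zero [simp]: "Fo 0 X = X" and Fm_zero [simp]: "Fm 0 X Y f = f"
  by (simp_all add: fpow_def fid_def)

lemma Fo_obj [simp]: "X \<in> Obj D \<Longrightarrow> Fo k X \<in> Obj D"
  by (rule aut_obj[OF aut_fpow])

lemma Fo_Fo [simp]: "X \<in> Obj D \<Longrightarrow> Fo p (Fo q X) = Fo (p + q) X"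
  using fpow_add[OF automorphism_F, of p q] unfolding functor_eq_def by (simp add: fcomp_def)

lemma Fm_Fm: "X \<in> Obj D \<Longrightarrow> Y \<in> Obj D \<Longrightarrow> f \<in> Hom D X Y \<Longrightarrow>
    Fm p (Fo q X) (Fo q Y) (Fm q X Y f) = Fm (p + q) X Y f"
  using fpow_add[OF automorphism_F, of p q] unfolding functor_eq_def by (simp add: fcomp_def)

lemma Fm_hom: "X \<in> Obj D \<Longrightarrow> Y \<in> Obj D \<Longrightarrow> f \<in> Hom D X Y \<Longrightarrow> Fm k X Y f \<in> Hom D (Fo k X) (Fo k Y)"
  by (rule aut_hom[OF aut_fpow])

lemma Fm_sum:
  assumes "X \<in> Obj D" "Y \<in> Obj D" "\<And>i. i \<in> I \<Longrightarrow> f i \<in> Hom D X Y" "finite I"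
  shows "Fm k X Y (sum f I) = (\<Sum>i\<in>I. Fm k X Y (f i))"
  using assms(4,3)
proof (induction I rule: finite_induct)
  case empty
  then show ?case
    using aut_add[OF aut_fpow, of X Y 0 0 k] assms(1,2) hom_zero by simp
next
  case (insert i I)
  then show ?case
    using aut_add[OF aut_fpow, of X Y "f i" "sum f I" k] assms(1,2) by (simp add: hom_sum)
qed

lemma Fm_zero_mor: "X \<in> Obj D \<Longrightarrow> Y \<in> Obj D \<Longrightarrow> Fm k X Y 0 = 0"
  using Fm_sum[of X Y "{}" undefined k] by simp

abbreviation C where "C \<equiv> orbit_category D F"

lemma orbit_Obj [simp]: "Obj C = Obj D"
  by (simp add: orbit_category_def)

lemma orbit_HomI:
  "finite {k. f k \<noteq> 0} \<Longrightarrow> (\<And>k. f k \<in> Hom D X (Fo k Y)) \<Longrightarrow> f \<in> Hom C X Y"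
  by (simp add: orbit_category_def)

lemma orbit_Hom_finite: "f \<in> Hom C X Y \<Longrightarrow> finite {k. f k \<noteq> 0}"
  by (simp add: orbit_category_def)

lemma orbit_Hom: "f \<in> Hom C X Y \<Longrightarrow> f k \<in> Hom D X (Fo k Y)"
  by (simp add: orbit_category_def)

lemma orbit_Idt: "Idt C X = (\<lambda>k. if k = 0 then Idt D X else 0)"
  by (simp add: orbit_category_def)

lemma orbit_scl: "scl C c f = (\<lambda>k. scl D c (f k))"
  by (simp add: orbit_category_def)

lemma orbit_Fm_hom:
  assumes "Y \<in> Obj D" "Z \<in> Obj D" "g \<in> Hom C Y Z"
  shows "Fm p Y (Fo (k - p) Z) (g (k - p)) \<in> Hom D (Fo p Y) (Fo k Z)"
  using Fm_hom[of Y "Fo (k - p) Z" "g (k - p)" p] assms by (simp add: orbit_Hom)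

text \<open>The definition sums over the support of f, which changes with f. Terms outside it
  vanish, so one common finite set can serve for several morphisms at once.\<close>

lemma orbit_Comp:
  assumes "X \<in> Obj D" "Y \<in> Obj D" "Z \<in> Obj D" "g \<in> Hom C Y Z"
    and "finite P" "{p. f p \<noteq> 0} \<subseteq> P"
  shows "Comp C X Y Z g f k =
    (\<Sum>p\<in>P. Comp D X (Fo p Y) (Fo k Z) (Fm p Y (Fo (k - p) Z) (g (k - p))) (f p))"
proof -
  have "Comp C X Y Z g f k =
    (\<Sum>p | f p \<noteq> 0. Comp D X (Fo p Y) (Fo k Z) (Fm p Y (Fo (k - p) Z) (g (k - p))) (f p))"
    by (simp add: orbit_category_def)
  also have "\<dots> = (\<Sum>p\<in>P. Comp D X (Fo p Y) (Fo k Z) (Fm p Y (Fo (k - p) Z) (g (k - p))) (f p))"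
    using assms by (intro sum.mono_neutral_left) (auto simp: comp_zero_right orbit_Fm_hom)
  finally show ?thesis .
qed

context
  fixes X Y Z f g P Q
  assumes obj: "X \<in> Obj D" "Y \<in> Obj D" "Z \<in> Obj D"
    and hom: "f \<in> Hom C X Y" "g \<in> Hom C Y Z"
    and supp: "finite P" "{p. f p \<noteq> 0} \<subseteq> P" "finite Q" "{q. g q \<noteq> 0} \<subseteq> Q"
begin

lemma orbit_Comp_supp: "{k. Comp C X Y Z g f k \<noteq> 0} \<subseteq> (\<lambda>(p, q). p + q) ` (P \<times> Q)"
proof
  fix k assume k: "k \<in> {k. Comp C X Y Z g f k \<noteq> 0}"
  have "\<exists>p\<in>P. Comp D X (Fo p Y) (Fo k Z) (Fm p Y (Fo (k - p) Z) (g (k - p))) (f p) \<noteq> 0"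
    using k orbit_Comp[OF obj hom(2) supp(1,2), of k] by (auto dest: sum.not_neutral_contains_not_neutral)
  then obtain p where p: "p \<in> P" "Comp D X (Fo p Y) (Fo k Z) (Fm p Y (Fo (k - p) Z) (g (k - p))) (f p) \<noteq> 0"
    by blast
  then have "g (k - p) \<noteq> 0"
    using Fm_zero_mor[of Y "Fo (k - p) Z" p] obj hom by (auto simp: comp_zero_left orbit_Hom)
  then have "k - p \<in> Q"
    using supp by blast
  then show "k \<in> (\<lambda>(p, q). p + q) ` (P \<times> Q)"
    using p(1) by (auto intro!: image_eqI[of _ _ "(p, k - p)"])
qed

lemma orbit_Comp_hom: "Comp C X Y Z g f \<in> Hom C X Z"
proof (rule orbit_HomI)
  show "finite {k. Comp C X Y Z g f k \<noteq> 0}"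
    using finite_subset[OF orbit_Comp_supp] supp by blast
  show "Comp C X Y Z g f k \<in> Hom D X (Fo k Z)" for k
    using obj hom by (simp add: orbit_Comp[OF obj hom(2) supp(1,2)])
      (intro hom_sum comp_hom orbit_Fm_hom orbit_Hom; simp)
qed

end

text \<open>Both sides are the sum of the triple composites \<open>T p q\<close> over the degrees p
  of f and q of g, the degree of h being forced to k - p - q. The left side groups by p, the right
  side by r = p + q.\<close>

lemma orbit_assoc:
  assumes obj: "W \<in> Obj D" "X \<in> Obj D" "Y \<in> Obj D" "Z \<in> Obj D"
    and f: "f \<in> Hom C W X" and g: "g \<in> Hom C X Y" and h: "h \<in> Hom C Y Z"
  shows "Comp C W X Z (Comp C X Y Z h g) f = Comp C W Y Z h (Comp C W X Y g f)"
proof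
  fix k
  define P where "P = {p. f p \<noteq> 0}"
  define Q where "Q = {q. g q \<noteq> 0}"
  define R where "R = (\<lambda>(p, q). p + q) ` (P \<times> Q)"
  have fin: "finite P" "finite Q" "finite R"
    using f g by (auto simp: P_def Q_def R_def orbit_Hom_finite)
  have hg: "Comp C X Y Z h g \<in> Hom C X Z"
    by (rule orbit_Comp_hom[OF obj(2-4) g h orbit_Hom_finite[OF g] order.refl orbit_Hom_finite[OF h] order.refl])
  have gf_supp: "{k. Comp C W X Y g f k \<noteq> 0} \<subseteq> R"
    unfolding R_def using orbit_Comp_supp[OF obj(1-3) f g] fin by (auto simp: P_def Q_def)
  define T where "T p q = Comp D W (Fo (p + q) Y) (Fo k Z) (Fm (p + q) Y (Fo (k - (p + q)) Z) (h (k - (p + q))))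
    (Comp D W (Fo p X) (Fo (p + q) Y) (Fm p X (Fo q Y) (g q)) (f p))" for p q
  have gM: "Fm p X (Fo q Y) (g q) \<in> Hom D (Fo p X) (Fo (p + q) Y)" for p q
    using Fm_hom[of X "Fo q Y" "g q" p] obj g by (simp add: orbit_Hom)
  have hM: "Fm p Y (Fo (k - p) Z) (h (k - p)) \<in> Hom D (Fo p Y) (Fo k Z)" for p k
    using orbit_Fm_hom[of Y Z h] obj h by simp
  have "Comp C W X Z (Comp C X Y Z h g) f k =
     (\<Sum>p\<in>P. Comp D W (Fo p X) (Fo k Z) (Fm p X (Fo (k - p) Z) (Comp C X Y Z h g (k - p))) (f p))"
    using obj fin by (intro orbit_Comp[OF _ _ _ hg]) (auto simp: P_def)
  also have "\<dots> = (\<Sum>p\<in>P. \<Sum>q\<in>Q. T p q)"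
  proof (intro sum.cong refl)
    fix p
    have "Comp C X Y Z h g (k - p) =
        (\<Sum>q\<in>Q. Comp D X (Fo q Y) (Fo (k - p) Z) (Fm q Y (Fo (k - p - q) Z) (h (k - p - q))) (g q))"
      using obj fin by (intro orbit_Comp[OF _ _ _ h]) (auto simp: Q_def)
    then have "Fm p X (Fo (k - p) Z) (Comp C X Y Z h g (k - p)) = (\<Sum>q\<in>Q. Fm p X (Fo (k - p) Z)
        (Comp D X (Fo q Y) (Fo (k - p) Z) (Fm q Y (Fo (k - p - q) Z) (h (k - p - q))) (g q)))"
      using Fm_sum[of X "Fo (k - p) Z" Q _ p] obj fin g hM[of _ "k - p"] by (simp add: comp_hom orbit_Hom)
    also have "\<dots> = (\<Sum>q\<in>Q. Comp D (Fo p X) (Fo (p + q) Y) (Fo k Z)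
        (Fm (p + q) Y (Fo (k - (p + q)) Z) (h (k - (p + q)))) (Fm p X (Fo q Y) (g q)))"
    proof (intro sum.cong refl)
      fix q
      have "Fm p (Fo q Y) (Fo (k - p) Z) (Fm q Y (Fo (k - p - q) Z) (h (k - p - q))) =
          Fm (p + q) Y (Fo (k - (p + q)) Z) (h (k - (p + q)))"
        using Fm_Fm[of Y "Fo (k - p - q) Z" "h (k - p - q)" p q] obj h
        by (simp add: orbit_Hom algebra_simps)
      then show "Fm p X (Fo (k - p) Z)
        (Comp D X (Fo q Y) (Fo (k - p) Z) (Fm q Y (Fo (k - p - q) Z) (h (k - p - q))) (g q)) =
        Comp D (Fo p X) (Fo (p + q) Y) (Fo k Z)
        (Fm (p + q) Y (Fo (k - (p + q)) Z) (h (k - (p + q)))) (Fm p X (Fo q Y) (g q))"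
        using aut_comp[OF aut_fpow, of X "Fo q Y" "Fo (k - p) Z" "g q" _ p] obj g hM[of q "k - p"]
        by (simp add: orbit_Hom)
    qed
    finally have "Comp D W (Fo p X) (Fo k Z) (Fm p X (Fo (k - p) Z) (Comp C X Y Z h g (k - p))) (f p) =
      Comp D W (Fo p X) (Fo k Z) (\<Sum>q\<in>Q. Comp D (Fo p X) (Fo (p + q) Y) (Fo k Z)
        (Fm (p + q) Y (Fo (k - (p + q)) Z) (h (k - (p + q)))) (Fm p X (Fo q Y) (g q))) (f p)"
      by simp
    also have "\<dots> = (\<Sum>q\<in>Q. T p q)"
      unfolding T_def using obj f gM hM
      by (simp add: comp_sum_left comp_hom comp_assoc orbit_Hom)
    finally show "Comp D W (Fo p X) (Fo k Z) (Fm p X (Fo (k - p) Z) (Comp C X Y Z h g (k - p))) (f p) =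
      (\<Sum>q\<in>Q. T p q)" .
  qed
  \<comment> \<open>Substitution r = p + q: for each p in P the set \<open>R\<close> contains p + Q,
    and at the other values of r the factor g (r - p) is zero.\<close>
  also have "\<dots> = (\<Sum>p\<in>P. \<Sum>r\<in>R. T p (r - p))"
  proof (rule sum.cong[OF refl])
    fix p assume p: "p \<in> P"
    have "(\<Sum>r\<in>R. T p (r - p)) = (\<Sum>q\<in>(\<lambda>r. r - p) ` R. T p q)"
      by (subst sum.reindex) (auto simp: inj_on_def)
    also have "\<dots> = (\<Sum>q\<in>Q. T p q)"
    proof (rule sum.mono_neutral_right)
      show "Q \<subseteq> (\<lambda>r. r - p) ` R"
        using p by (force simp: R_def)
      show "\<forall>q\<in>(\<lambda>r. r - p) ` R - Q. T p q = 0"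
        using obj f hM by (auto simp: T_def Q_def Fm_zero_mor comp_zero_left comp_zero_right orbit_Hom)
    qed (use fin in simp)
    finally show "(\<Sum>q\<in>Q. T p q) = (\<Sum>r\<in>R. T p (r - p))" by simp
  qed
  also have "\<dots> = (\<Sum>r\<in>R. \<Sum>p\<in>P. T p (r - p))"
    by (rule sum.swap)
  also have "\<dots> = (\<Sum>r\<in>R. Comp D W (Fo r Y) (Fo k Z) (Fm r Y (Fo (k - r) Z) (h (k - r))) (Comp C W X Y g f r))"
  proof (intro sum.cong refl)
    fix r
    have "Comp C W X Y g f r =
        (\<Sum>p\<in>P. Comp D W (Fo p X) (Fo r Y) (Fm p X (Fo (r - p) Y) (g (r - p))) (f p))"
      using obj fin by (intro orbit_Comp[OF _ _ _ g]) (auto simp: P_def)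
    then show "(\<Sum>p\<in>P. T p (r - p)) =
        Comp D W (Fo r Y) (Fo k Z) (Fm r Y (Fo (k - r) Z) (h (k - r))) (Comp C W X Y g f r)"
      using obj f hM[of r k] orbit_Fm_hom[of X Y g] g
      by (simp add: T_def comp_sum_right comp_hom orbit_Hom)
  qed
  also have "\<dots> = Comp C W Y Z h (Comp C W X Y g f) k"
    using obj fin gf_supp by (intro orbit_Comp[OF _ _ _ h, symmetric]) auto
  finally show "Comp C W X Z (Comp C X Y Z h g) f k = Comp C W Y Z h (Comp C W X Y g f) k" .
qed

lemma orbit_vector_space: "vector_space (scl C)"
proof -
  interpret vs: vector_space "scl D" by (rule scl_vector_space)
  show ?thesis
    by unfold_locales (auto simp: orbit_scl fun_eq_iff vs.scale_left_distrib vs.scale_right_distrib)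
qed

lemma orbit_subspace:
  assumes "X \<in> Obj D" "Y \<in> Obj D"
  shows "module.subspace (scl C) (Hom C X Y)"
proof -
  interpret vs: vector_space "scl D" by (rule scl_vector_space)
  interpret vc: vector_space "scl C" by (rule orbit_vector_space)
  show "vc.subspace (Hom C X Y)"
  proof (rule vc.subspaceI)
    show "0 \<in> Hom C X Y"
      using assms by (intro orbit_HomI) (auto simp: hom_zero)
    show "x + y \<in> Hom C X Y" if "x \<in> Hom C X Y" "y \<in> Hom C X Y" for x y
    proof (rule orbit_HomI)
      have "{k. (x + y) k \<noteq> 0} \<subseteq> {k. x k \<noteq> 0} \<union> {k. y k \<noteq> 0}" by auto
      then show "finite {k. (x + y) k \<noteq> 0}"
        using that orbit_Hom_finite by (meson finite_UnI finite_subset)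
    qed (use that assms in \<open>simp add: hom_add orbit_Hom\<close>)
    show "scl C c x \<in> Hom C X Y" if "x \<in> Hom C X Y" for x c
    proof (rule orbit_HomI)
      have "{k. scl C c x k \<noteq> 0} \<subseteq> {k. x k \<noteq> 0}" by (auto simp: orbit_scl)
      then show "finite {k. scl C c x k \<noteq> 0}"
        using that orbit_Hom_finite by (meson finite_subset)
    qed (use that assms in \<open>simp add: orbit_scl hom_scl orbit_Hom\<close>)
  qed
qed

lemma orbit_id_hom:
  assumes "X \<in> Obj D"
  shows "Idt C X \<in> Hom C X X"
proof (rule orbit_HomI)
  have "{k. Idt C X k \<noteq> 0} \<subseteq> {0}" by (auto simp: orbit_Idt)
  then show "finite {k. Idt C X k \<noteq> 0}" by (rule finite_subset) simp
qed (use assms in \<open>auto simp: orbit_Idt id_hom hom_zero\<close>)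

lemma orbit_comp_id:
  assumes "X \<in> Obj D" "Y \<in> Obj D" "f \<in> Hom C X Y"
  shows "Comp C X X Y f (Idt C X) = f" "Comp C X Y Y (Idt C Y) f = f"
proof -
  show "Comp C X X Y f (Idt C X) = f"
  proof
    fix k
    have "Comp C X X Y f (Idt C X) k = (\<Sum>p\<in>{0}. Comp D X (Fo p X) (Fo k Y)
        (Fm p X (Fo (k - p) Y) (f (k - p))) (Idt C X p))"
      using assms by (intro orbit_Comp) (auto simp: orbit_Idt)
    then show "Comp C X X Y f (Idt C X) k = f k"
      using assms by (simp add: orbit_Idt comp_id_right orbit_Hom)
  qed
  show "Comp C X Y Y (Idt C Y) f = f"
  proof
    fix k
    define P where "P = insert k {p. f p \<noteq> 0}"
    have P: "finite P" "k \<in> P" using orbit_Hom_finite[OF assms(3)] by (simp_all add: P_def)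
    have "Comp C X Y Y (Idt C Y) f k = (\<Sum>p\<in>P. Comp D X (Fo p Y) (Fo k Y)
        (Fm p Y (Fo (k - p) Y) (Idt C Y (k - p))) (f p))"
      using assms P by (intro orbit_Comp orbit_id_hom) (auto simp: P_def)
    also have "\<dots> = (\<Sum>p\<in>P. if p = k then f k else 0)"
    proof (intro sum.cong refl)
      fix p
      show "Comp D X (Fo p Y) (Fo k Y) (Fm p Y (Fo (k - p) Y) (Idt C Y (k - p))) (f p) =
          (if p = k then f k else 0)"
        using assms
        by (auto simp: orbit_Idt aut_id[OF aut_fpow] Fm_zero_mor comp_id_left comp_zero_left orbit_Hom)
    qed
    also have "\<dots> = f k" using P by simp
    finally show "Comp C X Y Y (Idt C Y) f k = f k" .
  qed
qed

lemma orbit_bilinear: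
  assumes obj: "X \<in> Obj D" "Y \<in> Obj D" "Z \<in> Obj D" and f: "f \<in> Hom C X Y" and g: "g \<in> Hom C Y Z"
  shows "f' \<in> Hom C X Y \<Longrightarrow> Comp C X Y Z g (f + f') = Comp C X Y Z g f + Comp C X Y Z g f'"
    and "g' \<in> Hom C Y Z \<Longrightarrow> Comp C X Y Z (g + g') f = Comp C X Y Z g f + Comp C X Y Z g' f"
    and "Comp C X Y Z g (scl C c f) = scl C c (Comp C X Y Z g f)"
    and "Comp C X Y Z (scl C c g) f = scl C c (Comp C X Y Z g f)"
proof -
  interpret vs: vector_space "scl D" by (rule scl_vector_space)
  interpret vc: vector_space "scl C" by (rule orbit_vector_space)
  define P where "P = {p. f p \<noteq> 0}"
  have P: "finite P" "{p. f p \<noteq> 0} \<subseteq> P" using f by (auto simp: P_def orbit_Hom_finite)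
  note gM = orbit_Fm_hom[OF obj(2,3) g]
  show "Comp C X Y Z g (f + f') = Comp C X Y Z g f + Comp C X Y Z g f'" if f': "f' \<in> Hom C X Y"
  proof
    fix k
    define P' where "P' = P \<union> {p. f' p \<noteq> 0}"
    have P': "finite P'" "{p. f p \<noteq> 0} \<subseteq> P'" "{p. f' p \<noteq> 0} \<subseteq> P'" "{p. (f + f') p \<noteq> 0} \<subseteq> P'"
      using P f' by (auto simp: P'_def orbit_Hom_finite)
    show "Comp C X Y Z g (f + f') k = (Comp C X Y Z g f + Comp C X Y Z g f') k"
      using obj f f' gM
      by (simp add: orbit_Comp[OF obj g P'(1,2)] orbit_Comp[OF obj g P'(1,3)] orbit_Comp[OF obj g P'(1,4)]
          comp_add_right orbit_Hom sum.distrib)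
  qed
  show "Comp C X Y Z (g + g') f = Comp C X Y Z g f + Comp C X Y Z g' f" if g': "g' \<in> Hom C Y Z"
  proof
    fix k
    have gg': "g + g' \<in> Hom C Y Z"
      by (rule vc.subspace_add[OF orbit_subspace[OF obj(2,3)] g g'])
    show "Comp C X Y Z (g + g') f k = (Comp C X Y Z g f + Comp C X Y Z g' f) k"
      using obj f gM orbit_Fm_hom[OF obj(2,3) g']
      by (simp add: orbit_Comp[OF obj g P] orbit_Comp[OF obj g' P] orbit_Comp[OF obj gg' P]
          aut_add[OF aut_fpow] comp_add_left orbit_Hom[OF f] orbit_Hom[OF g] orbit_Hom[OF g'] sum.distrib)
  qed
  show "Comp C X Y Z g (scl C c f) = scl C c (Comp C X Y Z g f)"
  proof
    fix k
    have "{p. scl C c f p \<noteq> 0} \<subseteq> P" using P by (auto simp: orbit_scl)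
    from orbit_Comp[OF obj g P(1) this]
    show "Comp C X Y Z g (scl C c f) k = scl C c (Comp C X Y Z g f) k"
      using obj f gM
      by (simp add: orbit_Comp[OF obj g P] orbit_scl comp_scl_right orbit_Hom vs.scale_sum_right)
  qed
  show "Comp C X Y Z (scl C c g) f = scl C c (Comp C X Y Z g f)"
  proof
    fix k
    have cg: "scl C c g \<in> Hom C Y Z"
      by (rule vc.subspace_scale[OF orbit_subspace[OF obj(2,3)] g])
    show "Comp C X Y Z (scl C c g) f k = scl C c (Comp C X Y Z g f) k"
      unfolding orbit_Comp[OF obj cg P] using obj f gM
      by (simp add: orbit_Comp[OF obj g P] orbit_scl aut_scl[OF aut_fpow]
          comp_scl_left orbit_Hom[OF f] orbit_Hom[OF g] vs.scale_sum_right)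
  qed
qed

lemma orbit_linear_category: "linear_category C"
proof -
  have "Comp C X Y Z g f \<in> Hom C X Z"
    if "X \<in> Obj D" "Y \<in> Obj D" "Z \<in> Obj D" "f \<in> Hom C X Y" "g \<in> Hom C Y Z" for X Y Z f g
    by (rule orbit_Comp_hom[OF that orbit_Hom_finite[OF that(4)] order.refl orbit_Hom_finite[OF that(5)] order.refl])
  note facts = this orbit_subspace orbit_id_hom orbit_comp_id orbit_assoc orbit_bilinear
    orbit_vector_space
  show ?thesis
    unfolding linear_category_def orbit_Obj
    by (intro conjI ballI allI; rule facts; assumption)
qed

lemma orbit_Hom_zero_iff:
  assumes "X \<in> Obj D" "Y \<in> Obj D"
  shows "Hom C X Y = {0} \<longleftrightarrow> (\<forall>k. Hom D X (Fo k Y) = {0})"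
proof (intro iffI allI)
  fix k assume zero: "Hom C X Y = {0}"
  have "f = 0" if f: "f \<in> Hom D X (Fo k Y)" for f
  proof -
    have "(\<lambda>l. if l = k then f else 0) \<in> Hom C X Y"
      using f assms by (intro orbit_HomI) (simp_all add: hom_zero)
    then have "(\<lambda>l. if l = k then f else 0) = 0" using zero by blast
    from fun_cong[OF this, of k] show ?thesis by simp
  qed
  then show "Hom D X (Fo k Y) = {0}"
    using hom_zero assms by auto
next
  assume zero: "\<forall>k. Hom D X (Fo k Y) = {0}"
  have "f = 0" if "f \<in> Hom C X Y" for f
  proof
    show "f k = 0 k" for k
      using zero orbit_Hom[OF that, of k] by simp
  qed
  moreover have "0 \<in> Hom C X Y"
    using assms by (intro orbit_HomI) (simp_all add: hom_zero)
  ultimately show "Hom C X Y = {0}" by blast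
qed

end

section \<open>Serre duality and extensions in the orbit category\<close>

lemma (in lin_category) aut_Hom_zero_iff:
  assumes "automorphism C G" "X \<in> Obj C" "Y \<in> Obj C"
  shows "Hom C (fobj G X) (fobj G Y) = {0} \<longleftrightarrow> Hom C X Y = {0}"
proof -
  have G0: "fmor G X Y 0 = 0"
    using aut_add[OF assms, of 0 0] hom_zero[OF assms(2,3)] by simp
  have bij: "fmor G X Y ` Hom C X Y = Hom C (fobj G X) (fobj G Y)"
    using aut_bij[OF assms] by (simp add: bij_betw_def)
  show ?thesis
  proof
    assume zero: "Hom C (fobj G X) (fobj G Y) = {0}"
    have "f = 0" if "f \<in> Hom C X Y" for f
    proof (rule aut_inj[OF assms that hom_zero[OF assms(2,3)]])
      show "fmor G X Y f = fmor G X Y 0"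
        using aut_hom[OF assms that] zero G0 by simp
    qed
    then show "Hom C X Y = {0}"
      using hom_zero[OF assms(2,3)] by blast
  qed (use bij G0 in auto)
qed

text \<open>The argument does not count dimensions. If Hom(X, Y) is zero, only the zero form on
  Hom(Y, S X) is represented, and a nonzero g would admit another form. Conversely, on a zero space
  all elements of Hom(X, Y) represent the same form, and representatives are unique.\<close>

lemma (in lin_category) serre_Hom_zero_iff:
  assumes S: "serre_functor C S" and X: "X \<in> Obj C" and Y: "Y \<in> Obj C"
  shows "Hom C X Y = {0} \<longleftrightarrow> Hom C Y (fobj S X) = {0}"
proof -
  interpret vs: vector_space "scl C" by (rule scl_vector_space)
  obtain B where all: "\<forall>X\<in>Obj C. \<forall>Y\<in>Obj C.
        (\<forall>f\<in>Hom C X Y. linear_form_on C (Hom C Y (fobj S X)) (B X Y f)) \<and>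
        (\<forall>g\<in>Hom C Y (fobj S X). linear_form_on C (Hom C X Y) (\<lambda>f. B X Y f g)) \<and>
        (\<forall>l. linear_form_on C (Hom C Y (fobj S X)) l \<longrightarrow>
           (\<exists>!f. f \<in> Hom C X Y \<and> (\<forall>g\<in>Hom C Y (fobj S X). B X Y f g = l g)))"
    using S unfolding serre_functor_def by (elim conjE exE)
  then have B: "\<And>g. g \<in> Hom C Y (fobj S X) \<Longrightarrow> linear_form_on C (Hom C X Y) (\<lambda>f. B X Y f g)"
    "\<And>l. linear_form_on C (Hom C Y (fobj S X)) l \<Longrightarrow>
      \<exists>!f. f \<in> Hom C X Y \<and> (\<forall>g\<in>Hom C Y (fobj S X). B X Y f g = l g)"
    using X Y by simp_all
  have autS: "automorphism C S" using S by (simp add: serre_functor_def)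
  have SX: "fobj S X \<in> Obj C" by (rule aut_obj[OF autS X])
  note zero = hom_zero[OF X Y] hom_zero[OF Y SX]
  have B0: "B X Y 0 g = 0" if "g \<in> Hom C Y (fobj S X)" for g
    using B(1)[OF that] zero(1) unfolding linear_form_on_def
    by (metis add.right_neutral add_left_cancel)
  show ?thesis
  proof
    assume XY: "Hom C X Y = {0}"
    have "g = 0" if g: "g \<in> Hom C Y (fobj S X)" for g
    proof (rule ccontr)
      assume "g \<noteq> 0"
      then have ind: "vs.independent {g}" by simp
      \<comment> \<open>A form that is nonzero at g: the coordinate along g in a basis of the whole
        ambient space that contains g.\<close>
      define b where "b = vs.extend_basis {g}"
      have b: "vs.independent b" "vs.span b = UNIV" "g \<in> b"
        using vs.independent_extend_basis[OF ind] vs.span_extend_basis[OF ind]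
          vs.extend_basis_superset[OF ind] by (auto simp: b_def)
      define l where "l v = vs.representation b v g" for v
      have l: "linear_form_on C (Hom C Y (fobj S X)) l"
        unfolding linear_form_on_def l_def using b
        by (simp add: vs.representation_add vs.representation_scale)
      have "l g = 1"
        unfolding l_def using vs.representation_basis[OF b(1,3)] by simp
      moreover obtain f where "f \<in> Hom C X Y" "\<forall>g\<in>Hom C Y (fobj S X). B X Y f g = l g"
        using B(2)[OF l] by blast
      ultimately show False
        using XY B0 g by auto
    qed
    then show "Hom C Y (fobj S X) = {0}"
      using zero(2) by blast
  next
    assume YS: "Hom C Y (fobj S X) = {0}"
    have "f = 0" if f: "f \<in> Hom C X Y" for f
    proof -
      have l: "linear_form_on C (Hom C Y (fobj S X)) (\<lambda>_. 0)"
        by (simp add: linear_form_on_def)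
      have "B X Y h 0 = 0" if "h \<in> Hom C X Y" for h
      proof -
        have "linear_form_on C (Hom C Y (fobj S X)) (B X Y h)"
          using all X Y that by simp
        then show ?thesis
          using zero(2) unfolding linear_form_on_def by (metis add.right_neutral add_left_cancel)
      qed
      then show ?thesis
        using B(2)[OF l] f zero(1) YS by (metis singletonD)
    qed
    then show "Hom C X Y = {0}"
      using zero(1) by blast
  qed
qed

section \<open>Vanishing of Hom under shift, translate and Serre functor\<close>

locale serre_orbit = lin_category D
  for D :: "('o, 'm::ab_group_add, 'k::field) lincat" +
  fixes \<Sigma> \<tau> :: "('o, 'o, 'm, 'm) lfunctor"
  assumes automorphism_shift: "automorphism D \<Sigma>"
    and automorphism_translate: "automorphism D \<tau>"
    and serre: "serre_functor D (fcomp \<Sigma> \<tau>)"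
begin

abbreviation F where "F \<equiv> fcomp \<tau> (fcomp \<Sigma> \<Sigma>)"

sublocale orbit D F
  by unfold_locales
    (intro automorphism_fcomp automorphism_shift automorphism_translate)

abbreviation sh where "sh \<equiv> fobj \<Sigma>"
abbreviation tr where "tr \<equiv> fobj \<tau>"
abbreviation vanish where "vanish X Y \<equiv> Hom D X Y = {0}"

lemma sh_obj [simp]: "X \<in> Obj D \<Longrightarrow> sh X \<in> Obj D"
  by (rule aut_obj[OF automorphism_shift])

lemma tr_obj [simp]: "X \<in> Obj D \<Longrightarrow> tr X \<in> Obj D"
  by (rule aut_obj[OF automorphism_translate])

lemma sh_surj: "Y \<in> Obj D \<Longrightarrow> \<exists>X\<in>Obj D. Y = sh X"
  using aut_obj_surj[OF automorphism_shift] by metis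

lemma vanish_sh [simp]: "X \<in> Obj D \<Longrightarrow> Y \<in> Obj D \<Longrightarrow> vanish (sh X) (sh Y) \<longleftrightarrow> vanish X Y"
  by (rule aut_Hom_zero_iff[OF automorphism_shift])

lemma vanish_Fo: "X \<in> Obj D \<Longrightarrow> Y \<in> Obj D \<Longrightarrow> vanish (Fo k X) (Fo k Y) \<longleftrightarrow> vanish X Y"
  by (rule aut_Hom_zero_iff[OF aut_fpow])

lemma vanish_serre: "X \<in> Obj D \<Longrightarrow> Y \<in> Obj D \<Longrightarrow> vanish X Y \<longleftrightarrow> vanish Y (sh (tr X))"
  using serre_Hom_zero_iff[OF serre, of X Y] by (simp add: fcomp_def)

text \<open>What remains of the commutation of a Serre functor with an automorphism when only
  vanishing is recorded. For Z = \<Sigma> Z', both sides are dual to Hom(X, Z'): the left one by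
  duality at \<Sigma> X, the right one by duality at X followed by a shift. Every Z has this
  form.\<close>

lemma vanish_serre_sh:
  assumes "X \<in> Obj D" "Z \<in> Obj D"
  shows "vanish Z (sh (tr (sh X))) \<longleftrightarrow> vanish Z (sh (sh (tr X)))"
proof -
  obtain Z' where "Z' \<in> Obj D" "Z = sh Z'"
    using sh_surj assms(2) by blast
  then show ?thesis
    using assms vanish_serre[of "sh X" Z] vanish_serre[of X Z'] by simp
qed

lemma Fo_one: "Fo 1 X = tr (sh (sh X))"
  by (simp add: fpow_def fcomp_def fid_def)

text \<open>In F the translate is outermost, so both arguments are shifted once more to expose the
  pattern of \<open>vanish_serre_sh\<close>.\<close>

lemma vanish_Fo_one_sh:
  assumes "X \<in> Obj D" "Z \<in> Obj D"
  shows "vanish Z (Fo 1 (sh X)) \<longleftrightarrow> vanish Z (sh (Fo 1 X))"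
proof -
  have "vanish Z (Fo 1 (sh X)) \<longleftrightarrow> vanish (sh Z) (sh (tr (sh (sh (sh X)))))"
    using assms by (simp add: Fo_one)
  also have "\<dots> \<longleftrightarrow> vanish (sh Z) (sh (sh (tr (sh (sh X)))))"
    using assms by (intro vanish_serre_sh) simp_all
  also have "\<dots> \<longleftrightarrow> vanish Z (sh (Fo 1 X))"
    using assms by (simp add: Fo_one)
  finally show ?thesis .
qed

text \<open>Z has to vary in the induction: the step up replaces it by a preimage under F, the step
  down by its image.\<close>

lemma vanish_Fo_sh:
  assumes "X \<in> Obj D" "Z \<in> Obj D"
  shows "vanish Z (Fo k (sh X)) \<longleftrightarrow> vanish Z (sh (Fo k X))"
  using assms
proof (induction k arbitrary: Z rule: int_induct[where k = 0])
  case base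
  then show ?case by simp
next
  case (step1 k)
  obtain Z' where Z': "Z' \<in> Obj D" "Z = Fo 1 Z'"
    using aut_obj_surj[OF aut_fpow, of Z 1] step1 by metis
  have "vanish Z (Fo (k + 1) (sh X)) \<longleftrightarrow> vanish Z (Fo 1 (Fo k (sh X)))"
    using step1.prems by (simp add: add.commute)
  also have "\<dots> \<longleftrightarrow> vanish Z' (Fo k (sh X))"
    unfolding Z'(2) using Z'(1) step1.prems by (intro vanish_Fo) simp_all
  also have "\<dots> \<longleftrightarrow> vanish Z' (sh (Fo k X))"
    using Z' step1 by blast
  also have "\<dots> \<longleftrightarrow> vanish Z (Fo 1 (sh (Fo k X)))"
    unfolding Z'(2) using Z'(1) step1.prems by (intro vanish_Fo[symmetric]) simp_all
  also have "\<dots> \<longleftrightarrow> vanish Z (sh (Fo 1 (Fo k X)))"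
    using step1.prems by (intro vanish_Fo_one_sh) simp_all
  also have "\<dots> \<longleftrightarrow> vanish Z (sh (Fo (k + 1) X))"
    using step1.prems by (simp add: add.commute)
  finally show ?case .
next
  case (step2 k)
  have "vanish Z (Fo (k - 1) (sh X)) \<longleftrightarrow> vanish (Fo 1 Z) (Fo 1 (Fo (k - 1) (sh X)))"
    using step2.prems by (intro vanish_Fo[symmetric]) simp_all
  also have "\<dots> \<longleftrightarrow> vanish (Fo 1 Z) (Fo k (sh X))"
    using step2.prems by simp
  also have "\<dots> \<longleftrightarrow> vanish (Fo 1 Z) (sh (Fo k X))"
    using step2 by simp
  also have "\<dots> \<longleftrightarrow> vanish (Fo 1 Z) (sh (Fo 1 (Fo (k - 1) X)))"
    using step2.prems by simp
  also have "\<dots> \<longleftrightarrow> vanish (Fo 1 Z) (Fo 1 (sh (Fo (k - 1) X)))"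
    using step2.prems by (intro vanish_Fo_one_sh[symmetric]) simp_all
  also have "\<dots> \<longleftrightarrow> vanish Z (sh (Fo (k - 1) X))"
    using step2.prems by (intro vanish_Fo) simp_all
  finally show ?case .
qed

text \<open>The Auslander-Reiten formula degree by degree: degree k of Ext(X, Y) is matched with
  degree -k of Hom(Y, \<tau> X).\<close>

lemma orbit_Ext_zero_iff:
  assumes "X \<in> Obj D" "Y \<in> Obj D"
  shows "Hom C X (sh Y) = {0} \<longleftrightarrow> Hom C Y (tr X) = {0}"
proof -
  have "vanish X (Fo k (sh Y)) \<longleftrightarrow> vanish Y (Fo (- k) (tr X))" for k
  proof -
    have "vanish X (Fo k (sh Y)) \<longleftrightarrow> vanish X (sh (Fo k Y))"
      using vanish_Fo_sh assms by simp
    also have "\<dots> \<longleftrightarrow> vanish (Fo k Y) (tr X)"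
      using vanish_serre[of X "sh (Fo k Y)"] assms by simp
    also have "\<dots> \<longleftrightarrow> vanish Y (Fo (- k) (tr X))"
      using vanish_Fo[of Y "Fo (- k) (tr X)" k] assms by simp
    finally show ?thesis .
  qed
  then have "(\<forall>k. vanish X (Fo k (sh Y))) \<longleftrightarrow> (\<forall>k. vanish Y (Fo k (tr X)))"
    by (metis minus_minus)
  then show ?thesis
    using assms by (simp add: orbit_Hom_zero_iff)
qed

end

section \<open>The mesh category\<close>

text \<open>The clockwise length of the edge, with loops of length n instead of 0. It is the row of
  the edge in \<Gamma>(n), the quotient of the translation quiver ZA_n by the n-th power of \<tau>:
  the sides [i, i+1] form row 1 and the loops row n.\<close>

definition level :: "nat \<Rightarrow> edge \<Rightarrow> nat" where
  "level n x = (if fst x < snd x then snd x - fst x else snd x + n - fst x)"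

text \<open>Clockwise distance of vertices, with values 0 to n - 1; it differs from
  \<open>level\<close> exactly at equal vertices.\<close>

definition cdist :: "nat \<Rightarrow> nat \<Rightarrow> nat \<Rightarrow> nat" where
  "cdist n a c = (if a \<le> c then c - a else c + n - a)"

text \<open>
  Lift \<open>[i, j]\<close> to the point \<open>(i, i + level)\<close> of the universal cover of \<open>\<Gamma>(n)\<close>. The edges reached
  from it by a nonzero morphism lift to the rectangle \<open>[i, j - 1] \<times> [j, i + n]\<close>.
\<close>

definition reach :: "nat \<Rightarrow> edge \<Rightarrow> edge \<Rightarrow> bool" where
  "reach n x y \<longleftrightarrow> cdist n (fst x) (fst y) < level n x \<and> level n x + cdist n (snd x) (snd y) \<le> n"

text \<open>The flag names the vertex that advances, True for the start and False for the end, so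
  that facts symmetric in the two kinds of arrow are stated once.\<close>

definition move :: "nat \<Rightarrow> bool \<Rightarrow> edge \<Rightarrow> edge" where
  "move n s x = (if s then (nxt n (fst x), snd x) else (fst x, nxt n (snd x)))"

text \<open>How many consecutive arrows of kind s fit before the border row stops them. It is also
  the side length, in that direction, of the rectangle described by \<open>reach\<close>.\<close>

definition room :: "nat \<Rightarrow> bool \<Rightarrow> edge \<Rightarrow> nat" where
  "room n s x = (if s then level n x - 1 else n - level n x)"

section \<open>Moves, room and the arrows of the translation quiver\<close>

lemma level_bounds: "x \<in> edges n \<Longrightarrow> 1 \<le> level n x \<and> level n x \<le> n"
  by (auto simp: edges_def level_def)

lemma nxt_mem: "i \<in> {1..n} \<Longrightarrow> nxt n i \<in> {1..n}"
  by (auto simp: nxt_def)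

lemma prv_mem: "i \<in> {1..n} \<Longrightarrow> prv n i \<in> {1..n}"
  by (auto simp: prv_def)

lemma nxt_prv: "i \<in> {1..n} \<Longrightarrow> nxt n (prv n i) = i"
  by (auto simp: prv_def nxt_def)

lemma prv_nxt: "i \<in> {1..n} \<Longrightarrow> prv n (nxt n i) = i"
  by (auto simp: prv_def nxt_def)

lemma nxt_inj: "i \<in> {1..n} \<Longrightarrow> j \<in> {1..n} \<Longrightarrow> nxt n i = nxt n j \<longleftrightarrow> i = j"
  by (metis prv_nxt)

lemma move_edge: "x \<in> edges n \<Longrightarrow> move n s x \<in> edges n"
  using nxt_mem by (auto simp: edges_def move_def)

lemma move_commute: "move n s (move n (\<not> s) x) = move n (\<not> s) (move n s x)"
  by (simp add: move_def)

lemma gamma_tau_edge: "x \<in> edges n \<Longrightarrow> gamma_tau n x \<in> edges n"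
  using prv_mem by (auto simp: edges_def gamma_tau_def)

lemma gamma_tau_move: "x \<in> edges n \<Longrightarrow> gamma_tau n (move n s (move n (\<not> s) x)) = x"
  using prv_nxt by (cases s) (auto simp: edges_def gamma_tau_def move_def)

lemma move_gamma_tau: "z \<in> edges n \<Longrightarrow> move n s (move n (\<not> s) (gamma_tau n z)) = z"
  using nxt_prv by (cases s) (auto simp: edges_def gamma_tau_def move_def)

lemma room_True_pos_iff: "x \<in> edges n \<Longrightarrow> 0 < room n True x \<longleftrightarrow> snd x \<noteq> nxt n (fst x)"
  by (auto simp: edges_def room_def level_def nxt_def)

lemma room_False_pos_iff: "x \<in> edges n \<Longrightarrow> 0 < room n False x \<longleftrightarrow> fst x \<noteq> snd x"
  by (auto simp: edges_def room_def level_def)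

lemma level_move:
  assumes "x \<in> edges n" "0 < room n s x"
  shows "level n (move n s x) = (if s then level n x - 1 else level n x + 1)"
  using assms by (auto simp: edges_def room_def level_def move_def nxt_def split: if_splits)

lemma room_move:
  assumes "x \<in> edges n" "0 < room n s x"
  shows "room n s (move n s x) = room n s x - 1" "room n (\<not> s) (move n s x) = room n (\<not> s) x + 1"
  using level_move[OF assms] assms(2) level_bounds[OF assms(1)]
  by (auto simp: room_def split: if_splits)

lemma gamma_arrow_iff:
  "gamma_arrow n x y \<longleftrightarrow> x \<in> edges n \<and> (\<exists>s. y = move n s x \<and> 0 < room n s x)"
proof (cases "x \<in> edges n")
  case True
  have "gamma_arrow n x y \<longleftrightarrow>
      (y = move n True x \<and> 0 < room n True x) \<or> (y = move n False x \<and> 0 < room n False x)"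
    unfolding room_True_pos_iff[OF True] room_False_pos_iff[OF True]
    using True by (cases x) (simp add: gamma_arrow_def move_def)
  then show ?thesis using True by (metis (full_types))
qed (simp add: gamma_arrow_def)

text \<open>Positive room excludes n = 1, where both moves are the identity.\<close>

lemma move_move_neq: "x \<in> edges n \<Longrightarrow> 0 < room n s x \<Longrightarrow> move n True x \<noteq> move n False x"
  by (cases s) (auto simp: edges_def room_def level_def move_def nxt_def split: if_splits)

text \<open>The target is the inverse translate of x, so this is the axiom of a translation quiver:
  its predecessors are the successors of x. At a border row the arrow missing on one side of the
  mesh is missing on the other side too.\<close>

lemma gamma_arrow_mesh:
  assumes "x \<in> edges n"
  shows "gamma_arrow n y (move n True (move n False x)) \<longleftrightarrow> (\<exists>s. y = move n s x \<and> 0 < room n s x)"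
proof
  assume "\<exists>s. y = move n s x \<and> 0 < room n s x"
  then obtain s where s: "y = move n s x" "0 < room n s x" by blast
  have "move n True (move n False x) = move n (\<not> s) (move n s x)"
    using move_commute[of n True x] by (cases s) auto
  then show "gamma_arrow n y (move n True (move n False x))"
    using s room_move(2)[OF assms s(2)] move_edge[OF assms] unfolding gamma_arrow_iff by auto
next
  assume "gamma_arrow n y (move n True (move n False x))"
  then obtain s where y: "y \<in> edges n" and eq: "move n True (move n False x) = move n s y"
    and s: "0 < room n s y"
    unfolding gamma_arrow_iff by blast
  have "y = move n (\<not> s) x"
    using eq y assms nxt_inj by (cases s) (auto simp: edges_def move_def)
  moreover have "0 < room n (\<not> s) x"
    using s \<open>y = move n (\<not> s) x\<close> assms
    by (cases s) (auto simp: edges_def room_def level_def move_def nxt_def split: if_splits)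
  ultimately show "\<exists>s. y = move n s x \<and> 0 < room n s x" by blast
qed

subsection \<open>Paths\<close>

definition single :: "edge list \<Rightarrow> edge list \<Rightarrow> 'k::field" where
  "single p = (\<lambda>q. if q = p then 1 else 0)"

lemma single_support: "{q. (single p q :: 'k::field) \<noteq> 0} = {p}"
  by (auto simp: single_def)

lemma single_same [simp]: "single p p = 1"
  by (simp add: single_def)

lemma gamma_path_append:
  assumes "gamma_path n x y p" "gamma_path n y z q"
  shows "gamma_path n x z (p @ tl q)"
proof -
  obtain q' where q: "q = y # q'"
    using assms(2) by (cases q) (auto simp: gamma_path_def)
  have "successively (gamma_arrow n) (p @ q')"
    using assms unfolding gamma_path_def q
    by (auto simp: successively_append_iff successively_Cons)
  then show ?thesis
    using assms unfolding gamma_path_def q by (auto split: if_splits)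
qed

lemma path_Hom: "f \<in> Hom (path_category n) x y \<longleftrightarrow>
    finite {p. f p \<noteq> 0} \<and> (\<forall>p. f p \<noteq> 0 \<longrightarrow> gamma_path n x y p)"
  by (simp add: path_category_def)

lemma path_Comp: "Comp (path_category n) x y z g f =
    (\<lambda>r. \<Sum>p\<in>{p. f p \<noteq> 0}. \<Sum>q\<in>{q. g q \<noteq> 0}. if r = p @ tl q then g q * f p else 0)"
  by (simp add: path_category_def)

lemma path_Idt: "Idt (path_category n) x = single [x]"
  by (simp add: path_category_def single_def)

lemma path_scl: "scl (path_category n) c f = (\<lambda>p. c * f p)"
  by (simp add: path_category_def)

lemma path_Obj: "Obj (path_category n) = edges n"
  by (simp add: path_category_def)

lemma single_Hom: "gamma_path n x y p \<Longrightarrow> single p \<in> Hom (path_category n) x y"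
  unfolding path_Hom single_support by (simp add: single_def)

lemma Comp_single: "Comp (path_category n) x y z (single q) (single p) = single (p @ tl q)"
  unfolding path_Comp single_support by (auto simp: single_def)

lemma path_Comp_support:
  "{r. Comp (path_category n) x y z g f r \<noteq> 0} \<subseteq>
     (\<lambda>(p, q). p @ tl q) ` ({p. f p \<noteq> 0} \<times> {q. g q \<noteq> 0})"
proof
  fix r assume "r \<in> {r. Comp (path_category n) x y z g f r \<noteq> 0}"
  then have "(\<Sum>p\<in>{p. f p \<noteq> 0}. \<Sum>q\<in>{q. g q \<noteq> 0}. if r = p @ tl q then g q * f p else 0) \<noteq> 0"
    by (simp add: path_Comp)
  from sum.not_neutral_contains_not_neutral[OF this] obtain p where
    p: "p \<in> {p. f p \<noteq> 0}" "(\<Sum>q\<in>{q. g q \<noteq> 0}. if r = p @ tl q then g q * f p else 0) \<noteq> 0" .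
  from sum.not_neutral_contains_not_neutral[OF p(2)] obtain q where
    "q \<in> {q. g q \<noteq> 0}" "(if r = p @ tl q then g q * f p else 0) \<noteq> 0" .
  then show "r \<in> (\<lambda>(p, q). p @ tl q) ` ({p. f p \<noteq> 0} \<times> {q. g q \<noteq> 0})"
    using p by (auto split: if_splits)
qed

lemma path_Comp_Hom:
  assumes "f \<in> Hom (path_category n) x y" "g \<in> Hom (path_category n) y z"
  shows "Comp (path_category n) x y z g f \<in> Hom (path_category n) x z"
  unfolding path_Hom
proof (intro conjI allI impI)
  show "finite {r. Comp (path_category n) x y z g f r \<noteq> 0}"
    using assms by (intro finite_subset[OF path_Comp_support]) (simp add: path_Hom)
  fix r assume "Comp (path_category n) x y z g f r \<noteq> 0"
  then have "r \<in> (\<lambda>(p, q). p @ tl q) ` ({p. f p \<noteq> 0} \<times> {q. g q \<noteq> 0})"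
    using path_Comp_support by blast
  then obtain p q where "f p \<noteq> 0" "g q \<noteq> 0" "r = p @ tl q" by auto
  then show "gamma_path n x z r"
    using assms gamma_path_append[of n x y p z q] by (simp add: path_Hom)
qed

subsection \<open>Nonzero morphisms\<close>

text \<open>
  The representation of \<open>\<Gamma>(n)\<close> that is one-dimensional on the edges reached from \<open>x\<close> and zero
  elsewhere; a path acts by the product of the signs of its arrows. The signs make the meshes
  anticommute, so that the mesh ideal acts by zero.
\<close>

definition arrow_sign :: "nat \<Rightarrow> edge \<Rightarrow> edge \<Rightarrow> 'k::field" where
  "arrow_sign n y z = (if snd z = snd y then (-1) ^ level n y else 1)"

fun path_value :: "nat \<Rightarrow> edge \<Rightarrow> edge list \<Rightarrow> 'k::field" where
  "path_value n x (y # z # p) =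
     (if reach n x y \<and> reach n x z then arrow_sign n y z else 0) * path_value n x (z # p)"
| "path_value n x [y] = 1"
| "path_value n x [] = 1"

lemma path_value_append:
  "p \<noteq> [] \<Longrightarrow> q \<noteq> [] \<Longrightarrow> last p = hd q \<Longrightarrow>
   path_value n x (p @ tl q) = path_value n x p * path_value n x q"
proof (induction n x p rule: path_value.induct)
  case (2 n x y)
  then show ?case by (cases q) auto
qed auto

text \<open>The linear extension of \<open>path_value\<close>; a nonzero value will certify that a
  combination of paths lies outside the mesh ideal.\<close>

definition path_form :: "nat \<Rightarrow> edge \<Rightarrow> (edge list \<Rightarrow> 'k::field) \<Rightarrow> 'k" where
  "path_form n x f = (\<Sum>p\<in>{p. f p \<noteq> 0}. f p * path_value n x p)"

lemma path_form_superset: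
  "finite P \<Longrightarrow> {p. f p \<noteq> 0} \<subseteq> P \<Longrightarrow> path_form n x f = (\<Sum>p\<in>P. f p * path_value n x p)"
  unfolding path_form_def by (rule sum.mono_neutral_left) auto

lemma path_form_single: "path_form n x (single p) = path_value n x p"
  by (simp add: path_form_superset[of "{p}"] single_support)

text \<open>Multiplicativity makes vanishing of the form persist under composition on either side,
  as an ideal requires.\<close>

lemma path_form_Comp:
  assumes f: "f \<in> Hom (path_category n) u v" and g: "g \<in> Hom (path_category n) v w"
  shows "path_form n x (Comp (path_category n) u v w g f) = path_form n x g * path_form n x f"
proof -
  let ?P = "{p. f p \<noteq> 0}" and ?Q = "{q. g q \<noteq> 0}"
  let ?R = "(\<lambda>(p, q). p @ tl q) ` (?P \<times> ?Q)"
  have fin: "finite ?P" "finite ?Q" "finite ?R" using f g by (auto simp: path_Hom)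
  have "path_form n x (Comp (path_category n) u v w g f) =
     (\<Sum>r\<in>?R. Comp (path_category n) u v w g f r * path_value n x r)"
    by (rule path_form_superset[OF fin(3) path_Comp_support])
  also have "\<dots> = (\<Sum>r\<in>?R. \<Sum>p\<in>?P. \<Sum>q\<in>?Q. (if r = p @ tl q then g q * f p * path_value n x r else 0))"
    by (simp add: path_Comp sum_distrib_right if_distrib[of "\<lambda>c. c * _"] cong: if_cong)
  \<comment> \<open>Several pairs may concatenate to the same path; with the sum over r innermost,
    each pair picks out its own r.\<close>
  also have "\<dots> = (\<Sum>p\<in>?P. \<Sum>r\<in>?R. \<Sum>q\<in>?Q. (if r = p @ tl q then g q * f p * path_value n x r else 0))"
    by (rule sum.swap)
  also have "\<dots> = (\<Sum>p\<in>?P. \<Sum>q\<in>?Q. \<Sum>r\<in>?R. (if r = p @ tl q then g q * f p * path_value n x r else 0))"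
    by (intro sum.cong[OF refl] sum.swap)
  also have "\<dots> = (\<Sum>p\<in>?P. \<Sum>q\<in>?Q. g q * path_value n x q * (f p * path_value n x p))"
  proof (rule sum.cong[OF refl], rule sum.cong[OF refl])
    fix p q assume pq: "p \<in> ?P" "q \<in> ?Q"
    then have "gamma_path n u v p" "gamma_path n v w q"
      using f g by (auto simp: path_Hom)
    then have "path_value n x (p @ tl q) = (path_value n x p * path_value n x q :: 'a)"
      by (intro path_value_append) (auto simp: gamma_path_def)
    moreover have "p @ tl q \<in> ?R" using pq by (auto intro!: image_eqI[of _ _ "(p, q)"])
    ultimately show "(\<Sum>r\<in>?R. (if r = p @ tl q then g q * f p * path_value n x r else 0)) =
       g q * path_value n x q * (f p * path_value n x p)"
      using fin(3) by simp
  qed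
  also have "\<dots> = path_form n x g * path_form n x f"
    unfolding path_form_def sum_product by (rule sum.swap)
  finally show ?thesis .
qed

text \<open>If two opposite corners of a mesh lie in the rectangle, so do the other two, because
  membership is tested coordinate by coordinate. Such a mesh never touches a border row: a mesh with
  a single middle vertex has an end outside the rectangle, since otherwise its one path would have
  to be zero without a partner to cancel it. The room hypothesis excludes n = 1.\<close>

lemma reach_mesh:
  assumes "x \<in> edges n" "y \<in> edges n" and "reach n x y" "reach n x (move n True (move n False y))"
    and "0 < room n s y"
  shows "reach n x (move n True y)" "reach n x (move n False y)"
    "0 < room n True y" "0 < room n False y"
proof -
  show "reach n x (move n True y)" "reach n x (move n False y)"
    using assms by (auto simp: reach_def move_def)
  obtain a b where x: "x = (a, b)" by (cases x)
  obtain c d where y: "y = (c, d)" by (cases y)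
  have bounds: "1 \<le> a" "a \<le> n" "1 \<le> b" "b \<le> n" "1 \<le> c" "c \<le> n" "1 \<le> d" "d \<le> n"
    using assms(1,2) by (auto simp: x y edges_def)
  have "n \<noteq> 1"
    using bounds assms(5) by (auto simp: y room_def level_def split: if_splits)
  then have n: "2 \<le> n" using bounds by linarith
  have "d \<noteq> nxt n c"
    using assms(3,4) bounds n unfolding x y
    by (auto simp: reach_def move_def cdist_def level_def nxt_def split: if_splits)
  moreover have "c \<noteq> d"
    using assms(3,4) bounds n unfolding x y
    by (auto simp: reach_def move_def cdist_def level_def nxt_def split: if_splits)
  ultimately show "0 < room n True y" "0 < room n False y"
    using room_True_pos_iff[OF assms(2)] room_False_pos_iff[OF assms(2)] by (auto simp: y)
qed

text \<open>The paths of a mesh are distinct by \<open>move_move_neq\<close>, which turns the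
  indicator function of the definition into a sum of basis paths.\<close>

lemma mesh_relation_eq:
  assumes "y \<in> edges n"
  shows "(mesh_relation n (move n True (move n False y)) :: _ \<Rightarrow> 'k::field) =
    (\<lambda>p. \<Sum>s\<in>{s. 0 < room n s y}. single [y, move n s y, move n True (move n False y)] p)"
proof
  fix p
  let ?z = "move n True (move n False y)"
  have tau: "gamma_tau n ?z = y"
    using gamma_tau_move[OF assms, of True] by simp
  show "(mesh_relation n ?z p :: 'k) = (\<Sum>s\<in>{s. 0 < room n s y}. single [y, move n s y, ?z] p)"
  proof (cases "\<exists>s. 0 < room n s y \<and> p = [y, move n s y, ?z]")
    case True
    then obtain s where s: "0 < room n s y" "p = [y, move n s y, ?z]" by blast
    have "single [y, move n s' y, ?z] p = (if s' = s then 1 else 0 :: 'k)" for s'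
      using s move_move_neq[OF assms s(1)] by (cases s; cases s') (auto simp: single_def)
    then have 1: "(\<Sum>s\<in>{s. 0 < room n s y}. single [y, move n s y, ?z] p) = (1 :: 'k)"
      using s(1) by simp
    have "\<exists>m. (\<exists>s. m = move n s y \<and> 0 < room n s y) \<and> p = [y, m, ?z]"
      using s by blast
    then have "mesh_relation n ?z p = (1 :: 'k)"
      unfolding mesh_relation_def gamma_arrow_mesh[OF assms] tau by simp
    with 1 show ?thesis by simp
  next
    case False
    then have "\<not> (\<exists>m. (\<exists>s. m = move n s y \<and> 0 < room n s y) \<and> p = [y, m, ?z])"
      by blast
    then have "mesh_relation n ?z p = (0 :: 'k)"
      unfolding mesh_relation_def gamma_arrow_mesh[OF assms] tau by simp
    moreover have "(\<Sum>s\<in>{s. 0 < room n s y}. single [y, move n s y, ?z] p) = (0 :: 'k)"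
      using False by (intro sum.neutral) (auto simp: single_def)
    ultimately show ?thesis by simp
  qed
qed

lemma path_form_mesh_relation:
  assumes "x \<in> edges n" "y \<in> edges n"
  shows "path_form n x (mesh_relation n (move n True (move n False y))) = (0 :: 'k::field)"
proof -
  let ?z = "move n True (move n False y)"
  let ?P = "(\<lambda>s. [y, move n s y, ?z]) ` {s. 0 < room n s y}"
  have tau: "gamma_tau n ?z = y"
    using gamma_tau_move[OF assms(2), of True] by simp
  have inj: "inj_on (\<lambda>s. [y, move n s y, ?z]) {s. 0 < room n s y}"
  proof (rule inj_onI)
    fix s t assume "s \<in> {s. 0 < room n s y}" "[y, move n s y, ?z] = [y, move n t y, ?z]"
    then show "s = t"
      using move_move_neq[OF assms(2), of s] by (cases s; cases t) auto
  qed
  have val: "(\<Sum>t\<in>{s. 0 < room n s y}. single [y, move n t y, ?z] [y, move n s y, ?z]) = (1 :: 'k)"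
    if "0 < room n s y" for s
  proof -
    have "single [y, move n t y, ?z] [y, move n s y, ?z] = (if t = s then 1 else 0 :: 'k)" for t
      using move_move_neq[OF assms(2) that] by (cases s; cases t) (auto simp: single_def)
    then show ?thesis using that by simp
  qed
  have "path_form n x (mesh_relation n ?z :: _ \<Rightarrow> 'k) =
      (\<Sum>p\<in>?P. mesh_relation n ?z p * path_value n x p)"
    by (rule path_form_superset) (auto simp: mesh_relation_def gamma_arrow_mesh[OF assms(2)] tau
        split: if_splits)
  also have "\<dots> = (\<Sum>s\<in>{s. 0 < room n s y}. path_value n x [y, move n s y, ?z])"
    using val by (simp add: sum.reindex[OF inj] mesh_relation_eq[OF assms(2)])
  also have "\<dots> = 0"
  \<comment> \<open>Outside this case each path of the mesh has an end that is not reached, or there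
    is no path at all.\<close>
  proof (cases "reach n x y \<and> reach n x ?z \<and> (\<exists>s. 0 < room n s y)")
    case False
    then show ?thesis by (intro sum.neutral) auto
  next
    case True
    then obtain s where s: "reach n x y" "reach n x ?z" "0 < room n s y" by blast
    note r = reach_mesh[OF assms s]
    have "{s. 0 < room n s y} = UNIV" using r by (auto intro: bool.induct)
    moreover have "snd (move n False y) \<noteq> snd y"
      using move_move_neq[OF assms(2) r(3)] r(4) assms(2)
      by (auto simp: move_def edges_def nxt_def room_def level_def split: if_splits)
    moreover have "snd ?z \<noteq> snd (move n True y)" "snd ?z = snd (move n False y)" "snd (move n True y) = snd y"
      using calculation(2) by (auto simp: move_def)
    \<comment> \<open>The start advances at y on one path and at \<open>move n False y\<close> on
      the other. These levels differ by one, so the signs are opposite.\<close>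
    ultimately show ?thesis
      using s r level_move[OF assms(2) r(4)] by (simp add: UNIV_bool arrow_sign_def)
  qed
  finally show ?thesis .
qed

text \<open>Membership in \<open>Hom\<close> is carried through the induction because
  \<open>path_form_Comp\<close> applies to finite combinations of genuine paths.\<close>

lemma mesh_ideal_path_form:
  fixes f :: "edge list \<Rightarrow> 'k::field"
  assumes "mesh_ideal n u v f" "x \<in> edges n"
  shows "f \<in> Hom (path_category n) u v \<and> path_form n x f = 0"
  using assms(1)
proof (induction rule: mesh_ideal.induct)
  case (relation z)
  let ?y = "gamma_tau n z"
  have y: "?y \<in> edges n" and z: "move n True (move n False ?y) = z"
    using gamma_tau_edge[OF relation] move_gamma_tau[OF relation, of True] by simp_all
  have "(mesh_relation n z :: _ \<Rightarrow> 'k) \<in> Hom (path_category n) ?y z"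
    unfolding path_Hom
  proof (intro conjI allI impI)
    have "{p. mesh_relation n z p \<noteq> (0 :: 'k)} \<subseteq> (\<lambda>s. [?y, move n s ?y, z]) ` UNIV"
      using gamma_arrow_mesh[OF y] unfolding z by (auto simp: mesh_relation_def split: if_splits)
    then show "finite {p. mesh_relation n z p \<noteq> (0 :: 'k)}"
      by (rule finite_subset) simp
    fix p assume "mesh_relation n z p \<noteq> (0 :: 'k)"
    then obtain m where m: "gamma_arrow n m z" "p = [?y, m, z]"
      by (auto simp: mesh_relation_def split: if_splits)
    then have "gamma_arrow n ?y m"
      using gamma_arrow_mesh[OF y] y unfolding z by (auto simp: gamma_arrow_iff)
    then show "gamma_path n ?y z p"
      using m y relation by (auto simp: gamma_path_def gamma_arrow_iff)
  qed
  moreover have "path_form n x (mesh_relation n z) = (0 :: 'k)"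
    using path_form_mesh_relation[OF assms(2) y] unfolding z .
  ultimately show ?case by simp
next
  case (zero u v)
  then show ?case by (simp add: path_Hom path_form_def)
next
  case (add u v f g)
  let ?P = "{p. f p \<noteq> 0} \<union> {p. g p \<noteq> 0}"
  have P: "finite ?P" using add by (simp add: path_Hom)
  have "{p. (f + g) p \<noteq> 0} \<subseteq> ?P" by auto
  moreover have "path_form n x (f + g) = path_form n x f + path_form n x g"
    by (subst (1 2 3) path_form_superset[OF P]) (auto simp: sum.distrib distrib_right)
  moreover have "gamma_path n u v p" if "(f + g) p \<noteq> 0" for p
    using add that by (cases "f p = 0") (auto simp: path_Hom)
  ultimately show ?case
    using add finite_subset[OF _ P] by (simp only: path_Hom) simp
next
  case (scale u v f c)
  have "path_form n x (\<lambda>p. c * f p) = c * path_form n x f"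
    unfolding path_form_def[of n x f] sum_distrib_left mult.assoc[symmetric]
    using scale by (intro path_form_superset) (auto simp: path_Hom)
  then show ?case
    using scale by (auto simp: path_Hom path_scl intro: finite_subset[of _ "{p. f p \<noteq> 0}"])
next
  case (left u v f w g)
  then show ?case by (simp add: path_Comp_Hom path_form_Comp)
next
  case (right v w g u f)
  then show ?case by (simp add: path_Comp_Hom path_form_Comp)
qed

text \<open>The level is the difference of the lifted coordinates. Modulo n the equation holds for
  all pairs of edges; \<open>reach\<close> selects the lift for which it is exact.\<close>

lemma reach_level:
  assumes "x \<in> edges n" "y \<in> edges n" "reach n x y"
  shows "level n y + cdist n (fst x) (fst y) = level n x + cdist n (snd x) (snd y)"
  using assms by (auto simp: edges_def reach_def cdist_def level_def split: if_splits)

text \<open>Walk back inside the rectangle: retreat the end vertex while it differs from that of x,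
  then the start vertex. The retreat reverses a genuine arrow, because \<open>reach_level\<close>
  keeps y off row 1 in the first case and off row n in the second.\<close>

lemma reach_predecessor:
  assumes "x \<in> edges n" "y \<in> edges n" "reach n x y" "x \<noteq> y"
  obtains s y' where "y' \<in> edges n" "reach n x y'" "0 < room n s y'" "y = move n s y'"
    "cdist n (fst x) (fst y') + cdist n (snd x) (snd y') <
     cdist n (fst x) (fst y) + cdist n (snd x) (snd y)"
proof -
  obtain a b where x: "x = (a, b)" by (cases x)
  obtain c d where y: "y = (c, d)" by (cases y)
  have bounds: "a \<in> {1..n}" "b \<in> {1..n}" "c \<in> {1..n}" "d \<in> {1..n}"
    using assms(1,2) by (auto simp: x y edges_def)
  note lev = reach_level[OF assms(1-3)] level_bounds[OF assms(1)] level_bounds[OF assms(2)]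
  have step: "cdist n i (prv n k) = cdist n i k - 1" if "i \<in> {1..n}" "k \<in> {1..n}" "i \<noteq> k" for i k
    using that by (auto simp: cdist_def prv_def)
  have pos: "0 < cdist n i k" if "i \<in> {1..n}" "k \<in> {1..n}" "i \<noteq> k" for i k
    using that by (auto simp: cdist_def)
  show ?thesis
  proof (cases "b = d")
    case False
    have "level n y > 1"
      using lev pos[OF bounds(2,4) False] assms(3) by (simp add: x y reach_def)
    moreover have "level n (a, b) + cdist n b d - Suc 0 \<le> n"
      using assms(3) unfolding x y reach_def fst_conv snd_conv by linarith
    ultimately have "c \<noteq> prv n d" "level n (a, b) + cdist n b d - Suc 0 \<le> n"
      using bounds by (auto simp: y level_def prv_def split: if_splits)
    then show ?thesis
      using that[of "(c, prv n d)" False] bounds step[OF bounds(2,4) False] pos[OF bounds(2,4) False]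
        assms(3) room_False_pos_iff[of "(c, prv n d)" n] prv_mem nxt_prv
      by (simp add: x y edges_def reach_def move_def)
  next
    case True
    then have ac: "a \<noteq> c" using assms(4) by (simp add: x y)
    have "cdist n a c - Suc 0 < level n (a, b)"
      using assms(3) unfolding x y reach_def fst_conv snd_conv by linarith
    moreover have "level n y < n"
      using lev pos[OF bounds(1,3) ac] True by (simp add: x y cdist_def)
    then have "d \<noteq> c"
      by (auto simp: y level_def)
    ultimately have "d \<noteq> c" "cdist n a c - Suc 0 < level n (a, b)" by simp_all
    then show ?thesis
      using that[of "(prv n c, d)" True] bounds step[OF bounds(1,3) ac] pos[OF bounds(1,3) ac]
        assms(3) room_True_pos_iff[of "(prv n c, d)" n] prv_mem nxt_prv
      by (simp add: x y edges_def reach_def move_def)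
  qed
qed

text \<open>All arrows of a path inside the rectangle have sign 1 or -1, so its value is not
  zero.\<close>

lemma reach_path:
  assumes "x \<in> edges n" "y \<in> edges n" "reach n x y"
  shows "\<exists>p. gamma_path n x y p \<and> path_value n x p \<noteq> (0 :: 'k::field)"
  using assms(2,3)
proof (induction "cdist n (fst x) (fst y) + cdist n (snd x) (snd y)" arbitrary: y rule: less_induct)
  case less
  show ?case
  proof (cases "x = y")
    case True
    then show ?thesis
      using assms(1) by (intro exI[of _ "[x]"]) (simp add: gamma_path_def)
  next
    case False
    obtain s y' where y': "y' \<in> edges n" "reach n x y'" "0 < room n s y'" "y = move n s y'"
      "cdist n (fst x) (fst y') + cdist n (snd x) (snd y') <
       cdist n (fst x) (fst y) + cdist n (snd x) (snd y)"
      using reach_predecessor[OF assms(1) less.prems False] by metis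
    obtain p where p: "gamma_path n x y' p" "path_value n x p \<noteq> (0 :: 'k)"
      using less.hyps[OF y'(5,1,2)] by blast
    have arrow: "gamma_path n y' y [y', y]"
      using y'(1,3,4) less.prems by (auto simp: gamma_path_def gamma_arrow_iff)
    have "path_value n x (p @ tl [y', y]) = path_value n x p * (path_value n x [y', y] :: 'k)"
      using p(1) by (intro path_value_append) (auto simp: gamma_path_def)
    moreover have "path_value n x [y', y] \<noteq> (0 :: 'k)"
      using y'(2) less.prems by (simp add: arrow_sign_def)
    ultimately show ?thesis
      using gamma_path_append[OF p(1) arrow] p(2) by (intro exI[of _ "p @ tl [y', y]"]) auto
  qed
qed

subsection \<open>Vanishing morphisms\<close>

text \<open>A path is recorded by the directions of its steps. In this form a mesh relation
  exchanges two neighbouring letters, and the end depends only on how often each letter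
  occurs.\<close>

primrec word_end :: "nat \<Rightarrow> edge \<Rightarrow> bool list \<Rightarrow> edge" where
  "word_end n x [] = x"
| "word_end n x (s # w) = word_end n (move n s x) w"

primrec word_path :: "nat \<Rightarrow> edge \<Rightarrow> bool list \<Rightarrow> edge list" where
  "word_path n x [] = [x]"
| "word_path n x (s # w) = x # word_path n (move n s x) w"

primrec word_valid :: "nat \<Rightarrow> edge \<Rightarrow> bool list \<Rightarrow> bool" where
  "word_valid n x [] \<longleftrightarrow> x \<in> edges n"
| "word_valid n x (s # w) \<longleftrightarrow> x \<in> edges n \<and> 0 < room n s x \<and> word_valid n (move n s x) w"

lemma word_valid_edge: "word_valid n x w \<Longrightarrow> x \<in> edges n"
  by (cases w) auto

lemma word_end_append: "word_end n x (u @ w) = word_end n (word_end n x u) w"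
  by (induction u arbitrary: x) auto

lemma word_valid_append:
  "word_valid n x (u @ w) \<longleftrightarrow> word_valid n x u \<and> word_valid n (word_end n x u) w"
  by (induction u arbitrary: x) (auto dest: word_valid_edge)

lemma word_path_hd: "word_path n x w = x # tl (word_path n x w)"
  by (cases w) auto

lemma word_path_append:
  "word_path n x (u @ w) = word_path n x u @ tl (word_path n (word_end n x u) w)"
  by (induction u arbitrary: x) (auto simp: word_path_hd[symmetric])

lemma word_end_edge: "word_valid n x w \<Longrightarrow> word_end n x w \<in> edges n"
  by (induction w arbitrary: x) auto

lemma word_gamma_path: "word_valid n x w \<Longrightarrow> gamma_path n x (word_end n x w) (word_path n x w)"
proof (induction w arbitrary: x)
  case (Cons s w)
  have "gamma_path n x (move n s x) [x, move n s x]"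
    using Cons.prems move_edge by (auto simp: gamma_path_def gamma_arrow_iff)
  then have "gamma_path n x (word_end n x (s # w)) ([x, move n s x] @ tl (word_path n (move n s x) w))"
    using Cons.IH[of "move n s x"] Cons.prems by (intro gamma_path_append) simp_all
  then show ?case
    using word_path_hd[of n "move n s x" w] by simp
qed (simp add: gamma_path_def)

lemma gamma_path_word:
  assumes "gamma_path n x y p"
  obtains w where "word_valid n x w" "word_end n x w = y" "word_path n x w = p"
proof -
  have "\<exists>w. word_valid n x w \<and> word_end n x w = y \<and> word_path n x w = p"
    using assms
  proof (induction p arbitrary: x)
    case (Cons a p)
    show ?case
    proof (cases p)
      case Nil
      then show ?thesis
        using Cons.prems by (intro exI[of _ "[]"]) (auto simp: gamma_path_def)
    next
      case (Cons b p')
      have "a = x" "gamma_arrow n x b" "gamma_path n b y p"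
        using Cons.prems \<open>p = b # p'\<close> by (auto simp: gamma_path_def)
      then obtain w s where "word_valid n b w" "word_end n b w = y" "word_path n b w = p"
        "b = move n s x" "0 < room n s x" "x \<in> edges n"
        using Cons.IH[of b] by (auto simp: gamma_arrow_iff)
      then show ?thesis
        using \<open>a = x\<close> by (intro exI[of _ "s # w"]) auto
    qed
  qed (simp add: gamma_path_def)
  then show ?thesis using that by blast
qed

section \<open>Cyclic distances along words\<close>

lemma funpow_nxt_mem: "a \<in> {1..n} \<Longrightarrow> (nxt n ^^ k) a \<in> {1..n}"
proof (induction k)
  case (Suc k)
  then show ?case using nxt_mem[of "(nxt n ^^ k) a" n] by simp
qed simp

lemma cdist_nxt:
  "a \<in> {1..n} \<Longrightarrow> c \<in> {1..n} \<Longrightarrow> Suc (cdist n a c) < n \<Longrightarrow> cdist n a (nxt n c) = Suc (cdist n a c)"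
  by (auto simp: cdist_def nxt_def)

lemma cdist_funpow_nxt:
  assumes "a \<in> {1..n}"
  shows "k < n \<Longrightarrow> cdist n a ((nxt n ^^ k) a) = k"
proof (induction k)
  case 0
  then show ?case by (simp add: cdist_def)
next
  case (Suc k)
  then have "cdist n a ((nxt n ^^ k) a) = k" by simp
  moreover have "(nxt n ^^ k) a \<in> {1..n}" by (rule funpow_nxt_mem[OF assms])
  ultimately show ?case
    using cdist_nxt[OF assms] Suc.prems by simp
qed

lemma word_end_eq:
  "word_end n x w = ((nxt n ^^ count_list w True) (fst x), (nxt n ^^ count_list w False) (snd x))"
  by (induction w arbitrary: x) (auto simp: move_def funpow_swap1)

text \<open>Within the available room each letter occurs fewer than n times, so the cyclic distance
  does not wrap around.\<close>

lemma word_cdist: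
  assumes "x \<in> edges n" "\<And>s. count_list w s \<le> room n s x"
  shows "cdist n (fst x) (fst (word_end n x w)) = count_list w True"
    "cdist n (snd x) (snd (word_end n x w)) = count_list w False"
proof -
  have "count_list w True < n" "count_list w False < n"
    using assms(2)[of True] assms(2)[of False] level_bounds[OF assms(1)]
    unfolding room_def if_True if_False by arith+
  then show "cdist n (fst x) (fst (word_end n x w)) = count_list w True"
    "cdist n (snd x) (snd (word_end n x w)) = count_list w False"
    using assms(1) unfolding word_end_eq fst_conv snd_conv
    by (intro cdist_funpow_nxt; auto simp: edges_def)+
qed

text \<open>Used in the contrapositive: a word that ends outside the rectangle has a letter in
  excess of its room.\<close>

lemma word_reach:
  assumes "x \<in> edges n" "\<And>s. count_list w s \<le> room n s x"
  shows "reach n x (word_end n x w)"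
  using assms(2)[of True] assms(2)[of False] level_bounds[OF assms(1)]
  unfolding reach_def word_cdist[OF assms] room_def if_True if_False by arith

text \<open>Likewise, a nontrivial cycle must have a letter in excess.\<close>

lemma word_cycle:
  assumes "x \<in> edges n" "\<And>s. count_list w s \<le> room n s x" "word_end n x w = x"
  shows "w = []"
proof -
  have "count_list w True = 0" "count_list w False = 0"
    using word_cdist[OF assms(1,2)] assms(3) by (simp_all add: cdist_def)
  then show ?thesis
    by (cases w; cases "hd w") auto
qed

section \<open>Morphisms between the objects identified with edges\<close>

locale identified_category = lin_category C
  for C :: "('o, 'm::ab_group_add, 'k::field) lincat" +
  fixes n :: nat and t :: "'o \<Rightarrow> 'o" and \<Psi> :: "(edge, 'o, edge list \<Rightarrow> 'k, 'm) lfunctor"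
  assumes identification: "identification n C t \<Psi>"
begin

interpretation vs: vector_space "scl C"
  by (rule scl_vector_space)

abbreviation E where "E \<equiv> fobj \<Psi>"

lemma E_obj: "x \<in> edges n \<Longrightarrow> E x \<in> Obj C"
  using identification unfolding identification_def linear_functor_def path_Obj by blast

lemma E_translate: "x \<in> edges n \<Longrightarrow> isomorphic C (t (E x)) (E (gamma_tau n x))"
  using identification unfolding identification_def by blast

lemma Psi_full: "x \<in> edges n \<Longrightarrow> y \<in> edges n \<Longrightarrow>
    Hom C (E x) (E y) = fmor \<Psi> x y ` Hom (path_category n) x y"
  using identification unfolding identification_def by blast

lemma Psi_zero_iff: "x \<in> edges n \<Longrightarrow> y \<in> edges n \<Longrightarrow> f \<in> Hom (path_category n) x y \<Longrightarrow>
    fmor \<Psi> x y f = 0 \<longleftrightarrow> mesh_ideal n x y f"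
  using identification unfolding identification_def by blast

lemma Psi_Hom: "x \<in> edges n \<Longrightarrow> y \<in> edges n \<Longrightarrow> f \<in> Hom (path_category n) x y \<Longrightarrow>
    fmor \<Psi> x y f \<in> Hom C (E x) (E y)"
  using Psi_full by blast

lemma Psi_functor: "linear_functor (path_category n) C \<Psi>"
  using identification unfolding identification_def by blast

lemma Psi_add: "x \<in> edges n \<Longrightarrow> y \<in> edges n \<Longrightarrow> f \<in> Hom (path_category n) x y \<Longrightarrow>
    g \<in> Hom (path_category n) x y \<Longrightarrow> fmor \<Psi> x y (f + g) = fmor \<Psi> x y f + fmor \<Psi> x y g"
  using Psi_functor unfolding linear_functor_def path_Obj by blast

lemma Psi_scl: "x \<in> edges n \<Longrightarrow> y \<in> edges n \<Longrightarrow> f \<in> Hom (path_category n) x y \<Longrightarrow>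
    fmor \<Psi> x y (\<lambda>p. c * f p) = scl C c (fmor \<Psi> x y f)"
  using Psi_functor unfolding linear_functor_def path_Obj path_scl by blast

lemma Psi_comp: "x \<in> edges n \<Longrightarrow> y \<in> edges n \<Longrightarrow> z \<in> edges n \<Longrightarrow>
    f \<in> Hom (path_category n) x y \<Longrightarrow> g \<in> Hom (path_category n) y z \<Longrightarrow>
    fmor \<Psi> x z (Comp (path_category n) x y z g f) =
    Comp C (E x) (E y) (E z) (fmor \<Psi> y z g) (fmor \<Psi> x y f)"
  using Psi_functor unfolding linear_functor_def path_Obj by blast

lemma Psi_id: "x \<in> edges n \<Longrightarrow> fmor \<Psi> x x (single [x]) = Idt C (E x)"
  using Psi_functor unfolding linear_functor_def path_Obj path_Idt by blast

text \<open>\<Psi> is given as additive and homogeneous; the expansion over paths comes from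
  truncating f to growing finite subsets of its support.\<close>

lemma Psi_expand:
  assumes "x \<in> edges n" "y \<in> edges n" "f \<in> Hom (path_category n) x y"
  shows "fmor \<Psi> x y f = (\<Sum>p\<in>{p. f p \<noteq> 0}. scl C (f p) (fmor \<Psi> x y (single p)))"
proof -
  have zero: "fmor \<Psi> x y 0 = 0"
    using assms(1,2) Psi_zero_iff mesh_ideal.zero by (simp add: path_Hom)
  have "fmor \<Psi> x y (\<lambda>q. if q \<in> P then f q else 0) = (\<Sum>p\<in>P. scl C (f p) (fmor \<Psi> x y (single p)))
      \<and> (\<lambda>q. if q \<in> P then f q else 0) \<in> Hom (path_category n) x y"
    if "finite P" "P \<subseteq> {p. f p \<noteq> 0}" for P
    using that
  proof (induction P rule: finite_induct)
    case empty
    have "(\<lambda>q. if q \<in> {} then f q else 0) = 0" by (simp add: fun_eq_iff)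
    then show ?case using zero by (simp add: path_Hom)
  next
    case (insert p P)
    define g where "g = (\<lambda>q. if q \<in> P then f q else 0)"
    have g: "g \<in> Hom (path_category n) x y"
      "fmor \<Psi> x y g = (\<Sum>p\<in>P. scl C (f p) (fmor \<Psi> x y (single p)))"
      using insert by (auto simp: g_def)
    have p: "single p \<in> Hom (path_category n) x y"
      using insert.prems assms(3) by (intro single_Hom) (simp add: path_Hom)
    have cp: "(\<lambda>q. f p * single p q) \<in> Hom (path_category n) x y"
      using insert.prems assms(3) by (auto simp: path_Hom single_def)
    have split: "(\<lambda>q. if q \<in> insert p P then f q else 0) = (\<lambda>q. f p * single p q) + g"
      using insert.hyps by (auto simp: g_def single_def fun_eq_iff)
    have "(\<lambda>q. if q \<in> insert p P then f q else 0) \<in> Hom (path_category n) x y"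
      using insert.prems insert.hyps assms(3) by (auto simp: path_Hom)
    then show ?case
      using insert.hyps Psi_add[OF assms(1,2) cp g(1)] Psi_scl[OF assms(1,2) p, of "f p"] g(2)
      unfolding split by simp
  qed
  from this[of "{p. f p \<noteq> 0}"] have
    "fmor \<Psi> x y (\<lambda>q. if q \<in> {p. f p \<noteq> 0} then f q else 0) =
      (\<Sum>p\<in>{p. f p \<noteq> 0}. scl C (f p) (fmor \<Psi> x y (single p)))"
    using assms(3) by (simp add: path_Hom)
  moreover have "(\<lambda>q. if q \<in> {p. f p \<noteq> 0} then f q else 0) = f" by auto
  ultimately show ?thesis by simp
qed

definition word_mor :: "edge \<Rightarrow> bool list \<Rightarrow> 'm" where
  "word_mor x w = fmor \<Psi> x (word_end n x w) (single (word_path n x w))"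

lemma word_mor_Hom: "word_valid n x w \<Longrightarrow> word_mor x w \<in> Hom C (E x) (E (word_end n x w))"
  unfolding word_mor_def
  by (intro Psi_Hom single_Hom word_gamma_path word_end_edge word_valid_edge)

lemma word_mor_append:
  assumes "word_valid n x (u @ w)"
  shows "word_mor x (u @ w) = Comp C (E x) (E (word_end n x u)) (E (word_end n x (u @ w)))
    (word_mor (word_end n x u) w) (word_mor x u)"
proof -
  have v: "word_valid n x u" "word_valid n (word_end n x u) w"
    using assms by (simp_all add: word_valid_append)
  have "word_mor x (u @ w) = fmor \<Psi> x (word_end n x (u @ w))
     (Comp (path_category n) x (word_end n x u) (word_end n x (u @ w))
       (single (word_path n (word_end n x u) w)) (single (word_path n x u)))"
    unfolding word_mor_def Comp_single word_path_append ..
  also have "\<dots> = Comp C (E x) (E (word_end n x u)) (E (word_end n x (u @ w)))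
    (word_mor (word_end n x u) w) (word_mor x u)"
    unfolding word_mor_def word_end_append using v word_end_edge
    by (intro Psi_comp single_Hom word_gamma_path) (auto intro: word_valid_edge)
  finally show ?thesis .
qed

lemma word_mor_append3:
  assumes "word_valid n x (u @ v @ w)"
  shows "word_mor x (u @ v @ w) =
    Comp C (E x) (E (word_end n x (u @ v))) (E (word_end n x (u @ v @ w)))
      (word_mor (word_end n x (u @ v)) w)
      (Comp C (E x) (E (word_end n x u)) (E (word_end n x (u @ v)))
        (word_mor (word_end n x u) v) (word_mor x u))"
  using word_mor_append[of x "u @ v" w] word_mor_append[of x u v] assms
  by (simp add: word_valid_append)

text \<open>The image of the mesh relation that starts at x. Without room for the other letter the
  mesh has one middle vertex, and its only path is zero.\<close>

lemma word_mor_mesh: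
  assumes "x \<in> edges n" "0 < room n s x"
  shows "word_mor x [s, \<not> s] + (if 0 < room n (\<not> s) x then word_mor x [\<not> s, s] else 0) = 0"
proof -
  let ?z = "move n True (move n False x)"
  have zs: "move n (\<not> r) (move n r x) = ?z" for r
    using move_commute[of n True x] by (cases r) auto
  have z: "?z \<in> edges n" using assms(1) move_edge by blast
  have mid: "move n r x \<in> edges n" for r using assms(1) move_edge by blast
  have path: "gamma_path n x ?z [x, move n r x, ?z]" if "0 < room n r x" for r
  proof -
    have "gamma_arrow n (move n r x) ?z"
      unfolding gamma_arrow_mesh[OF assms(1)] using that by blast
    then show ?thesis
      using that assms(1) z mid by (auto simp: gamma_path_def gamma_arrow_iff)
  qed
  have mor: "word_mor x [r, \<not> r] = fmor \<Psi> x ?z (single [x, move n r x, ?z])" for r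
    by (simp add: word_mor_def zs)
  have tau: "gamma_tau n ?z = x"
    using gamma_tau_move[OF assms(1), of True] by simp
  have mesh: "mesh_ideal n x ?z (mesh_relation n ?z)"
    using mesh_ideal.relation[OF z] unfolding tau .
  have "(mesh_relation n ?z :: _ \<Rightarrow> 'k) = single [x, move n s x, ?z] +
    (if 0 < room n (\<not> s) x then single [x, move n (\<not> s) x, ?z] else 0)"
  proof -
    have "{r. 0 < room n r x} = (if 0 < room n (\<not> s) x then {s, \<not> s} else {s})"
    proof (rule set_eqI)
      show "r \<in> {r. 0 < room n r x} \<longleftrightarrow> r \<in> (if 0 < room n (\<not> s) x then {s, \<not> s} else {s})" for r
        using assms(2) by (cases r; cases s) auto
    qed
    then show ?thesis
      unfolding mesh_relation_eq[OF assms(1)] by (simp add: fun_eq_iff)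
  qed
  moreover have "fmor \<Psi> x ?z (single [x, move n s x, ?z] + single [x, move n (\<not> s) x, ?z]) =
      word_mor x [s, \<not> s] + word_mor x [\<not> s, s]" if "0 < room n (\<not> s) x"
    using Psi_add[OF assms(1) z single_Hom[OF path[OF assms(2)]] single_Hom[OF path[OF that]]]
      mor[of s] mor[of "\<not> s"] by simp
  moreover have "fmor \<Psi> x ?z (mesh_relation n ?z) = 0"
    using Psi_zero_iff[OF assms(1) z] mesh mesh_ideal_path_form[OF mesh assms(1)] by blast
  ultimately show ?thesis
    using mor[of s] by (auto split: if_splits)
qed

text \<open>
  Modulo the mesh ideal the steps of a word anticommute, so a letter occurring more often than
  there is room for it can be moved to the front until the word leaves \<open>\<Gamma>(n)\<close>.
\<close>

lemma word_mor_zero: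
  "word_valid n x w \<Longrightarrow> room n s x < count_list w s \<Longrightarrow> word_mor x w = 0"
proof (induction "length w" arbitrary: x w rule: less_induct)
  case less
  have "s \<in> set w"
    using less.prems(2) count_notin by fastforce
  \<comment> \<open>Split at the first s, so that everything in front of it is a power of the other
    letter.\<close>
  then obtain u v where uv: "w = u @ s # v" "s \<notin> set u"
    by (meson split_list_first)
  define m where "m = length u"
  have u: "u = replicate m (\<not> s)"
    using uv(2) unfolding m_def by (induction u) auto
  \<comment> \<open>The inner induction brings s to the front past m letters. Fixing the length
    keeps the outer hypothesis applicable.\<close>
  have "word_mor x (replicate m (\<not> s) @ s # v) = 0"
    if "word_valid n x (replicate m (\<not> s) @ s # v)"
      "room n s x < count_list (replicate m (\<not> s) @ s # v) s"
      "length (replicate m (\<not> s) @ s # v) = length w" for v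
    using that
  proof (induction m arbitrary: v)
    case 0
    have x: "x \<in> edges n" and r: "0 < room n s x" and v: "word_valid n (move n s x) v"
      using 0 by simp_all
    \<comment> \<open>With s in front, one step lowers both its room and its count by one, so the
      excess persists in a shorter word.\<close>
    have "word_mor (move n s x) v = 0"
      using 0 v room_move(1)[OF x r] r by (intro less.hyps) auto
    then show ?case
      using word_mor_append[of x "[s]" v] 0(1) x r v word_mor_Hom[of x "[s]"] E_obj
        word_end_edge[OF v] move_edge[OF x]
      by (simp add: comp_zero_left)
  next
    case (Suc m)
    let ?u = "replicate m (\<not> s)"
    let ?x = "word_end n x ?u"
    have eq: "replicate (Suc m) (\<not> s) @ s # v = ?u @ [\<not> s, s] @ v"
      by (simp add: replicate_app_Cons_same)
    have valid: "word_valid n x (?u @ [\<not> s, s] @ v)"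
      using Suc.prems(1) unfolding eq .
    then have x: "?x \<in> edges n" "0 < room n (\<not> s) ?x" "word_valid n x ?u"
      by (auto simp: word_valid_append)
    have same: "word_end n x (?u @ [\<not> s, s]) = word_end n x (?u @ [s, \<not> s])"
      using move_commute[of n s ?x] by (simp add: word_end_append)
    let ?y = "word_end n x (?u @ [s, \<not> s])" and ?z = "word_end n x (?u @ [s, \<not> s] @ v)"
    have z: "word_end n x (?u @ [\<not> s, s] @ v) = ?z"
      using same by (simp add: word_end_append)
    have v: "word_valid n ?y v"
      using valid same by (simp add: word_valid_append word_end_append)
    have yz: "?y \<in> edges n" "?z \<in> edges n"
      using word_valid_edge[OF v] word_end_edge[OF v] by (simp_all add: word_end_append)
    note hom = word_mor_Hom[OF x(3)] word_mor_Hom[OF v, unfolded word_end_append[symmetric]]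
    note obj = E_obj[OF word_valid_edge[OF x(3)]] E_obj[OF x(1)] E_obj[OF yz(1)] E_obj[OF yz(2)]
    have split: "word_mor x (?u @ [\<not> s, s] @ v) = Comp C (E x) (E ?y) (E ?z) (word_mor ?y v)
        (Comp C (E x) (E ?x) (E ?y) (word_mor ?x [\<not> s, s]) (word_mor x ?u))"
      using word_mor_append3[OF valid] unfolding same z .
    have mesh: "word_mor ?x [\<not> s, s] + (if 0 < room n s ?x then word_mor ?x [s, \<not> s] else 0) = 0"
      using word_mor_mesh[OF x(1,2)] unfolding not_not .
    have hom1: "word_mor ?x [\<not> s, s] \<in> Hom C (E ?x) (E ?y)"
      using word_mor_Hom[of ?x "[\<not> s, s]"] valid same word_valid_edge[OF v]
      by (simp add: word_valid_append word_end_append word_valid_edge)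
    show ?case
    \<comment> \<open>Either the mesh at \<open>?x\<close> consists of this path alone, which is
      then zero, or the path is minus the one with the letters exchanged, where s stands one place
      further forward.\<close>
    proof (cases "0 < room n s ?x")
      case False
      then have "word_mor ?x [\<not> s, s] = 0" using mesh by simp
      then show ?thesis
        unfolding eq split using hom obj by (simp add: comp_zero_left comp_zero_right)
    next
      case True
      have valid': "word_valid n x (?u @ [s, \<not> s] @ v)"
        using x True v room_move(2)[OF x(1) True] move_edge[OF x(1)] same
        by (simp add: word_valid_append word_end_append)
      have hom2: "word_mor ?x [s, \<not> s] \<in> Hom C (E ?x) (E ?y)"
        using word_mor_Hom[of ?x "[s, \<not> s]"] valid' word_valid_edge[OF v]
        by (simp add: word_valid_append word_end_append word_valid_edge)
      have "word_mor x (?u @ [s, \<not> s] @ v) = 0"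
        using Suc.IH[of "(\<not> s) # v"] valid' Suc.prems by simp
      then have zero: "Comp C (E x) (E ?y) (E ?z) (word_mor ?y v)
          (Comp C (E x) (E ?x) (E ?y) (word_mor ?x [s, \<not> s]) (word_mor x ?u)) = 0"
        using word_mor_append3[OF valid'] by simp
      have "word_mor x (?u @ [\<not> s, s] @ v) = Comp C (E x) (E ?y) (E ?z) (word_mor ?y v)
          (Comp C (E x) (E ?x) (E ?y) (word_mor ?x [\<not> s, s] + word_mor ?x [s, \<not> s]) (word_mor x ?u))"
        unfolding split using zero hom hom1 hom2 obj
        by (simp add: comp_add_left comp_add_right comp_hom)
      also have "\<dots> = 0"
        using mesh True hom obj by (simp add: comp_zero_left comp_zero_right)
      finally show ?thesis unfolding eq .
    qed
  qed
  from this[of v] show ?case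
    using less.prems uv u by simp
qed

text \<open>By \<open>word_reach\<close> and \<open>word_cycle\<close> such a path has a letter in
  excess, so \<open>word_mor_zero\<close> applies.\<close>

lemma Psi_path_zero:
  assumes "gamma_path n x y p" "x \<in> edges n" and "\<not> reach n x y \<or> (x = y \<and> p \<noteq> [x])"
  shows "fmor \<Psi> x y (single p) = 0"
proof -
  obtain w where w: "word_valid n x w" "word_end n x w = y" "word_path n x w = p"
    using gamma_path_word[OF assms(1)] by metis
  have "\<exists>s. room n s x < count_list w s"
  proof (rule ccontr)
    assume "\<not> ?thesis"
    then have c: "\<And>s. count_list w s \<le> room n s x" by (simp add: not_less)
    show False
      using word_reach[OF assms(2) c] word_cycle[OF assms(2) c] w assms(3) by auto
  qed
  then show ?thesis
    using word_mor_zero[OF w(1)] w by (auto simp: word_mor_def)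
qed

lemma Hom_zero_iff_not_reach:
  assumes "x \<in> edges n" "y \<in> edges n"
  shows "Hom C (E x) (E y) = {0} \<longleftrightarrow> \<not> reach n x y"
proof
  assume zero: "Hom C (E x) (E y) = {0}"
  show "\<not> reach n x y"
  proof
    assume "reach n x y"
    then obtain p where p: "gamma_path n x y p" "path_value n x p \<noteq> (0 :: 'k)"
      using reach_path[OF assms] by blast
    have "fmor \<Psi> x y (single p) = 0"
      using Psi_Hom[OF assms single_Hom[OF p(1)]] zero by simp
    then have "mesh_ideal n x y (single p :: _ \<Rightarrow> 'k)"
      using Psi_zero_iff[OF assms single_Hom[OF p(1)]] by simp
    from mesh_ideal_path_form[OF this assms(1)] p(2) show False
      by (simp add: path_form_single)
  qed
next
  assume "\<not> reach n x y"
  have "fmor \<Psi> x y f = 0" if "f \<in> Hom (path_category n) x y" for f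
    unfolding Psi_expand[OF assms that]
    using that Psi_path_zero[OF _ assms(1)] \<open>\<not> reach n x y\<close>
    by (intro sum.neutral) (auto simp: path_Hom)
  then have "Hom C (E x) (E y) \<subseteq> {0}"
    unfolding Psi_full[OF assms] by auto
  then show "Hom C (E x) (E y) = {0}"
    using hom_zero[OF E_obj[OF assms(1)] E_obj[OF assms(2)]] by auto
qed

text \<open>Nontrivial cycles vanish, so only the coefficient of the trivial path survives; this is
  what makes endomorphisms scalar.\<close>

lemma Psi_endo:
  assumes "x \<in> edges n" "f \<in> Hom (path_category n) x x"
  shows "fmor \<Psi> x x f = scl C (f [x]) (Idt C (E x))"
proof -
  have fin: "finite {p. f p \<noteq> 0}" using assms(2) by (simp add: path_Hom)
  have "fmor \<Psi> x x f = (\<Sum>p\<in>{p. f p \<noteq> 0}. if p = [x] then scl C (f [x]) (Idt C (E x)) else 0)"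
    unfolding Psi_expand[OF assms(1,1,2)]
    using assms Psi_path_zero[of x x] Psi_id by (intro sum.cong refl) (auto simp: path_Hom)
  then show ?thesis using fin by simp
qed

sublocale schur_family C "edges n" E
proof
  fix x assume x: "x \<in> edges n"
  show "E x \<in> Obj C" by (rule E_obj[OF x])
  have path: "gamma_path n x x [x]" using x by (simp add: gamma_path_def)
  show "Idt C (E x) \<noteq> 0"
  proof
    assume "Idt C (E x) = 0"
    then have "mesh_ideal n x x (single [x] :: _ \<Rightarrow> 'k)"
      using Psi_id[OF x] Psi_zero_iff[OF x x single_Hom[OF path]] by simp
    from mesh_ideal_path_form[OF this x] show False
      by (simp add: path_form_single)
  qed
  show "\<exists>c. f = scl C c (Idt C (E x))" if "f \<in> Hom C (E x) (E x)" for f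
    using that Psi_endo[OF x] unfolding Psi_full[OF x x] by auto
  fix y f g assume y: "y \<in> edges n" "x \<noteq> y"
    and "f \<in> Hom C (E x) (E y)" "g \<in> Hom C (E y) (E x)"
  then obtain h k where h: "h \<in> Hom (path_category n) x y" "f = fmor \<Psi> x y h"
    and k: "k \<in> Hom (path_category n) y x" "g = fmor \<Psi> y x k"
    unfolding Psi_full[OF x y(1)] Psi_full[OF y(1) x] by blast
  \<comment> \<open>A concatenation that passes through y, which differs from x, is never the
    trivial path; by \<open>Psi_endo\<close> its coefficient is all that counts.\<close>
  have "Comp (path_category n) x y x k h [x] = 0"
  proof (rule ccontr)
    assume "Comp (path_category n) x y x k h [x] \<noteq> 0"
    then have "[x] \<in> (\<lambda>(p, q). p @ tl q) ` ({p. h p \<noteq> 0} \<times> {q. k q \<noteq> 0})"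
      using path_Comp_support[of n x y x k h] by blast
    then obtain p q where "h p \<noteq> 0" "[x] = p @ tl q" by auto
    moreover from this have "gamma_path n x y p" using h by (simp add: path_Hom)
    ultimately have "p = [x]" "last p = y"
      by (auto simp: gamma_path_def Cons_eq_append_conv)
    then show False using y(2) by simp
  qed
  then show "Comp C (E x) (E y) (E x) g f = 0"
    using Psi_endo[OF x path_Comp_Hom[OF h(1) k(1)]] Psi_comp[OF x y(1) x h(1) k(1)] h k by simp
next
  show "\<exists>X. direct_sum C {..<length xs} (\<lambda>k. E (xs ! k)) X" if "set xs \<subseteq> edges n" for xs
    using that identification unfolding identification_def by blast
  show "\<exists>xs. set xs \<subseteq> edges n \<and> direct_sum C {..<length xs} (\<lambda>k. E (xs ! k)) X"
    if "X \<in> Obj C" for X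
    using that identification unfolding identification_def by blast
qed

end

text \<open>\<open>identification\<close> matches the translate with \<open>gamma_tau\<close> only
  up to isomorphism; this transports vanishing across it.\<close>

lemma (in lin_category) Hom_zero_isomorphic:
  assumes "isomorphic C Y Z" "X \<in> Obj C" "Y \<in> Obj C" "Z \<in> Obj C"
  shows "Hom C X Y = {0} \<longleftrightarrow> Hom C X Z = {0}"
proof -
  obtain f g where fg: "f \<in> Hom C Y Z" "g \<in> Hom C Z Y" "Comp C Y Z Y g f = Idt C Y"
    "Comp C Z Y Z f g = Idt C Z"
    using assms(1) unfolding isomorphic_def is_iso_def by blast
  have transfer: "Hom C X V = {0}"
    if "Hom C X U = {0}" "U \<in> Obj C" "V \<in> Obj C" "a \<in> Hom C U V" "b \<in> Hom C V U"
      "Comp C V U V a b = Idt C V" for U V a b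
  proof -
    have "h = 0" if h: "h \<in> Hom C X V" for h
    proof -
      have "Comp C X V U b h = 0"
        using comp_hom[OF assms(2) \<open>V \<in> Obj C\<close> \<open>U \<in> Obj C\<close> h] \<open>b \<in> _\<close> \<open>Hom C X U = {0}\<close> by auto
      then show ?thesis
        using comp_assoc[OF assms(2) \<open>V \<in> Obj C\<close> \<open>U \<in> Obj C\<close> \<open>V \<in> Obj C\<close> h \<open>b \<in> _\<close> \<open>a \<in> _\<close>]
          h assms(2) that \<open>V \<in> Obj C\<close> \<open>U \<in> Obj C\<close> \<open>a \<in> _\<close> \<open>Comp C V U V a b = Idt C V\<close>
        by (simp add: comp_id_left comp_zero_right)
    qed
    then show ?thesis using hom_zero[OF assms(2) \<open>V \<in> Obj C\<close>] by blast
  qed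
  show ?thesis
    using transfer[OF _ assms(3,4) fg(1,2,4)] transfer[OF _ assms(4,3) fg(2,1,3)] by blast
qed

section \<open>Conflicts between edges\<close>

text \<open>Loops form the border row n, and the rectangle of [i, j] meets that row only in one
  corner, the lift of [i, i].\<close>

lemma reach_to_loop:
  "i \<in> {1..n} \<Longrightarrow> j \<in> {1..n} \<Longrightarrow> k \<in> {1..n} \<Longrightarrow> reach n (i, j) (k, k) \<longleftrightarrow> i = k"
  by (auto simp: reach_def cdist_def level_def split: if_splits)

text \<open>The rectangle of a loop degenerates to a segment: the end vertex has no room, while the
  start vertex runs through all n positions.\<close>

lemma reach_from_loop:
  "i \<in> {1..n} \<Longrightarrow> j \<in> {1..n} \<Longrightarrow> k \<in> {1..n} \<Longrightarrow> reach n (k, k) (i, j) \<longleftrightarrow> j = k"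
  by (auto simp: reach_def cdist_def level_def split: if_splits)

text \<open>\<open>conflict n x y\<close> says that \<open>Ext(x, y)\<close> is nonzero, by Serre duality as \<open>Hom(y, \<tau> x)\<close>.\<close>

definition conflict :: "nat \<Rightarrow> edge \<Rightarrow> edge \<Rightarrow> bool" where
  "conflict n x y \<longleftrightarrow> reach n y (gamma_tau n x)"

lemma conflict_loop_left:
  assumes "i \<in> {1..n}" "j \<in> {1..n}" "k \<in> {1..n}"
  shows "conflict n (k, k) (i, j) \<longleftrightarrow> i = prv n k"
  using reach_to_loop[OF assms(1,2) prv_mem[OF assms(3)]] by (simp add: conflict_def gamma_tau_def)

lemma conflict_loop_right:
  assumes "i \<in> {1..n}" "j \<in> {1..n}" "k \<in> {1..n}"
  shows "conflict n (i, j) (k, k) \<longleftrightarrow> prv n j = k"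
  using reach_from_loop[OF prv_mem[OF assms(1)] prv_mem[OF assms(2)] assms(3)]
  by (simp add: conflict_def gamma_tau_def)

text \<open>Retreating the end by one turns lengths from 1 to n into distances from 0 to n - 1; the
  convention that loops have level n makes this uniform.\<close>

lemma cdist_prv: "a \<in> {1..n} \<Longrightarrow> c \<in> {1..n} \<Longrightarrow> cdist n a (prv n c) = level n (a, c) - 1"
  by (auto simp: cdist_def prv_def level_def)

lemma level_swap: "i \<in> {1..n} \<Longrightarrow> j \<in> {1..n} \<Longrightarrow> i \<noteq> j \<Longrightarrow> level n (i, j) + level n (j, i) = n"
  by (auto simp: level_def)

text \<open>
  One extension group is nonzero if the levels of the two edges add up to at most \<open>n + 1\<close>, the
  other if they add up to at least \<open>n\<close>.
\<close>

lemma conflict_consecutive: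
  assumes "i \<in> {1..n}" "j \<in> {1..n}" "m \<in> {1..n}" "i \<noteq> j" "j \<noteq> m"
  shows "conflict n (i, j) (j, m) \<or> conflict n (j, m) (i, j)"
proof -
  have "1 \<le> level n x" if "x \<in> {i, j, m} \<times> {i, j, m}" for x
    using level_bounds[of x n] that assms by (auto simp: edges_def)
  then have pos: "1 \<le> level n (i, j)" "1 \<le> level n (j, i)" "1 \<le> level n (j, m)" "1 \<le> level n (m, j)"
    by simp_all
  have "conflict n (j, m) (i, j) \<longleftrightarrow> level n (i, j) - 1 < level n (i, j) \<and> level n (i, j) + (level n (j, m) - 1) \<le> n"
    using assms by (simp add: conflict_def gamma_tau_def reach_def cdist_prv del: atLeastAtMost_iff)
  \<comment> \<open>By \<open>level_swap\<close> the first inequality bounds the sum of the two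
    levels below by n; the second holds because [j, m] and its reverse have levels adding up to
    n.\<close>
  moreover have "conflict n (i, j) (j, m) \<longleftrightarrow> level n (j, i) - 1 < level n (j, m) \<and> level n (j, m) + (level n (m, j) - 1) \<le> n"
    using assms by (simp add: conflict_def gamma_tau_def reach_def cdist_prv del: atLeastAtMost_iff)
  ultimately show ?thesis
    using pos level_swap[OF assms(1,2,4)] level_swap[OF assms(2,3,5)] by linarith
qed

lemma nonloop_conflict_avoids_loops:
  assumes G: "G \<subseteq> edges n" "\<And>x y. x \<in> G \<Longrightarrow> y \<in> G \<Longrightarrow> \<not> conflict n x y"
    and ij: "i \<in> {1..n}" "j \<in> {1..n}" "i \<noteq> j"
    and compatible: "\<And>x. x \<in> G \<Longrightarrow> fst x \<noteq> snd x \<Longrightarrow> \<not> conflict n x (i, j) \<and> \<not> conflict n (i, j) x"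
    and touched: "\<And>v. v \<in> {i, j} \<Longrightarrow> \<exists>x\<in>G. fst x \<noteq> snd x \<and> (fst x = v \<or> snd x = v)"
    and x: "x \<in> G"
  shows "\<not> conflict n x (i, j) \<and> \<not> conflict n (i, j) x"
proof (cases "fst x = snd x")
  case False
  then show ?thesis using compatible x by blast
next
  case True
  then obtain k where k: "x = (k, k)" "k \<in> {1..n}"
    using x G(1) by (cases x) (auto simp: edges_def)
  have "\<not> conflict n (k, k) (i, j)"
  proof
    assume "conflict n (k, k) (i, j)"
    then have i: "i = prv n k" using conflict_loop_left ij k by blast
    obtain a b where e: "(a, b) \<in> G" "a \<noteq> b" "a = i \<or> b = i"
      using touched[of i] by auto
    have ab: "a \<in> {1..n}" "b \<in> {1..n}" using e(1) G(1) by (auto simp: edges_def)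
    have "a \<noteq> i"
      using conflict_loop_left[OF ab k(2)] G(2)[OF x e(1)] k(1) i by blast
    \<comment> \<open>So b = i, and the nonloop edges [a, i] and [i, j] are consecutive.\<close>
    then show False
      using conflict_consecutive[OF ab ij(2)] e ij(3) compatible[OF e(1)] by auto
  qed
  moreover have "\<not> conflict n (i, j) (k, k)"
  proof
    assume "conflict n (i, j) (k, k)"
    then have j: "prv n j = k" using conflict_loop_right ij k by blast
    obtain a b where e: "(a, b) \<in> G" "a \<noteq> b" "a = j \<or> b = j"
      using touched[of j] by auto
    have ab: "a \<in> {1..n}" "b \<in> {1..n}" using e(1) G(1) by (auto simp: edges_def)
    have "b \<noteq> j"
      using conflict_loop_right[OF ab k(2)] G(2)[OF e(1) x] k(1) j by blast
    then show False
      using conflict_consecutive[OF ij(1,2) ab(2)] e ij(3) compatible[OF e(1)] by auto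
  qed
  ultimately show ?thesis using k(1) by simp
qed

section \<open>Maximal rigid objects\<close>

text \<open>All that the final argument takes from shift and translate: their action on objects and
  the duality of vanishing.\<close>

locale rigidity = lin_category C
  for C :: "('o, 'm::ab_group_add, 'k::field) lincat" +
  fixes s t :: "'o \<Rightarrow> 'o"
  assumes shift_obj: "X \<in> Obj C \<Longrightarrow> s X \<in> Obj C"
    and translate_obj: "X \<in> Obj C \<Longrightarrow> t X \<in> Obj C"
    and Ext_zero_iff: "X \<in> Obj C \<Longrightarrow> Y \<in> Obj C \<Longrightarrow> Ext C s X Y = {0} \<longleftrightarrow> Hom C Y (t X) = {0}"
begin

lemma Ext_direct_sum_left:
  assumes "direct_sum C I A X" "Y \<in> Obj C"
  shows "Ext C s X Y = {0} \<longleftrightarrow> (\<forall>i\<in>I. Ext C s (A i) Y = {0})"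
  unfolding Ext_def by (rule direct_sum_hom_zero_iff[OF assms(1) shift_obj[OF assms(2)]])

text \<open>The object map \<open>s\<close> comes without any compatibility with direct sums, so
  duality first moves the decomposed object into the first argument of Hom.\<close>

lemma Ext_direct_sum_right:
  assumes "direct_sum C I A X" "Y \<in> Obj C"
  shows "Ext C s Y X = {0} \<longleftrightarrow> (\<forall>i\<in>I. Ext C s Y (A i) = {0})"
proof -
  have "A ` I \<subseteq> Obj C" "X \<in> Obj C" using assms(1) by (auto simp: direct_sum_def)
  then show ?thesis
    using direct_sum_hom_zero_iff[OF assms(1) translate_obj[OF assms(2)]] assms(2)
    by (simp add: Ext_zero_iff image_subset_iff)
qed

lemma ext_free_direct_sum:
  assumes "direct_sum C I A X"
  shows "ext_free C s X \<longleftrightarrow> (\<forall>i\<in>I. \<forall>j\<in>I. Ext C s (A i) (A j) = {0})"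
proof -
  have "A ` I \<subseteq> Obj C" "X \<in> Obj C" using assms by (auto simp: direct_sum_def)
  then show ?thesis
    unfolding ext_free_def
    using Ext_direct_sum_left[OF assms] Ext_direct_sum_right[OF assms]
    by (simp add: image_subset_iff) blast
qed

lemma ext_free_direct_sum2:
  assumes "direct_sum2 C A B X"
  shows "ext_free C s X \<longleftrightarrow> Ext C s A A = {0} \<and> Ext C s A B = {0} \<and> Ext C s B A = {0} \<and> Ext C s B B = {0}"
  using ext_free_direct_sum[OF assms[unfolded direct_sum2_def]] by (auto simp: UNIV_bool)

end

locale polygon_category = identified_category C n t \<Psi> + rigidity C s t
  for C :: "('o, 'm::ab_group_add, 'k::field) lincat" and n t \<Psi> s
begin

lemma Ext_E_zero_iff:
  assumes "x \<in> edges n" "y \<in> edges n"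
  shows "Ext C s (E x) (E y) = {0} \<longleftrightarrow> \<not> conflict n x y"
proof -
  note tau = gamma_tau_edge[OF assms(1)]
  have "Ext C s (E x) (E y) = {0} \<longleftrightarrow> Hom C (E y) (t (E x)) = {0}"
    using assms by (intro Ext_zero_iff E_obj)
  also have "\<dots> \<longleftrightarrow> Hom C (E y) (E (gamma_tau n x)) = {0}"
    using assms tau by (intro Hom_zero_isomorphic E_translate E_obj translate_obj)
  also have "\<dots> \<longleftrightarrow> \<not> conflict n x y"
    unfolding conflict_def by (rule Hom_zero_iff_not_reach[OF assms(2) tau])
  finally show ?thesis .
qed

lemma remove_loops_loop_free_maximal_rigid:
  assumes T: "maximal_rigid C s T" and "remove_loops n C E T T'"
  shows "loop_free_maximal_rigid n C s E T'"
proof -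
  obtain G where G: "G \<subseteq> edges n" "direct_sum C G E T"
    and T': "direct_sum C {x\<in>G. fst x \<noteq> snd x} E T'"
    using assms(2) unfolding remove_loops_def by blast
  let ?G' = "{x\<in>G. fst x \<noteq> snd x}"
  have G': "?G' \<subseteq> edges n" using G(1) by blast
  have T_obj: "T \<in> Obj C" using G(2) by (simp add: direct_sum_def)
  have T_free: "ext_free C s T" using T by (simp add: maximal_rigid_def rigid_def)
  have compatible: "\<not> conflict n x y" if "x \<in> G" "y \<in> G" for x y
  proof -
    have "Ext C s (E x) (E y) = {0}"
      using T_free that unfolding ext_free_direct_sum[OF G(2)] by simp
    then show ?thesis
      using Ext_E_zero_iff[OF subsetD[OF G(1) that(1)] subsetD[OF G(1) that(2)]] by simp
  qed
  have "ext_free C s T'"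
    unfolding ext_free_direct_sum[OF T'] using G' compatible by (simp add: Ext_E_zero_iff subset_iff)
  then have rigid: "rigid C s T'"
    unfolding rigid_def using direct_sum_basic[OF T' G'] by simp
  have loops: "\<not> summand C (E (i, i)) T'" if "i \<in> {1..n}" for i
    using summand_imp_mem[OF T' G', of "(i, i)"] that by (auto simp: edges_def)
  have contradiction: False if ij: "i \<in> {1..n}" "j \<in> {1..n}" "i \<noteq> j"
    and iso: "\<not> isolated n C E T' i" "\<not> isolated n C E T' j"
    and no: "\<not> summand C (E (i, j)) T'"
    and Y: "direct_sum2 C T' (E (i, j)) Y" "rigid C s Y" for i j Y
  proof -
    have e: "(i, j) \<in> edges n" using ij by (simp add: edges_def)
    \<comment> \<open>A nonloop edge of G survives the removal of loops and would be a summand of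
      T'.\<close>
    have "(i, j) \<notin> G"
      using mem_imp_summand[OF T' G', of "(i, j)"] no ij(3) by auto
    have Y_free: "Ext C s T' (E (i, j)) = {0}" "Ext C s (E (i, j)) T' = {0}"
      "Ext C s (E (i, j)) (E (i, j)) = {0}"
      using Y(2) unfolding rigid_def ext_free_direct_sum2[OF Y(1)] by simp_all
    have comp': "\<not> conflict n x (i, j) \<and> \<not> conflict n (i, j) x" if "x \<in> G" "fst x \<noteq> snd x" for x
    proof -
      have x: "x \<in> edges n" using that G(1) by blast
      have "Ext C s (E x) (E (i, j)) = {0}" "Ext C s (E (i, j)) (E x) = {0}"
        using Y_free(1,2) that
        unfolding Ext_direct_sum_left[OF T' E_obj[OF e]] Ext_direct_sum_right[OF T' E_obj[OF e]]
        by (cases x; simp)+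
      then show ?thesis
        using Ext_E_zero_iff[OF x e] Ext_E_zero_iff[OF e x] by simp
    qed
    have touched: "\<exists>x\<in>G. fst x \<noteq> snd x \<and> (fst x = v \<or> snd x = v)" if "v \<in> {i, j}" for v
    proof -
      have "\<not> isolated n C E T' v" using iso that by blast
      then obtain x where "x \<in> edges n" "summand C (E x) T'" "fst x = v \<or> snd x = v"
        unfolding isolated_def by blast
      then show ?thesis using summand_imp_mem[OF T' G', of x] by auto
    qed
    have all: "\<not> conflict n x (i, j) \<and> \<not> conflict n (i, j) x" if "x \<in> G" for x
      by (rule nonloop_conflict_avoids_loops[OF G(1) compatible ij comp' touched that])
    \<comment> \<open>The given Y extends T' only. Maximality concerns sums of T with [i, j], so one
      is formed here and its Ext groups are checked edge by edge.\<close>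
    obtain Z where Z: "direct_sum2 C T (E (i, j)) Z"
      by (rule direct_sum2_exists[OF T_obj E_obj[OF e]])
    have "ext_free C s Z"
      unfolding ext_free_direct_sum2[OF Z]
    proof (intro conjI)
      show "Ext C s T T = {0}" using T_free by (simp add: ext_free_def)
      show "Ext C s (E (i, j)) (E (i, j)) = {0}" by (rule Y_free(3))
      show "Ext C s T (E (i, j)) = {0}"
        unfolding Ext_direct_sum_left[OF G(2) E_obj[OF e]] using all Ext_E_zero_iff[OF subsetD[OF G(1)] e]
        by simp
      show "Ext C s (E (i, j)) T = {0}"
        unfolding Ext_direct_sum_right[OF G(2) E_obj[OF e]] using all Ext_E_zero_iff[OF e subsetD[OF G(1)]]
        by simp
    qed
    then have "summand C (E (i, j)) T"
      using T Z E_indecomposable[OF e] unfolding maximal_rigid_def by blast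
    then show False
      using summand_imp_mem[OF G(2,1) e] \<open>(i, j) \<notin> G\<close> by simp
  qed
  show ?thesis
    unfolding loop_free_maximal_rigid_def
  proof (intro conjI ballI notI)
    show "rigid C s T'" by (rule rigid)
    show False if "i \<in> {1..n}" "summand C (E (i, i)) T'" for i
      using loops that by simp
    assume "\<exists>i\<in>{1..n}. \<exists>j\<in>{1..n}. i \<noteq> j \<and> \<not> isolated n C E T' i \<and> \<not> isolated n C E T' j \<and>
      \<not> summand C (E (i, j)) T' \<and> (\<exists>Y. direct_sum2 C T' (E (i, j)) Y \<and> rigid C s Y)"
    then show False by (elim bexE exE conjE) (rule contradiction)
  qed
qed

end

theorem mainTheorem4:
  fixes n :: nat
    and Q :: "('v, 'a) quiver"
    and D :: "('o, 'm::ab_group_add, 'k::alg_closed_field) lincat"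
    and L :: "(('v, 'a, 'k) rcomplex, 'o, ('v, 'k) cmap, 'm) lfunctor"
    and \<Sigma> \<tau> :: "('o, 'o, 'm, 'm) lfunctor"
    and \<Psi> :: "(edge, 'o, edge list \<Rightarrow> 'k, int \<Rightarrow> 'm) lfunctor"
    and T T' :: 'o
  assumes "dynkin_A n Q"
    and "bounded_derived_category Q D L"
    and "is_shift Q D L \<Sigma>"
    and "is_ar_translate D \<Sigma> \<tau>"
    and "identification n (CQ D \<Sigma> \<tau>) (fobj \<tau>) \<Psi>"
    and "maximal_rigid (CQ D \<Sigma> \<tau>) (fobj \<Sigma>) T"
    and "remove_loops n (CQ D \<Sigma> \<tau>) (fobj \<Psi>) T T'"
  shows "loop_free_maximal_rigid n (CQ D \<Sigma> \<tau>) (fobj \<Sigma>) (fobj \<Psi>) T'"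
proof -
  interpret D: serre_orbit D \<Sigma> \<tau>
    using assms(2-4)
    by unfold_locales (simp_all add: bounded_derived_category_def is_shift_def is_ar_translate_def)
  note CQ = CQ_def[of D \<Sigma> \<tau>]
  \<comment> \<open>On objects, the shift and translate of the orbit category are those of \<Sigma>
    and \<tau> in D.\<close>
  interpret C: polygon_category "CQ D \<Sigma> \<tau>" n "fobj \<tau>" \<Psi> "fobj \<Sigma>"
  proof unfold_locales
    show "linear_category (CQ D \<Sigma> \<tau>)"
      unfolding CQ by (rule D.orbit_linear_category)
    show "identification n (CQ D \<Sigma> \<tau>) (fobj \<tau>) \<Psi>" by (rule assms(5))
    fix X assume "X \<in> Obj (CQ D \<Sigma> \<tau>)"
    then have X: "X \<in> Obj D" by (simp add: CQ)
    show "fobj \<Sigma> X \<in> Obj (CQ D \<Sigma> \<tau>)" "fobj \<tau> X \<in> Obj (CQ D \<Sigma> \<tau>)"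
      using X by (simp_all add: CQ)
    fix Y assume "Y \<in> Obj (CQ D \<Sigma> \<tau>)"
    then have Y: "Y \<in> Obj D" by (simp add: CQ)
    show "Ext (CQ D \<Sigma> \<tau>) (fobj \<Sigma>) X Y = {0} \<longleftrightarrow> Hom (CQ D \<Sigma> \<tau>) Y (fobj \<tau> X) = {0}"
      unfolding Ext_def CQ by (rule D.orbit_Ext_zero_iff[OF X Y])
  qed
  show ?thesis
    by (rule C.remove_loops_loop_free_maximal_rigid[OF assms(6,7)])
qed

end
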